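(* For each $\Omega'\Subset\Omega$ there exist constants $c\in(0,1]$ and $\delta_0>0$, depending only on $\Omega'$ and the data, such that for every $X\in\mathfrak F(u_0)\cap\Omega'$ and every $0<\delta\le\delta_0$, $$\frac{\mathscr L^N\big(B_\delta(X)\cap\{u_0>0\}\big)}{\mathscr L^N(B_\delta(X))}\ge c.$$
   Context: Standing setting. $N\ge2$; $\Omega\subset\mathbb{R}^N$ is a bounded Lipschitz domain; $f\in C(\partial\Omega)$, $f\ge0$; $0<\gamma<1$ is fixed and $\alpha:=1+\frac{\gamma}{2-\gamma}$. $F:\mathrm{Sym}(N)\to\mathbb{R}$, $F\in C^1(\mathrm{Sym}(N)\setminus\{0\})$, $F(0)=0$, is uniformly elliptic: there are $0<\lambda\le\Lambda$ with $F(M+P)\le F(M)+\Lambda\|P^+\|-\lambda\|P^-\|$ for all $M,P\in\mathrm{Sym}(N)$. Moreover $F$ is assumed to have a priori interior $C^{2,\tau}$ estimates for some $\tau\in(0,1)$. Fix $\rho\in C_0^\infty$ with $\rho\ge0$, $\operatorname{supp}\rho\subset[0,1]$, $\int_0^1\rho=1$, and fix $\sigma_0\in(0,\tfrac12)$. For $\varepsilon>0$ set $B_\varepsilon(t)=\int_0^{(t-\sigma_0\varepsilon^\alpha)/\varepsilon^\alpha}\rho(s)\,ds$ and $\beta_\varepsilon(t)=\gamma t^{\gamma-1}B_\varepsilon(t)$ for $t>0$, $\beta_\varepsilon(t)=0$ for $t\le0$. Problem $(E_\varepsilon)$: $F(D^2u)=\beta_\varepsilon(u)$ in $\Omega$ in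 the viscosity sense, $u=f$ on $\partial\Omega$. Minimal solution: let $\zeta_\varepsilon=\sup\beta_\varepsilon$, let $u_\star$ be the viscosity solution of $F(D^2u)=\zeta_\varepsilon$ in $\Omega$, $u=f$ on $\partial\Omega$, and $u^\star$ the viscosity solution of $F(D^2u)=0$ in $\Omega$, $u=f$ on $\partial\Omega$; define $u_\varepsilon(x)=\inf\{w(x): w\in C(\overline\Omega),\ u_\star\le w\le u^\star,\ w \text{ a viscosity supersolution of } F(D^2w)=\beta_\varepsilon(w)\}$. Limiting function: $u_0$ denotes a limit $u_0=\lim_{k\to\infty}u_{\varepsilon_k}$, locally uniformly in $C^1$ on $\Omega$, along some sequence $\varepsilon_k\to0$ of minimal solutions. $\mathfrak F(u_0)=\partial\{u_0>0\}\cap\Omega$. *)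

theory Defs
  imports "HOL-Analysis.Analysis"
begin

definition lipschitz_domain :: "(real^'n) set \<Rightarrow> bool" where
  "lipschitz_domain \<Omega> \<longleftrightarrow> open \<Omega> \<and> connected \<Omega> \<and> bounded \<Omega> \<and> \<Omega> \<noteq> {} \<and>
     (\<forall>p\<in>frontier \<Omega>. \<exists>e r L g. norm e = 1 \<and> r > 0 \<and>
        lipschitz_on L {y. y \<bullet> e = 0} (g :: real^'n \<Rightarrow> real) \<and>
        \<Omega> \<inter> ball p r = {x \<in> ball p r. g (x - (x \<bullet> e) *\<^sub>R e) < x \<bullet> e})"

definition sym_mat :: "real^'n^'n \<Rightarrow> bool" where
  "sym_mat M \<longleftrightarrow> transpose M = M"

definition psd_mat :: "real^'n^'n \<Rightarrow> bool" where
  "psd_mat M \<longleftrightarrow> sym_mat M \<and> (\<forall>x. 0 \<le> x \<bullet> (M *v x))"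

definition pos_part :: "real^'n^'n \<Rightarrow> real^'n^'n" where
  "pos_part P = (THE A. \<exists>B. P = A - B \<and> psd_mat A \<and> psd_mat B \<and> A ** B = 0)"

definition neg_part :: "real^'n^'n \<Rightarrow> real^'n^'n" where
  "neg_part P = pos_part (- P)"

definition mnorm :: "real^'n^'n \<Rightarrow> real" where
  "mnorm M = onorm (\<lambda>x. M *v x)"

definition unif_elliptic :: "(real^'n^'n \<Rightarrow> real) \<Rightarrow> real \<Rightarrow> real \<Rightarrow> bool" where
  "unif_elliptic F lam Lam \<longleftrightarrow> 0 < lam \<and> lam \<le> Lam \<and>
     (\<forall>M P. sym_mat M \<longrightarrow> sym_mat P \<longrightarrow>
        F (M + P) \<le> F M + Lam * mnorm (pos_part P) - lam * mnorm (neg_part P))"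

definition C1_on_sym_minus0 :: "(real^'n^'n \<Rightarrow> real) \<Rightarrow> bool" where
  "C1_on_sym_minus0 F \<longleftrightarrow> (\<exists>F' :: real^'n^'n \<Rightarrow> ((real^'n^'n) \<Rightarrow>\<^sub>L real).
     (\<forall>M \<in> {M. sym_mat M \<and> M \<noteq> 0}. (F has_derivative blinfun_apply (F' M)) (at M within {M. sym_mat M \<and> M \<noteq> 0}))
     \<and> continuous_on {M. sym_mat M \<and> M \<noteq> 0} F')"

definition C2_on :: "(real^'n) set \<Rightarrow> (real^'n \<Rightarrow> real) \<Rightarrow> (real^'n \<Rightarrow> real^'n) \<Rightarrow> (real^'n \<Rightarrow> real^'n^'n) \<Rightarrow> bool" where
  "C2_on U w Dw D2w \<longleftrightarrow>
     (\<forall>y\<in>U. (w has_derivative (\<lambda>h. Dw y \<bullet> h)) (at y) \<and> (Dw has_derivative (\<lambda>h. D2w y *v h)) (at y))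
     \<and> continuous_on U D2w"

definition interior_C2tau_estimates :: "(real^'n^'n \<Rightarrow> real) \<Rightarrow> real \<Rightarrow> bool" where
  "interior_C2tau_estimates F \<tau> \<longleftrightarrow> (\<exists>C>0. \<forall>w Dw D2w.
     C2_on (ball 0 1) w Dw D2w \<and> (\<forall>x\<in>ball 0 1. F (D2w x) = 0) \<and> bounded (w ` ball 0 1) \<longrightarrow>
     (let K = (SUP x\<in>ball 0 1. \<bar>w x\<bar>) in
       (\<forall>x\<in>ball 0 (1/2). \<bar>w x\<bar> + norm (Dw x) + mnorm (D2w x) \<le> C * K) \<and>
       (\<forall>x\<in>ball 0 (1/2). \<forall>y\<in>ball 0 (1/2).
          mnorm (D2w x - D2w y) \<le> C * K * dist x y powr \<tau>)))"

definition visc_super :: "(real^'n^'n \<Rightarrow> real) \<Rightarrow> (real \<Rightarrow> real) \<Rightarrow> (real^'n) set \<Rightarrow> (real^'n \<Rightarrow> real) \<Rightarrow> bool" where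
  "visc_super F g U u \<longleftrightarrow> (\<forall>x0\<in>U. \<forall>\<phi> D\<phi> H\<phi> r. r > 0 \<and> ball x0 r \<subseteq> U \<and> C2_on (ball x0 r) \<phi> D\<phi> H\<phi>
      \<and> \<phi> x0 = u x0 \<and> (\<forall>y\<in>ball x0 r. \<phi> y \<le> u y) \<longrightarrow> F (H\<phi> x0) \<le> g (u x0))"

definition visc_sub :: "(real^'n^'n \<Rightarrow> real) \<Rightarrow> (real \<Rightarrow> real) \<Rightarrow> (real^'n) set \<Rightarrow> (real^'n \<Rightarrow> real) \<Rightarrow> bool" where
  "visc_sub F g U u \<longleftrightarrow> (\<forall>x0\<in>U. \<forall>\<phi> D\<phi> H\<phi> r. r > 0 \<and> ball x0 r \<subseteq> U \<and> C2_on (ball x0 r) \<phi> D\<phi> H\<phi>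
      \<and> \<phi> x0 = u x0 \<and> (\<forall>y\<in>ball x0 r. u y \<le> \<phi> y) \<longrightarrow> g (u x0) \<le> F (H\<phi> x0))"

definition visc_sol :: "(real^'n^'n \<Rightarrow> real) \<Rightarrow> (real \<Rightarrow> real) \<Rightarrow> (real^'n) set \<Rightarrow> (real^'n \<Rightarrow> real) \<Rightarrow> bool" where
  "visc_sol F g U u \<longleftrightarrow> continuous_on U u \<and> visc_super F g U u \<and> visc_sub F g U u"

definition dirichlet_sol :: "(real^'n^'n \<Rightarrow> real) \<Rightarrow> (real \<Rightarrow> real) \<Rightarrow> (real^'n \<Rightarrow> real) \<Rightarrow> (real^'n) set \<Rightarrow> (real^'n \<Rightarrow> real) \<Rightarrow> bool" where
  "dirichlet_sol F g f \<Omega> u \<longleftrightarrow> continuous_on (closure \<Omega>) u \<and> visc_sol F g \<Omega> u \<and> (\<forall>x\<in>frontier \<Omega>. u x = f x)"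

definition smooth_fun :: "(real \<Rightarrow> real) \<Rightarrow> bool" where
  "smooth_fun \<rho> \<longleftrightarrow> (\<forall>k x. ((deriv ^^ k) \<rho>) differentiable (at x))"

definition alpha_exp :: "real \<Rightarrow> real" where
  "alpha_exp \<gamma> = 1 + \<gamma> / (2 - \<gamma>)"

text \<open>B_eps(t) = int_0^{(t - sigma0 eps^alpha)/eps^alpha} rho. When the upper limit s is negative,
  the interval {0..s} is empty, giving 0, which agrees with the oriented integral since rho vanishes
  on the negative half-line.\<close>
definition B_eps :: "real \<Rightarrow> (real \<Rightarrow> real) \<Rightarrow> real \<Rightarrow> real \<Rightarrow> real \<Rightarrow> real" where
  "B_eps \<gamma> \<rho> \<sigma>0 \<epsilon> t =
     integral {0 .. (t - \<sigma>0 * \<epsilon> powr alpha_exp \<gamma>) / \<epsilon> powr alpha_exp \<gamma>} \<rho>"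

definition beta_eps :: "real \<Rightarrow> (real \<Rightarrow> real) \<Rightarrow> real \<Rightarrow> real \<Rightarrow> real \<Rightarrow> real" where
  "beta_eps \<gamma> \<rho> \<sigma>0 \<epsilon> t = (if t > 0 then \<gamma> * t powr (\<gamma> - 1) * B_eps \<gamma> \<rho> \<sigma>0 \<epsilon> t else 0)"

definition minimal_solution :: "(real^'n^'n \<Rightarrow> real) \<Rightarrow> (real^'n \<Rightarrow> real) \<Rightarrow> (real \<Rightarrow> real) \<Rightarrow> (real^'n) set \<Rightarrow> (real^'n \<Rightarrow> real) \<Rightarrow> bool" where
  "minimal_solution F f \<beta> \<Omega> u \<longleftrightarrow> (\<exists>ulo uhi.
     dirichlet_sol F (\<lambda>_. Sup (range \<beta>)) f \<Omega> ulo \<and>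
     dirichlet_sol F (\<lambda>_. 0) f \<Omega> uhi \<and>
     (\<forall>x\<in>closure \<Omega>. u x = Inf {w x | w. continuous_on (closure \<Omega>) w \<and>
         (\<forall>y\<in>closure \<Omega>. ulo y \<le> w y \<and> w y \<le> uhi y) \<and> visc_super F \<beta> \<Omega> w}))"

definition C1_loc_conv :: "(real^'n) set \<Rightarrow> (nat \<Rightarrow> real^'n \<Rightarrow> real) \<Rightarrow> (real^'n \<Rightarrow> real) \<Rightarrow> bool" where
  "C1_loc_conv \<Omega> u u0 \<longleftrightarrow> (\<exists>Du Du0.
     (\<forall>k. \<forall>x\<in>\<Omega>. (u k has_derivative (\<lambda>h. Du k x \<bullet> h)) (at x)) \<and>
     (\<forall>k. continuous_on \<Omega> (Du k)) \<and>
     (\<forall>x\<in>\<Omega>. (u0 has_derivative (\<lambda>h. Du0 x \<bullet> h)) (at x)) \<and>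
     (\<forall>K. compact K \<and> K \<subseteq> \<Omega> \<longrightarrow>
        uniform_limit K u u0 sequentially \<and> uniform_limit K Du Du0 sequentially))"

end

theory Submission
  imports Defs
begin

text \<open>
  Let \<open>\<alpha> = 2 / (2 - \<gamma>)\<close>. Minimality lets \<open>u\<^sub>\<epsilon>\<close> be compared from above with every nonnegative supersolution
  lying above it on a sphere, without a comparison principle between viscosity solutions.
  Against a smooth radial barrier this gives nondegeneracy: near a free boundary point \<open>u0\<close> reaches \<open>A r\<^sup>\<alpha>\<close>
  on spheres of radius \<open>r\<close>. Against \<open>inf\<^sub>y (u\<^sub>\<epsilon>(y) + p \<bar>x - y\<bar>) + C \<bar>x\<bar>\<^sup>2\<close> with a strictly concave penalty \<open>p\<close>
  (an Ishii-Lions argument without the theorem on sums) it gives a scale-invariant Lipschitz bound from below;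
  the singular right-hand side is harmless there because a subsolution sliding outwards from a ball keeps
  \<open>u\<^sub>\<epsilon>(y)\<close> comparable to the size of the penalty. The two bounds and a point selection give the growth
  \<open>u0 \<le> C d\<^sup>\<alpha>\<close> at distance \<open>d\<close> from a zero, and with nondegeneracy a ball of radius comparable to
  \<open>\<delta>\<close> inside \<open>B\<^sub>\<delta>(X) \<inter> {u0 > 0}\<close>.
\<close>

section \<open>Matrices and ellipticity\<close>

text \<open>The approximating equations enter only through bounds uniform in \<epsilon>:
  \<open>0 \<le> \<beta> s\<close>, \<open>\<beta> 0 \<le> 0\<close>,
  \<open>\<beta> s \<le> \<gamma> * s powr (\<gamma> - 1)\<close> for positive \<open>s\<close>,
  with equality above a threshold that tends to 0. Beyond it \<beta> decreases in the unknown, the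
  wrong monotonicity for a comparison principle. Minimality can stand in for one because the lower
  obstacle becomes nonpositive away from the boundary as the supremum of \<beta> blows up, so that
  it does not exclude nonnegative competitors. The quantity
  \<open>m powr (\<gamma> - 1) * D\<^sup>2 / m\<close> compares reaction and diffusion at size
  \<open>m\<close> and radius \<open>D\<close>. It is invariant under replacing u(x) by
  s^(-\<alpha>) u(s x), and its boundedness is the hypothesis of both interior estimates.
  Nondegeneracy alone yields a single point of height of order \<delta>^\<alpha>. To keep u0
  positive on a ball of radius comparable to \<delta> around it, the Lipschitz constant has to be of
  order \<delta>^(\<alpha>-1), which requires an upper bound of the same order as the height; that
  is what the growth estimate supplies.\<close>

definition outer :: "real^'n \<Rightarrow> real^'n \<Rightarrow> real^'n^'n" where
  "outer a b = (\<chi> i j. a$i * b$j)"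

lemma outer_mult_vec [simp]: "outer a b *v x = (b \<bullet> x) *\<^sub>R a"
  by (simp add: outer_def matrix_vector_mult_def vec_eq_iff inner_vec_def sum_distrib_left mult_ac
      sum_distrib_right)

lemma transpose_outer: "transpose (outer a b) = outer b a"
  by (simp add: outer_def transpose_def vec_eq_iff mult.commute)

lemma outer_scaleR: "outer (s *\<^sub>R a) (s *\<^sub>R a) = s\<^sup>2 *\<^sub>R outer a a"
  by (simp add: outer_def vec_eq_iff power2_eq_square)

lemma transpose_add: "transpose (A + B) = transpose A + transpose (B :: real^'n^'m)"
  by (simp add: transpose_def vec_eq_iff)

lemma transpose_minus: "transpose (- B) = - transpose (B :: real^'n^'m)"
  by (simp add: transpose_def vec_eq_iff)

lemma transpose_diff: "transpose (A - B) = transpose A - transpose (B :: real^'n^'m)"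
  by (simp add: transpose_def vec_eq_iff)

lemma minus_mult_vec: "(- A) *v x = - (A *v (x :: real^'n))"
  by (metis add.inverse_unique add.right_inverse matrix_vector_mult_0 matrix_vector_mult_add_rdistrib)

lemma scaleR_mult_vec: "(k *\<^sub>R A) *v x = k *\<^sub>R (A *v (x :: real^'n))"
  by (simp add: scaleR_matrix_vector_assoc)

lemmas mat_vec_simps = minus_mult_vec scaleR_mult_vec matrix_vector_mult_add_rdistrib
  matrix_vector_mult_diff_rdistrib matrix_vector_right_distrib matrix_vector_mult_diff_distrib
  matrix_vector_mult_scaleR

lemma sym_mat_add: "sym_mat A \<Longrightarrow> sym_mat B \<Longrightarrow> sym_mat (A + B)"
  by (simp add: sym_mat_def transpose_add)

lemma sym_mat_diff: "sym_mat A \<Longrightarrow> sym_mat B \<Longrightarrow> sym_mat (A - B)"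
  by (simp add: sym_mat_def transpose_diff)

lemma sym_mat_uminus: "sym_mat A \<Longrightarrow> sym_mat (- A)"
  by (simp add: sym_mat_def transpose_minus)

lemma sym_mat_scaleR: "sym_mat A \<Longrightarrow> sym_mat (k *\<^sub>R A)"
  by (simp add: sym_mat_def transpose_scalar)

lemma sym_mat_outer: "sym_mat (outer a a)"
  by (simp add: sym_mat_def transpose_outer)

lemma sym_mat_0: "sym_mat 0"
  by (simp add: sym_mat_def transpose_def vec_eq_iff)

lemma sym_mat_mat: "sym_mat (mat k)"
  by (simp add: sym_mat_def)

lemmas sym_mat_intros = sym_mat_add sym_mat_diff sym_mat_uminus sym_mat_scaleR sym_mat_outer
  sym_mat_0 sym_mat_mat

lemma sym_mat_inner:
  assumes "sym_mat A" shows "x \<bullet> (A *v y) = (A *v x) \<bullet> y"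
  using assms by (metis dot_lmul_matrix sym_mat_def transpose_matrix_vector)

lemma sym_matI:
  assumes "\<And>x y. x \<bullet> (A *v y) = (A *v x) \<bullet> y" shows "sym_mat A"
proof -
  have "(A *v x) \<bullet> y = (transpose A *v x) \<bullet> y" for x y
    using assms by (metis dot_lmul_matrix transpose_matrix_vector)
  then have "A *v x = transpose A *v x" for x
    by (metis vector_eq_rdot)
  then show ?thesis
    unfolding sym_mat_def by (metis matrix_eq)
qed

section \<open>Semidefinite matrices and their positive parts\<close>

lemma psd_mat_sym: "psd_mat P \<Longrightarrow> sym_mat P"
  by (simp add: psd_mat_def)

lemma psd_mat_outer: "0 \<le> k \<Longrightarrow> psd_mat (k *\<^sub>R outer a a)"
  by (simp add: psd_mat_def sym_mat_intros mat_vec_simps inner_commute mult.assoc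
      flip: power2_eq_square)

lemma psd_mat_scaled_id: "0 \<le> k \<Longrightarrow> psd_mat (k *\<^sub>R mat 1)"
  by (simp add: psd_mat_def sym_mat_intros mat_vec_simps)

text \<open>Moving \<open>z\<close> by a small multiple of \<open>- (B *v z)\<close> lowers the
  quadratic form at first order and raises it only at second order, so a nonzero image would make
  the form negative.\<close>

lemma psd_mat_null_vector:
  assumes B: "psd_mat B" and z: "z \<bullet> (B *v z) = 0" shows "B *v z = 0"
proof (rule ccontr)
  assume ne: "B *v z \<noteq> 0"
  define y where "y = B *v z"
  define Q where "Q = y \<bullet> (B *v y)"
  have Q0: "Q \<ge> 0" using B by (simp add: Q_def psd_mat_def)
  have yy: "y \<bullet> y > 0" using ne by (simp add: y_def)
  \<comment> \<open>The \<open>+ 1\<close> keeps the denominator positive when \<open>Q = 0\<close>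
    and still gives \<open>s * Q \<le> y \<bullet> y\<close>.\<close>
  define s where "s = (y \<bullet> y) / (Q + 1)"
  have s: "s > 0" using yy Q0 by (simp add: s_def)
  have sy: "z \<bullet> (B *v y) = y \<bullet> y"
    using sym_mat_inner[OF psd_mat_sym[OF B]] by (simp add: y_def)
  have "0 \<le> (z - s *\<^sub>R y) \<bullet> (B *v (z - s *\<^sub>R y))"
    using B by (simp add: psd_mat_def)
  also have "\<dots> = s\<^sup>2 * Q - 2 * s * (y \<bullet> y)"
    using z sy by (simp add: mat_vec_simps algebra_simps inner_diff Q_def y_def[symmetric] power2_eq_square)
  also have "\<dots> = s * (s * Q - 2 * (y \<bullet> y))" by (simp add: power2_eq_square algebra_simps)
  finally have "s * Q \<ge> 2 * (y \<bullet> y)" using s by (simp add: zero_le_mult_iff)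
  moreover have "s * Q \<le> y \<bullet> y"
    using Q0 yy by (simp add: s_def field_simps)
  ultimately show False using yy by simp
qed

text \<open>\<open>pos_part\<close> is a definite description, so it needs uniqueness of the
  orthogonal splitting; for semidefinite \<open>P\<close> this follows without diagonalisation.
  Since \<open>B ** P = - (B ** B)\<close>, the form of \<open>P\<close> at \<open>B *v y\<close> is
  minus the form of \<open>B\<close> there, and both are nonnegative.\<close>

lemma psd_mat_decomp_unique:
  assumes P: "psd_mat P" "P = A - B" and A: "psd_mat A" and B: "psd_mat B" and AB: "B ** A = 0"
  shows "B = 0"
proof -
  have "B *v y = 0" for y
  proof -
    have BP: "B *v (P *v z) = - (B *v (B *v z))" for z
    proof -
      have "B *v (A *v z) = 0" by (simp add: matrix_vector_mul_assoc AB)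
      then show ?thesis by (simp add: P(2) mat_vec_simps)
    qed
    define z where "z = B *v y"
    have "z \<bullet> (P *v z) = y \<bullet> (B *v (P *v z))"
      using sym_mat_inner[OF psd_mat_sym[OF B]] by (simp add: z_def)
    also have "\<dots> = - (z \<bullet> (B *v z))"
      using sym_mat_inner[OF psd_mat_sym[OF B]] by (simp add: BP z_def)
    finally have "z \<bullet> (B *v z) = 0"
      using P(1) B by (metis antisym neg_0_le_iff_le psd_mat_def)
    then have "B *v z = 0" using B by (rule psd_mat_null_vector[rotated])
    then have "z \<bullet> z = 0"
      using sym_mat_inner[OF psd_mat_sym[OF B], of y z] by (simp add: z_def)
    then show ?thesis by (simp add: z_def)
  qed
  then show ?thesis by (metis matrix_eq matrix_vector_mult_0)
qed

lemma psd_mat_prod_commute_zero: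
  assumes "psd_mat A" "psd_mat B" "A ** B = 0" shows "B ** A = 0"
proof -
  have "transpose (A ** B) = B ** A"
    using assms(1,2) by (simp add: matrix_transpose_mul psd_mat_def sym_mat_def)
  then show ?thesis using assms(3) by (simp add: sym_mat_0[unfolded sym_mat_def])
qed

lemma psd_mat_0: "psd_mat 0"
  using psd_mat_scaled_id[of 0] by simp

lemma pos_part_psd:
  assumes P: "psd_mat P" shows "pos_part P = P"
  unfolding pos_part_def
proof (rule the_equality)
  show "\<exists>B. P = P - B \<and> psd_mat P \<and> psd_mat B \<and> P ** B = 0"
    using P psd_mat_0 by (intro exI[of _ 0]) simp
next
  fix A assume "\<exists>B. P = A - B \<and> psd_mat A \<and> psd_mat B \<and> A ** B = 0"
  then obtain B where B: "P = A - B" "psd_mat A" "psd_mat B" "A ** B = 0" by blast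
  then have "B = 0"
    using psd_mat_decomp_unique[OF P] psd_mat_prod_commute_zero by blast
  then show "A = P" using B by simp
qed

text \<open>Together with \<open>pos_part_psd\<close> this evaluates the description for increments
  of definite sign; all later uses of ellipticity are reduced to such increments.\<close>

lemma pos_part_uminus_psd:
  assumes P: "psd_mat P" shows "pos_part (- P) = 0"
  unfolding pos_part_def
proof (rule the_equality)
  show "\<exists>B. - P = 0 - B \<and> psd_mat (0::real^'a^'a) \<and> psd_mat B \<and> 0 ** B = 0"
    using P psd_mat_0 by (intro exI[of _ P]) simp
next
  fix A assume "\<exists>B. - P = A - B \<and> psd_mat A \<and> psd_mat B \<and> A ** B = 0"
  then obtain B where B: "- P = A - B" "psd_mat A" "psd_mat B" "A ** B = 0" by blast
  then have "P = B - A" by (metis minus_diff_eq minus_minus)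
  then show "A = 0"
    using psd_mat_decomp_unique[OF P] B by blast
qed

lemma mnorm_0 [simp]: "mnorm 0 = 0"
  by (simp add: mnorm_def onorm_zero)

lemma mnorm_scaled_id: "0 \<le> k \<Longrightarrow> mnorm (k *\<^sub>R mat 1) = k"
  by (simp add: mnorm_def mat_vec_simps onorm_scaleR[OF bounded_linear_ident] onorm_id)

lemma mnorm_le: "(\<And>x. norm (M *v x) \<le> k * norm x) \<Longrightarrow> mnorm M \<le> k"
  unfolding mnorm_def by (rule onorm_le)

lemma le_mnorm: "norm (M *v x) \<le> mnorm M * norm x"
  unfolding mnorm_def by (intro onorm matrix_vector_mul_bounded_linear)

lemma mnorm_nonneg: "0 \<le> mnorm M"
  unfolding mnorm_def by (intro onorm_pos_le matrix_vector_mul_bounded_linear)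

lemma mnorm_outer: "0 \<le> k \<Longrightarrow> mnorm (k *\<^sub>R outer a a) = k * (a \<bullet> a)"
proof (rule antisym)
  assume k: "0 \<le> k"
  show "mnorm (k *\<^sub>R outer a a) \<le> k * (a \<bullet> a)"
  proof (rule mnorm_le)
    fix x
    have "k * \<bar>a \<bullet> x\<bar> * norm a \<le> k * (norm a * norm x) * norm a"
      using k Cauchy_Schwarz_ineq2 by (intro mult_right_mono mult_left_mono) auto
    then show "norm ((k *\<^sub>R outer a a) *v x) \<le> k * (a \<bullet> a) * norm x"
      using k by (simp add: mat_vec_simps abs_mult dot_square_norm power2_eq_square mult_ac)
  qed
  show "k * (a \<bullet> a) \<le> mnorm (k *\<^sub>R outer a a)"
  proof (cases "a = 0")
    case False
    then show ?thesis
      using le_mnorm[of "k *\<^sub>R outer a a" a] k by (simp add: mat_vec_simps)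
  qed (simp add: mnorm_nonneg)
qed

section \<open>One-sided bounds from uniform ellipticity\<close>

locale elliptic =
  fixes F :: "real^'n^'n \<Rightarrow> real" and lam Lam :: real
  assumes unif: "unif_elliptic F lam Lam" and F0: "F 0 = 0"
begin

lemma lam_pos: "0 < lam" and lam_le_Lam: "lam \<le> Lam"
  using unif by (auto simp: unif_elliptic_def)

lemma Lam_pos: "0 < Lam"
  using lam_pos lam_le_Lam by simp

lemma F_add_psd_le:
  assumes "sym_mat M" "psd_mat P" shows "F (M + P) \<le> F M + Lam * mnorm P"
  using unif assms psd_mat_sym
  by (force simp: unif_elliptic_def neg_part_def pos_part_psd pos_part_uminus_psd)

lemma F_add_psd_ge:
  assumes "sym_mat M" "psd_mat P" shows "F M + lam * mnorm P \<le> F (M + P)"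
proof -
  \<comment> \<open>Ellipticity with base \<open>M + P\<close> and increment \<open>- P\<close>,
    read backwards, is a lower bound for \<open>F (M + P)\<close>.\<close>
  have "F ((M + P) + (- P)) \<le> F (M + P) + Lam * mnorm (pos_part (- P)) - lam * mnorm (neg_part (- P))"
    using unif assms psd_mat_sym sym_mat_intros by (metis unif_elliptic_def)
  then show ?thesis
    using assms by (simp add: neg_part_def pos_part_psd pos_part_uminus_psd)
qed

lemma F_mono:
  assumes "sym_mat M" "psd_mat P" shows "F M \<le> F (M + P)"
proof -
  have "0 \<le> lam * mnorm P" using lam_pos mnorm_nonneg[of P] by simp
  then show ?thesis using F_add_psd_ge[OF assms] by simp
qed

lemma F_scaled_id_le: "0 \<le> k \<Longrightarrow> F (k *\<^sub>R mat 1) \<le> Lam * k"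
  using F_add_psd_le[OF sym_mat_0 psd_mat_scaled_id, of k] F0 by (simp add: mnorm_scaled_id)

lemma F_scaled_id_ge: "0 \<le> k \<Longrightarrow> lam * k \<le> F (k *\<^sub>R mat 1)"
  using F_add_psd_ge[OF sym_mat_0 psd_mat_scaled_id, of k] F0 by (simp add: mnorm_scaled_id)

lemma F_uminus_scaled_id_le: "0 \<le> k \<Longrightarrow> F (- (k *\<^sub>R mat 1)) \<le> - (lam * k)"
  using F_add_psd_ge[OF _ psd_mat_scaled_id, of "- (k *\<^sub>R mat 1)" k] F0
  by (simp add: mnorm_scaled_id sym_mat_intros)

text \<open>The two parts of a radial Hessian are treated in turn: the rank-one part is gained with
  \<open>lam\<close>, the isotropic part is lost with \<open>Lam\<close>. The operator norm keeps
  the bound free of the dimension.\<close>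

lemma F_radial_ge:
  assumes "0 \<le> k" "0 \<le> l"
  shows "lam * (l * (a \<bullet> a)) - Lam * k \<le> F (- (k *\<^sub>R mat 1) + l *\<^sub>R outer a a)"
proof -
  have "F (l *\<^sub>R outer a a) \<le> F (- (k *\<^sub>R mat 1) + l *\<^sub>R outer a a) + Lam * k"
    using F_add_psd_le[of "- (k *\<^sub>R mat 1) + l *\<^sub>R outer a a" "k *\<^sub>R mat 1"] assms
    by (simp add: sym_mat_intros psd_mat_scaled_id mnorm_scaled_id)
  moreover have "lam * (l * (a \<bullet> a)) \<le> F (l *\<^sub>R outer a a)"
    using F_add_psd_ge[of 0 "l *\<^sub>R outer a a"] assms F0
    by (simp add: sym_mat_intros psd_mat_outer mnorm_outer)
  ultimately show ?thesis by simp
qed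

text \<open>Serves profiles that are concave in the squared radius: their rank-one part only lowers
  \<open>F\<close>.\<close>

lemma F_radial_le:
  assumes "0 \<le> k" "l \<le> 0"
  shows "F (k *\<^sub>R mat 1 + l *\<^sub>R outer a a) \<le> Lam * k"
proof -
  have "F (k *\<^sub>R mat 1 + l *\<^sub>R outer a a) \<le> F (k *\<^sub>R mat 1)"
    using F_mono[of "k *\<^sub>R mat 1 + l *\<^sub>R outer a a" "(- l) *\<^sub>R outer a a"] assms
    by (simp add: sym_mat_intros psd_mat_outer del: scaleR_minus_left) simp
  then show ?thesis using F_scaled_id_le[OF assms(1)] by simp
qed

end

section \<open>Second-order calculus\<close>

lemma C2_on_subset: "C2_on U w Dw H \<Longrightarrow> V \<subseteq> U \<Longrightarrow> C2_on V w Dw H"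
  unfolding C2_on_def by (meson continuous_on_subset subsetD)

lemma C2_onD:
  assumes "C2_on U w Dw H" "y \<in> U"
  shows "(w has_derivative (\<lambda>h. Dw y \<bullet> h)) (at y)"
    and "(Dw has_derivative (\<lambda>h. H y *v h)) (at y)"
  using assms by (auto simp: C2_on_def)

lemma C2_on_continuous:
  assumes "C2_on U w Dw H"
  shows "continuous_on U w" and "continuous_on U Dw"
  using C2_onD[OF assms] by (auto intro!: continuous_at_imp_continuous_on has_derivative_continuous)

lemma C2_on_add:
  assumes "C2_on U v Dv Hv" "C2_on U w Dw Hw"
  shows "C2_on U (\<lambda>x. v x + w x) (\<lambda>x. Dv x + Dw x) (\<lambda>x. Hv x + Hw x)"
  using assms unfolding C2_on_def
  by (auto intro!: continuous_intros derivative_eq_intros simp: inner_add_left mat_vec_simps)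

lemma C2_on_diff:
  assumes "C2_on U v Dv Hv" "C2_on U w Dw Hw"
  shows "C2_on U (\<lambda>x. v x - w x) (\<lambda>x. Dv x - Dw x) (\<lambda>x. Hv x - Hw x)"
  using assms unfolding C2_on_def
  by (auto intro!: continuous_intros derivative_eq_intros simp: inner_diff_left mat_vec_simps)

lemma C2_on_const: "C2_on U (\<lambda>_. c) (\<lambda>_. 0) (\<lambda>_. 0)"
  by (simp add: C2_on_def)

lemma C2_on_affine: "C2_on U (\<lambda>x. b \<bullet> (x - c) + t) (\<lambda>_. b) (\<lambda>_. 0)"
  unfolding C2_on_def by (auto intro!: derivative_eq_intros simp: algebra_simps inner_diff)

lemma C2_on_sqdist:
  "C2_on U (\<lambda>x. (x - c) \<bullet> (x - c)) (\<lambda>x. 2 *\<^sub>R (x - c)) (\<lambda>_. 2 *\<^sub>R mat 1)"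
  unfolding C2_on_def
  by (auto intro!: derivative_eq_intros simp: mat_vec_simps algebra_simps inner_diff inner_commute)

lemma continuous_on_outer_square: "continuous_on U f \<Longrightarrow> continuous_on U (\<lambda>x. outer (f x) (f x))"
  unfolding outer_def by (intro continuous_intros continuous_on_vec_lambda)

lemma C2_on_scalar_comp:
  assumes q: "C2_on U q Dq Hq"
    and d1: "\<And>y. y \<in> U \<Longrightarrow> (\<psi> has_real_derivative \<psi>' (q y)) (at (q y))"
    and d2: "\<And>y. y \<in> U \<Longrightarrow> (\<psi>' has_real_derivative \<psi>'' (q y)) (at (q y))"
    and c2: "continuous_on (q ` U) \<psi>''"
  shows "C2_on U (\<lambda>y. \<psi> (q y)) (\<lambda>y. \<psi>' (q y) *\<^sub>R Dq y)
    (\<lambda>y. \<psi>' (q y) *\<^sub>R Hq y + \<psi>'' (q y) *\<^sub>R outer (Dq y) (Dq y))"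
  unfolding C2_on_def
proof (intro conjI ballI)
  fix y assume y: "y \<in> U"
  note Q = C2_onD[OF q y]
  show "((\<lambda>y. \<psi> (q y)) has_derivative (\<lambda>h. (\<psi>' (q y) *\<^sub>R Dq y) \<bullet> h)) (at y)"
    using has_derivative_compose[OF Q(1) d1[OF y, unfolded has_field_derivative_def]] by simp
  have "((\<lambda>y. \<psi>' (q y)) has_derivative (\<lambda>h. \<psi>'' (q y) * (Dq y \<bullet> h))) (at y)"
    using has_derivative_compose[OF Q(1) d2[OF y, unfolded has_field_derivative_def]] by simp
  then show "((\<lambda>y. \<psi>' (q y) *\<^sub>R Dq y) has_derivative
     (*v) (\<psi>' (q y) *\<^sub>R Hq y + \<psi>'' (q y) *\<^sub>R outer (Dq y) (Dq y))) (at y)"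
    using Q(2) by (auto intro!: derivative_eq_intros simp: mat_vec_simps fun_eq_iff)
next
  have cq: "continuous_on U q" and cDq: "continuous_on U Dq"
    using q by (simp_all add: C2_on_continuous)
  have "continuous_on (q ` U) \<psi>'"
    by (auto intro!: continuous_at_imp_continuous_on DERIV_isCont[OF d2])
  then have "continuous_on U (\<lambda>y. \<psi>' (q y))"
    using cq by (metis continuous_on_compose2 subset_refl)
  moreover have "continuous_on U (\<lambda>y. \<psi>'' (q y))"
    using cq c2 by (metis continuous_on_compose2 subset_refl)
  moreover have "continuous_on U Hq" using q by (simp add: C2_on_def)
  ultimately show "continuous_on U (\<lambda>y. \<psi>' (q y) *\<^sub>R Hq y + \<psi>'' (q y) *\<^sub>R outer (Dq y) (Dq y))"
    using continuous_on_outer_square[OF cDq] by (intro continuous_intros)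
qed

lemma continuous_on_matrix_sandwich:
  "continuous_on V A \<Longrightarrow> continuous_on V (\<lambda>z. S ** A z ** (T :: real^'n^'m))"
  unfolding matrix_matrix_mult_def by (intro continuous_intros continuous_on_vec_lambda)

text \<open>Carries a test function in \<open>x\<close> over to the variable \<open>y\<close> when
  the pair of doubled variables moves linearly; the Hessian changes by congruence with
  \<open>T\<close>.\<close>

lemma C2_on_compose_affine:
  fixes T :: "real^'n^'n"
  assumes phi: "C2_on U \<phi> D\<phi> H" and V: "\<And>z. z \<in> V \<Longrightarrow> a + T *v (z - c) \<in> U"
  shows "C2_on V (\<lambda>z. \<phi> (a + T *v (z - c))) (\<lambda>z. transpose T *v D\<phi> (a + T *v (z - c)))
    (\<lambda>z. transpose T ** H (a + T *v (z - c)) ** T)"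
  unfolding C2_on_def
proof (intro conjI ballI)
  fix z assume z: "z \<in> V"
  define y where "y = a + T *v (z - c)"
  note Q = C2_onD[OF phi V[OF z], folded y_def]
  have T: "((\<lambda>z. a + T *v (z - c)) has_derivative (\<lambda>h. T *v h)) (at z)"
    by (auto intro!: derivative_eq_intros
        bounded_linear.has_derivative[OF matrix_vector_mul_bounded_linear])
  show "((\<lambda>z. \<phi> (a + T *v (z - c))) has_derivative
      (\<lambda>h. (transpose T *v D\<phi> (a + T *v (z - c))) \<bullet> h)) (at z)"
    using has_derivative_compose[OF T, of \<phi>] Q(1)
    by (simp add: y_def dot_lmul_matrix del: transpose_matrix_vector)
      (simp add: dot_lmul_matrix)
  have "((\<lambda>z. D\<phi> (a + T *v (z - c))) has_derivative (\<lambda>h. H y *v (T *v h))) (at z)"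
    using has_derivative_compose[OF T, of D\<phi>] Q(2) by (simp add: y_def)
  then have "((\<lambda>z. transpose T *v D\<phi> (a + T *v (z - c))) has_derivative
      (\<lambda>h. transpose T *v (H y *v (T *v h)))) (at z)"
    by (rule bounded_linear.has_derivative[OF matrix_vector_mul_bounded_linear])
  then show "((\<lambda>z. transpose T *v D\<phi> (a + T *v (z - c))) has_derivative
      (*v) (transpose T ** H (a + T *v (z - c)) ** T)) (at z)"
    by (simp add: y_def matrix_vector_mul_assoc matrix_mul_assoc del: transpose_matrix_vector)
next
  have "continuous_on V (\<lambda>z. a + T *v (z - c))"
    by (intro continuous_intros linear_continuous_on_compose[OF _ matrix_vector_mul_linear])
  moreover have "continuous_on U H" using phi by (simp add: C2_on_def)
  ultimately have "continuous_on V (\<lambda>z. H (a + T *v (z - c)))"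
    using V by (auto intro: continuous_on_compose2)
  then show "continuous_on V (\<lambda>z. transpose T ** H (a + T *v (z - c)) ** T)"
    by (rule continuous_on_matrix_sandwich)
qed

section \<open>Symmetry of the Hessian and second-order conditions at a minimum\<close>

lemma C2_on_gradient_estimate:
  assumes "C2_on (ball x0 r) g Dg H" "r > 0" "\<epsilon> > 0"
  obtains \<delta> where "0 < \<delta>" "\<delta> \<le> r"
    "\<And>z. norm z < \<delta> \<Longrightarrow> norm (Dg (x0 + z) - Dg x0 - H x0 *v z) \<le> \<epsilon> * norm z"
proof -
  have "(Dg has_derivative (\<lambda>h. H x0 *v h)) (at x0)"
    using C2_onD(2)[OF assms(1), of x0] assms(2) by simp
  then obtain d where d: "d > 0"
    "\<And>y. norm (y - x0) < d \<Longrightarrow> norm (Dg y - Dg x0 - H x0 *v (y - x0)) \<le> \<epsilon> * norm (y - x0)"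
    using \<open>\<epsilon> > 0\<close> unfolding has_derivative_at_alt by blast
  show ?thesis
  proof (rule that[of "min d r"])
    fix z :: "real^'a" assume "norm z < min d r"
    then show "norm (Dg (x0 + z) - Dg x0 - H x0 *v z) \<le> \<epsilon> * norm z"
      using d(2)[of "x0 + z"] by simp
  qed (use d(1) assms(2) in auto)
qed

text \<open>The double difference is the increment of \<open>g (x0 + \<tau> *\<^sub>R h + k) - g (x0
  + \<tau> *\<^sub>R h)\<close> over the unit interval. The mean value theorem turns it into a
  difference of gradients, and differentiability of the gradient at the single point
  \<open>x0\<close> linearises both.\<close>

lemma double_difference_estimate:
  assumes g: "C2_on (ball x0 r) g Dg H" and "\<delta> \<le> r"
    and e: "\<And>z. norm z < \<delta> \<Longrightarrow> norm (Dg (x0 + z) - Dg x0 - H x0 *v z) \<le> \<epsilon> * norm z"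
    and hk: "norm h + norm k < \<delta>" and "\<epsilon> \<ge> 0"
  shows "\<bar>g (x0 + h + k) - g (x0 + h) - g (x0 + k) + g x0 - (H x0 *v k) \<bullet> h\<bar>
    \<le> 2 * \<epsilon> * (norm h + norm k) * norm h"
proof -
  define f where "f = (\<lambda>\<tau>. g (x0 + \<tau> *\<^sub>R h + k) - g (x0 + \<tau> *\<^sub>R h))"
  have nrm: "norm (\<tau> *\<^sub>R h) \<le> norm h" if "0 \<le> \<tau>" "\<tau> \<le> 1" for \<tau>
    using that by (simp add: mult_left_le_one_le)
  have inb: "x0 + \<tau> *\<^sub>R h + k \<in> ball x0 r" "x0 + \<tau> *\<^sub>R h \<in> ball x0 r"
    "norm (\<tau> *\<^sub>R h + k) \<le> norm h + norm k"
    if "0 \<le> \<tau>" "\<tau> \<le> 1" for \<tau>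
  proof -
    show *: "norm (\<tau> *\<^sub>R h + k) \<le> norm h + norm k"
      using nrm[OF that] norm_triangle_ineq[of "\<tau> *\<^sub>R h" k] by linarith
    have "x0 + z \<in> ball x0 r \<longleftrightarrow> norm z < r" for z by (simp add: dist_norm)
    from this[of "\<tau> *\<^sub>R h + k"] this[of "\<tau> *\<^sub>R h"]
    show "x0 + \<tau> *\<^sub>R h + k \<in> ball x0 r" "x0 + \<tau> *\<^sub>R h \<in> ball x0 r"
      using * hk \<open>\<delta> \<le> r\<close> nrm[OF that] norm_ge_zero[of k]
      unfolding add.assoc by linarith+
  qed
  have der: "(f has_real_derivative (Dg (x0 + \<tau> *\<^sub>R h + k) - Dg (x0 + \<tau> *\<^sub>R h)) \<bullet> h) (at \<tau>)"
    if "0 \<le> \<tau>" "\<tau> \<le> 1" for \<tau>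
  proof -
    have "((\<lambda>\<tau>. x0 + \<tau> *\<^sub>R h + k) has_derivative (\<lambda>s. s *\<^sub>R h)) (at \<tau>)"
      "((\<lambda>\<tau>. x0 + \<tau> *\<^sub>R h) has_derivative (\<lambda>s. s *\<^sub>R h)) (at \<tau>)"
      by (auto intro!: derivative_eq_intros)
    from has_derivative_compose[OF this(1) C2_onD(1)[OF g inb(1)[OF that]]]
      has_derivative_compose[OF this(2) C2_onD(1)[OF g inb(2)[OF that]]]
    show ?thesis unfolding f_def has_field_derivative_def
      by (auto intro!: derivative_eq_intros simp: inner_diff_left algebra_simps)
  qed
  obtain \<theta> where th: "0 < \<theta>" "\<theta> < 1"
    "f 1 - f 0 = (Dg (x0 + \<theta> *\<^sub>R h + k) - Dg (x0 + \<theta> *\<^sub>R h)) \<bullet> h"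
    using MVT2[of 0 1 f, OF _ der] by auto
  define E1 where "E1 = Dg (x0 + (\<theta> *\<^sub>R h + k)) - Dg x0 - H x0 *v (\<theta> *\<^sub>R h + k)"
  define E2 where "E2 = Dg (x0 + \<theta> *\<^sub>R h) - Dg x0 - H x0 *v (\<theta> *\<^sub>R h)"
  have t: "0 \<le> \<theta>" "\<theta> \<le> 1" using th by auto
  have n1: "norm E1 \<le> \<epsilon> * (norm h + norm k)"
    unfolding E1_def using e[of "\<theta> *\<^sub>R h + k"] inb(3)[OF t] hk \<open>\<epsilon> \<ge> 0\<close>
    by (meson le_less_trans mult_left_mono order_trans)
  have n2: "norm E2 \<le> \<epsilon> * (norm h + norm k)"
    unfolding E2_def using e[of "\<theta> *\<^sub>R h"] nrm[OF t] hk \<open>\<epsilon> \<ge> 0\<close> norm_ge_zero[of k]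
    by (smt (verit, best) mult_left_mono)
  have "g (x0 + h + k) - g (x0 + h) - g (x0 + k) + g x0 - (H x0 *v k) \<bullet> h = (E1 - E2) \<bullet> h"
    using th(3) by (simp add: f_def E1_def E2_def mat_vec_simps inner_diff_left inner_add_left
        algebra_simps)
  also have "\<bar>\<dots>\<bar> \<le> norm (E1 - E2) * norm h" by (rule Cauchy_Schwarz_ineq2)
  also have "\<dots> \<le> (2 * \<epsilon> * (norm h + norm k)) * norm h"
    using n1 n2 norm_triangle_ineq4[of E1 E2] by (intro mult_right_mono) auto
  finally show ?thesis .
qed

text \<open>\<open>C2_on\<close> does not ask the Hessian to be symmetric, whereas ellipticity
  speaks of symmetric matrices only. The double difference is symmetric in its two increments and,
  for shrinking increments, approximates the bilinear form of the Hessian.\<close>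

lemma C2_on_sym_mat:
  assumes g: "C2_on (ball x0 r) g Dg H" and r: "r > 0"
  shows "sym_mat (H x0)"
proof (rule sym_matI)
  fix h k :: "real^'a"
  have "\<bar>(H x0 *v k) \<bullet> h - (H x0 *v h) \<bullet> k\<bar> \<le> 0"
  proof (rule field_le_epsilon)
    fix e :: real assume e: "e > 0"
    define n where "n = norm h + norm k"
    have n0: "n \<ge> 0" by (simp add: n_def)
    \<comment> \<open>Makes the error \<open>\<epsilon> * (2 * n * n)\<close> that remains after
      division by \<open>s\<^sup>2\<close> at most \<open>e\<close>.\<close>
    define \<epsilon> where "\<epsilon> = e / (2 * n * n + 1)"
    have ep: "\<epsilon> > 0" using e n0 by (simp add: \<epsilon>_def add_nonneg_pos)
    obtain \<delta> where \<delta>: "0 < \<delta>" "\<delta> \<le> r"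
      "\<And>z. norm z < \<delta> \<Longrightarrow> norm (Dg (x0 + z) - Dg x0 - H x0 *v z) \<le> \<epsilon> * norm z"
      using C2_on_gradient_estimate[OF g r ep] by blast
    define s where "s = \<delta> / (2 * (n + 1))"
    have s: "s > 0" "s * n < \<delta>" using \<delta>(1) n0 by (auto simp: s_def field_simps add_nonneg_pos)
    have sn: "norm (s *\<^sub>R h) + norm (s *\<^sub>R k) = s * n"
      using s by (simp add: n_def algebra_simps)
    define L where "L = g (x0 + s *\<^sub>R h + s *\<^sub>R k) - g (x0 + s *\<^sub>R h) - g (x0 + s *\<^sub>R k) + g x0"
    have "\<bar>g (x0 + s *\<^sub>R h + s *\<^sub>R k) - g (x0 + s *\<^sub>R h) - g (x0 + s *\<^sub>R k) + g x0
        - (H x0 *v (s *\<^sub>R k)) \<bullet> (s *\<^sub>R h)\<bar> \<le> 2 * \<epsilon> * (s * n) * norm (s *\<^sub>R h)"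
      using double_difference_estimate[OF g \<delta>(2,3), of "s *\<^sub>R h" "s *\<^sub>R k", unfolded sn] s(2) ep
      by simp
    then have 1: "\<bar>L - s\<^sup>2 * ((H x0 *v k) \<bullet> h)\<bar> \<le> 2 * \<epsilon> * (s * n) * (s * norm h)"
      using s(1) by (simp add: L_def mat_vec_simps power2_eq_square mult.assoc)
    have "\<bar>g (x0 + s *\<^sub>R k + s *\<^sub>R h) - g (x0 + s *\<^sub>R k) - g (x0 + s *\<^sub>R h) + g x0
        - (H x0 *v (s *\<^sub>R h)) \<bullet> (s *\<^sub>R k)\<bar> \<le> 2 * \<epsilon> * (s * n) * norm (s *\<^sub>R k)"
      using double_difference_estimate[OF g \<delta>(2,3), of "s *\<^sub>R k" "s *\<^sub>R h",
          unfolded add.commute[of "norm (s *\<^sub>R k)"] sn] s(2) ep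
      by simp
    moreover have "L = g (x0 + s *\<^sub>R k + s *\<^sub>R h) - g (x0 + s *\<^sub>R k) - g (x0 + s *\<^sub>R h) + g x0"
      by (simp add: L_def add_ac)
    ultimately have 2: "\<bar>L - s\<^sup>2 * ((H x0 *v h) \<bullet> k)\<bar> \<le> 2 * \<epsilon> * (s * n) * (s * norm k)"
      using s(1) by (simp add: mat_vec_simps power2_eq_square mult.assoc)
    have "s\<^sup>2 * \<bar>(H x0 *v k) \<bullet> h - (H x0 *v h) \<bullet> k\<bar>
      = \<bar>(L - s\<^sup>2 * ((H x0 *v h) \<bullet> k)) - (L - s\<^sup>2 * ((H x0 *v k) \<bullet> h))\<bar>"
      by (simp add: abs_mult flip: right_diff_distrib)
    also have "\<dots> \<le> 2 * \<epsilon> * (s * n) * (s * norm h) + 2 * \<epsilon> * (s * n) * (s * norm k)"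
      using 1 2 by linarith
    also have "\<dots> = s\<^sup>2 * (\<epsilon> * (2 * n * n))"
      by (simp add: n_def power2_eq_square algebra_simps)
    finally have "\<bar>(H x0 *v k) \<bullet> h - (H x0 *v h) \<bullet> k\<bar> \<le> \<epsilon> * (2 * n * n)"
      using s by simp
    also have "\<dots> \<le> \<epsilon> * (2 * n * n + 1)" using ep by simp
    also have "\<dots> = e" using n0 by (simp add: \<epsilon>_def add_nonneg_pos less_imp_neq[symmetric])
    finally show "\<bar>(H x0 *v k) \<bullet> h - (H x0 *v h) \<bullet> k\<bar> \<le> 0 + e" by simp
  qed
  then show "h \<bullet> (H x0 *v k) = (H x0 *v h) \<bullet> k" by (simp add: inner_commute)
qed

lemma C2_on_min_gradient_zero:
  assumes g: "C2_on (ball x0 r) g Dg H" and r: "r > 0"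
    and min: "\<And>y. y \<in> ball x0 r \<Longrightarrow> g x0 \<le> g y"
  shows "Dg x0 = 0"
proof -
  have "(\<lambda>h. Dg x0 \<bullet> h) = (\<lambda>h. 0)"
    using differential_zero_maxmin[of x0 "ball x0 r" g "\<lambda>h. Dg x0 \<bullet> h"] C2_onD(1)[OF g, of x0] r min
    by auto
  then have "Dg x0 \<bullet> Dg x0 = 0" by meson
  then show ?thesis by simp
qed

text \<open>The mean value theorem on a segment issuing from \<open>x0\<close> gives a point of
  nonnegative slope. As the gradient vanishes at \<open>x0\<close>, that slope is
  \<open>\<theta>\<close> times the quadratic form up to an error of smaller order.\<close>

lemma C2_on_min_psd:
  assumes g: "C2_on (ball x0 r) g Dg H" and r: "r > 0"
    and min: "\<And>y. y \<in> ball x0 r \<Longrightarrow> g x0 \<le> g y"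
  shows "psd_mat (H x0)"
  unfolding psd_mat_def
proof (intro conjI allI)
  show "sym_mat (H x0)" by (rule C2_on_sym_mat[OF g r])
  fix x
  have "- (x \<bullet> (H x0 *v x)) \<le> 0"
  proof (rule field_le_epsilon)
    fix e :: real assume e: "e > 0"
    define n where "n = norm x"
    have n0: "n \<ge> 0" by (simp add: n_def)
    define \<epsilon> where "\<epsilon> = e / (n * n + 1)"
    have ep: "\<epsilon> > 0" using e n0 by (simp add: \<epsilon>_def add_nonneg_pos)
    obtain \<delta> where \<delta>: "0 < \<delta>" "\<delta> \<le> r"
      "\<And>z. norm z < \<delta> \<Longrightarrow> norm (Dg (x0 + z) - Dg x0 - H x0 *v z) \<le> \<epsilon> * norm z"
      using C2_on_gradient_estimate[OF g r ep] by blast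
    define s where "s = \<delta> / (2 * (n + 1))"
    have s: "s > 0" "s * n < \<delta>" using \<delta>(1) n0 by (auto simp: s_def field_simps add_nonneg_pos)
    have small: "\<tau> * n < \<delta>" if "0 \<le> \<tau>" "\<tau> \<le> s" for \<tau>
      using mult_right_mono[OF that(2) n0] s(2) by linarith
    have der: "((\<lambda>\<tau>. g (x0 + \<tau> *\<^sub>R x)) has_real_derivative Dg (x0 + \<tau> *\<^sub>R x) \<bullet> x) (at \<tau>)"
      if "0 \<le> \<tau>" "\<tau> \<le> s" for \<tau>
    proof -
      have b: "x0 + \<tau> *\<^sub>R x \<in> ball x0 r"
        using small[OF that] \<delta>(2) that by (simp add: dist_norm n_def)
      have "((\<lambda>\<tau>. x0 + \<tau> *\<^sub>R x) has_derivative (\<lambda>s. s *\<^sub>R x)) (at \<tau>)"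
        by (auto intro!: derivative_eq_intros)
      from has_derivative_compose[OF this C2_onD(1)[OF g b]]
      show ?thesis unfolding has_field_derivative_def by (simp add: mult_commute_abs)
    qed
    obtain \<theta> where th: "0 < \<theta>" "\<theta> < s" "g (x0 + s *\<^sub>R x) - g (x0 + 0 *\<^sub>R x) = (s - 0) * (Dg (x0 + \<theta> *\<^sub>R x) \<bullet> x)"
      using MVT2[OF s(1) der] by blast
    have "x0 + s *\<^sub>R x \<in> ball x0 r" using s \<delta>(2) by (simp add: dist_norm n_def)
    then have "0 \<le> s * (Dg (x0 + \<theta> *\<^sub>R x) \<bullet> x)" using min th(3) by fastforce
    then have pos: "0 \<le> Dg (x0 + \<theta> *\<^sub>R x) \<bullet> x" using s by (simp add: zero_le_mult_iff)
    define E where "E = Dg (x0 + \<theta> *\<^sub>R x) - H x0 *v (\<theta> *\<^sub>R x)"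
    have "norm E \<le> \<epsilon> * (\<theta> * n)"
      using \<delta>(3)[of "\<theta> *\<^sub>R x"] small[of \<theta>] th(1,2) C2_on_min_gradient_zero[OF g r min]
      by (simp add: E_def n_def)
    then have "E \<bullet> x \<le> \<epsilon> * (\<theta> * n) * n"
      using Cauchy_Schwarz_ineq2[of E x] n0 unfolding n_def
      by (smt (verit, best) mult_right_mono)
    moreover have "Dg (x0 + \<theta> *\<^sub>R x) \<bullet> x = E \<bullet> x + \<theta> * (x \<bullet> (H x0 *v x))"
      by (simp add: E_def inner_diff_left inner_diff_right mat_vec_simps inner_commute)
    ultimately have "\<theta> * (- (x \<bullet> (H x0 *v x))) \<le> \<theta> * (\<epsilon> * (n * n))"
      using pos by (simp add: algebra_simps)
    then have "- (x \<bullet> (H x0 *v x)) \<le> \<epsilon> * (n * n)"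
      using th(1) by (rule mult_left_le_imp_le)
    also have "\<dots> \<le> \<epsilon> * (n * n + 1)" using ep by simp
    also have "\<dots> = e" using n0 by (simp add: \<epsilon>_def add_nonneg_pos less_imp_neq[symmetric])
    finally show "- (x \<bullet> (H x0 *v x)) \<le> 0 + e" by simp
  qed
  then show "0 \<le> x \<bullet> (H x0 *v x)" by simp
qed

text \<open>Radial profiles are written in the squared distance, which is smooth also at the
  centre.\<close>

lemma C2_on_radial:
  assumes d1: "\<And>y. y \<in> U \<Longrightarrow> (\<psi> has_real_derivative \<psi>' ((y - c) \<bullet> (y - c))) (at ((y - c) \<bullet> (y - c)))"
    and d2: "\<And>y. y \<in> U \<Longrightarrow> (\<psi>' has_real_derivative \<psi>'' ((y - c) \<bullet> (y - c))) (at ((y - c) \<bullet> (y - c)))"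
    and c2: "continuous_on ((\<lambda>y. (y - c) \<bullet> (y - c)) ` U) \<psi>''"
  shows "C2_on U (\<lambda>y. \<psi> ((y - c) \<bullet> (y - c))) (\<lambda>y. \<psi>' ((y - c) \<bullet> (y - c)) *\<^sub>R 2 *\<^sub>R (y - c))
    (\<lambda>y. (2 * \<psi>' ((y - c) \<bullet> (y - c))) *\<^sub>R mat 1
      + (4 * \<psi>'' ((y - c) \<bullet> (y - c))) *\<^sub>R outer (y - c) (y - c))"
  using C2_on_scalar_comp[OF C2_on_sqdist d1 d2 c2, simplified]
  by (simp add: outer_scaleR mult.commute)

section \<open>Viscosity supersolutions\<close>

text \<open>Pointwise and without reference to a domain, so that the property can be required at
  selected points only and passed from one function to another.\<close>

definition super_at :: "(real^'n^'n \<Rightarrow> real) \<Rightarrow> (real \<Rightarrow> real) \<Rightarrow> (real^'n \<Rightarrow> real) \<Rightarrow> real^'n \<Rightarrow> bool" where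
  "super_at F g w x0 \<longleftrightarrow> (\<forall>\<phi> D\<phi> H\<phi> r. r > 0 \<and> C2_on (ball x0 r) \<phi> D\<phi> H\<phi> \<and> \<phi> x0 = w x0
     \<and> (\<forall>y\<in>ball x0 r. \<phi> y \<le> w y) \<longrightarrow> F (H\<phi> x0) \<le> g (w x0))"

lemma super_atD:
  assumes "super_at F g w x0" "r > 0" "C2_on (ball x0 r) \<phi> D\<phi> H\<phi>" "\<phi> x0 = w x0"
    "\<And>y. y \<in> ball x0 r \<Longrightarrow> \<phi> y \<le> w y"
  shows "F (H\<phi> x0) \<le> g (w x0)"
  using assms unfolding super_at_def by blast

text \<open>A test function below \<open>w\<close> lies below \<open>v\<close> as well and meets it
  at the same point. This is how minima of supersolutions are glued.\<close>

lemma super_at_touching: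
  assumes sup: "super_at F g v x0" and e: "e > 0" "w x0 = v x0"
    "\<And>y. y \<in> ball x0 e \<Longrightarrow> w y \<le> v y"
  shows "super_at F g w x0"
  unfolding super_at_def
proof (intro allI impI, elim conjE)
  fix \<phi> D\<phi> H\<phi> r
  assume r: "r > 0" and C: "C2_on (ball x0 r) \<phi> D\<phi> H\<phi>" and eq: "\<phi> x0 = w x0"
    and le: "\<forall>y\<in>ball x0 r. \<phi> y \<le> w y"
  have "C2_on (ball x0 (min r e)) \<phi> D\<phi> H\<phi>" using C by (rule C2_on_subset) auto
  moreover have "\<phi> y \<le> v y" if "y \<in> ball x0 (min r e)" for y
    using le e(3)[of y] that by (meson ball_subset_cball subset_ball min.cobounded1 min.cobounded2 order_trans subsetD)
  ultimately show "F (H\<phi> x0) \<le> g (w x0)"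
    using super_atD[OF sup, of "min r e"] r e eq by auto
qed

lemma visc_super_iff_super_at:
  assumes "open U"
  shows "visc_super F g U u \<longleftrightarrow> (\<forall>x\<in>U. super_at F g u x)"
proof
  assume L: "visc_super F g U u"
  show "\<forall>x\<in>U. super_at F g u x"
    unfolding super_at_def
  proof (intro ballI allI impI, elim conjE)
    fix x0 \<phi> D\<phi> H\<phi> r
    assume x0: "x0 \<in> U" and r: "r > 0" and C: "C2_on (ball x0 r) \<phi> D\<phi> H\<phi>"
      and eq: "\<phi> x0 = u x0" and le: "\<forall>y\<in>ball x0 r. \<phi> y \<le> u y"
    obtain e where e: "e > 0" "ball x0 e \<subseteq> U" using assms x0 open_contains_ball by blast
    have C': "C2_on (ball x0 (min r e)) \<phi> D\<phi> H\<phi>" using C by (rule C2_on_subset) auto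
    have "min r e > 0" "ball x0 (min r e) \<subseteq> U" "\<forall>y\<in>ball x0 (min r e). \<phi> y \<le> u y"
      using r e le by auto
    then show "F (H\<phi> x0) \<le> g (u x0)"
      using L x0 C' eq unfolding visc_super_def by blast
  qed
next
  assume "\<forall>x\<in>U. super_at F g u x"
  then show "visc_super F g U u" unfolding visc_super_def super_at_def by blast
qed

lemma visc_superD: "visc_super F g U u \<Longrightarrow> open U \<Longrightarrow> x \<in> U \<Longrightarrow> super_at F g u x"
  using visc_super_iff_super_at by blast

lemma visc_subD:
  assumes "visc_sub F g U u" "open U" "x0 \<in> U" "r > 0" "C2_on UNIV \<phi> D\<phi> H\<phi>" "\<phi> x0 = u x0"
    "\<And>y. y \<in> ball x0 r \<Longrightarrow> u y \<le> \<phi> y"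
  shows "g (u x0) \<le> F (H\<phi> x0)"
proof -
  obtain e where e: "e > 0" "ball x0 e \<subseteq> U" using assms(2,3) open_contains_ball by blast
  have C: "C2_on (ball x0 (min r e)) \<phi> D\<phi> H\<phi>" using assms(5) by (rule C2_on_subset) auto
  have "min r e > 0" "ball x0 (min r e) \<subseteq> U" "\<forall>y\<in>ball x0 (min r e). u y \<le> \<phi> y"
    using assms(4,7) e by auto
  then show ?thesis
    using assms(1,3,6) C unfolding visc_sub_def by blast
qed

lemma C2_on_paraboloid:
  "C2_on U (\<lambda>x. k * ((x - c) \<bullet> (x - c)) + t) (\<lambda>x. k *\<^sub>R 2 *\<^sub>R (x - c)) (\<lambda>_. (2 * k) *\<^sub>R mat 1)"
proof -
  have "((\<lambda>s. k * s + t) has_real_derivative k) (at s)" for s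
    by (auto intro!: derivative_eq_intros)
  then show ?thesis
    using C2_on_scalar_comp[OF C2_on_sqdist, of U "\<lambda>s. k * s + t" "\<lambda>_. k" c "\<lambda>_. 0"]
    by (simp add: mult.commute)
qed

section \<open>Maximum principles against paraboloids and stability under infima\<close>

context elliptic
begin

lemma super_at_classical:
  assumes r: "r > 0" and w: "C2_on (ball x0 r) w Dw H" and F: "F (H x0) \<le> g (w x0)"
  shows "super_at F g w x0"
  unfolding super_at_def
proof (intro allI impI, elim conjE)
  fix \<phi> D\<phi> H\<phi> s
  assume s: "s > 0" and C: "C2_on (ball x0 s) \<phi> D\<phi> H\<phi>" and eq: "\<phi> x0 = w x0"
    and le: "\<forall>y\<in>ball x0 s. \<phi> y \<le> w y"
  define t where "t = min r s"
  have t: "t > 0" using r s by (simp add: t_def)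
  have C': "C2_on (ball x0 t) \<phi> D\<phi> H\<phi>" and w': "C2_on (ball x0 t) w Dw H"
    using C w by (auto intro: C2_on_subset simp: t_def)
  have "psd_mat (H x0 - H\<phi> x0)"
    by (rule C2_on_min_psd[OF C2_on_diff[OF w' C'] t]) (use le eq in \<open>simp add: t_def\<close>)
  then have "F (H\<phi> x0) \<le> F (H\<phi> x0 + (H x0 - H\<phi> x0))"
    using C2_on_sym_mat[OF C' t] by (intro F_mono)
  then show "F (H\<phi> x0) \<le> g (w x0)" using F by simp
qed

text \<open>An interior maximum of \<open>v y + \<eta> * (y \<bullet> y)\<close> would be touched
  from above by a strictly concave paraboloid, on which \<open>F\<close> is negative while
  \<open>k \<ge> 0\<close>.\<close>

lemma visc_sub_le_boundary:
  assumes \<Omega>: "open \<Omega>" "bounded \<Omega>" and v: "continuous_on (closure \<Omega>) v"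
    and sub: "visc_sub F (\<lambda>_. k) \<Omega> v" and k: "k \<ge> 0"
    and bd: "\<And>x. x \<in> frontier \<Omega> \<Longrightarrow> v x \<le> S" and x: "x \<in> closure \<Omega>"
  shows "v x \<le> S"
proof (rule ccontr)
  assume ns: "\<not> v x \<le> S"
  obtain R where R: "\<And>y. y \<in> closure \<Omega> \<Longrightarrow> norm y \<le> R"
    using \<Omega>(2) bounded_closure bounded_iff by metis
  \<comment> \<open>So small that the perturbation stays below the excess \<open>v x - S\<close> on
    the whole bounded set; the maximum then cannot lie on the frontier.\<close>
  define \<eta> where "\<eta> = (v x - S) / (2 * (R * R + 1))"
  have eta: "\<eta> > 0" using ns by (simp add: \<eta>_def add_nonneg_pos)
  have etaR: "\<eta> * (R * R) < v x - S"
  proof -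
    have "\<eta> * (2 * (R * R + 1)) = v x - S"
      by (simp add: \<eta>_def add_nonneg_pos less_imp_neq[symmetric])
    moreover have "\<eta> * (2 * (R * R + 1)) = \<eta> * (R * R) + \<eta> * (R * R) + 2 * \<eta>"
      by (simp add: algebra_simps)
    moreover have "\<eta> * (R * R) \<ge> 0" using eta by simp
    ultimately show ?thesis using eta by linarith
  qed
  have "compact (closure \<Omega>)" using \<Omega>(2) by simp
  moreover have "continuous_on (closure \<Omega>) (\<lambda>y. v y + \<eta> * (y \<bullet> y))"
    using v by (intro continuous_intros)
  ultimately have "\<exists>x2\<in>closure \<Omega>. \<forall>y\<in>closure \<Omega>. v y + \<eta> * (y \<bullet> y) \<le> v x2 + \<eta> * (x2 \<bullet> x2)"
    using x by (intro continuous_attains_sup) auto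
  then obtain x2 where x2: "x2 \<in> closure \<Omega>"
    "\<And>y. y \<in> closure \<Omega> \<Longrightarrow> v y + \<eta> * (y \<bullet> y) \<le> v x2 + \<eta> * (x2 \<bullet> x2)"
    by blast
  have "x2 \<bullet> x2 \<le> R * R"
    using R[OF x2(1)] mult_mono'[of "norm x2" R "norm x2" R]
    by (simp add: dot_square_norm power2_eq_square)
  then have "\<eta> * (x2 \<bullet> x2) \<le> \<eta> * (R * R)" using eta by simp
  moreover have "\<eta> * (x \<bullet> x) \<ge> 0" using eta by simp
  ultimately have "v x2 > S" using etaR x2(2)[OF x] by linarith
  then have "x2 \<notin> frontier \<Omega>" using bd by force
  then have x2\<Omega>: "x2 \<in> \<Omega>" using x2(1) \<Omega>(1) by (simp add: frontier_def interior_open)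
  obtain e where e: "e > 0" "ball x2 e \<subseteq> \<Omega>" using \<Omega>(1) x2\<Omega> open_contains_ball by blast
  let ?t = "v x2 + \<eta> * (x2 \<bullet> x2)"
  have "k \<le> F ((2 * (- \<eta>)) *\<^sub>R mat 1)"
  proof (rule visc_subD[OF sub \<Omega>(1) x2\<Omega> e(1) C2_on_paraboloid[of _ "- \<eta>" 0 ?t]])
    fix y assume "y \<in> ball x2 e"
    then have "y \<in> closure \<Omega>" using e closure_subset by blast
    then show "v y \<le> - \<eta> * ((y - 0) \<bullet> (y - 0)) + ?t" using x2(2)[of y] by simp
  qed simp
  moreover have "F ((2 * (- \<eta>)) *\<^sub>R mat 1) \<le> - (lam * (2 * \<eta>))"
    using F_uminus_scaled_id_le[of "2 * \<eta>"] eta by simp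
  moreover have "lam * (2 * \<eta>) > 0" using lam_pos eta by simp
  ultimately show False using k by linarith
qed

text \<open>Mirror image of the preceding argument with a convex paraboloid; it works because
  \<beta> is not positive at negative values, where the minimum would lie.\<close>

lemma visc_super_nonneg:
  assumes \<Omega>: "open \<Omega>" "bounded \<Omega>" and v: "continuous_on (closure \<Omega>) v"
    and super: "visc_super F \<beta> \<Omega> v" and \<beta>: "\<And>t. t < 0 \<Longrightarrow> \<beta> t \<le> 0"
    and bd: "\<And>x. x \<in> frontier \<Omega> \<Longrightarrow> 0 \<le> v x" and x: "x \<in> closure \<Omega>"
  shows "0 \<le> v x"
proof (rule ccontr)
  assume ns: "\<not> 0 \<le> v x"
  obtain R where R: "\<And>y. y \<in> closure \<Omega> \<Longrightarrow> norm y \<le> R"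
    using \<Omega>(2) bounded_closure bounded_iff by metis
  define \<eta> where "\<eta> = (- v x) / (2 * (R * R + 1))"
  have eta: "\<eta> > 0" using ns by (simp add: \<eta>_def add_nonneg_pos divide_neg_pos)
  have etaR: "\<eta> * (R * R) < - v x"
  proof -
    have "\<eta> * (2 * (R * R + 1)) = - v x"
      by (simp add: \<eta>_def add_nonneg_pos less_imp_neq[symmetric])
    moreover have "\<eta> * (2 * (R * R + 1)) = \<eta> * (R * R) + \<eta> * (R * R) + 2 * \<eta>"
      by (simp add: algebra_simps)
    moreover have "\<eta> * (R * R) \<ge> 0" using eta by simp
    ultimately show ?thesis using eta by linarith
  qed
  have "compact (closure \<Omega>)" using \<Omega>(2) by simp
  moreover have "continuous_on (closure \<Omega>) (\<lambda>y. v y - \<eta> * (y \<bullet> y))"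
    using v by (intro continuous_intros)
  ultimately have "\<exists>x2\<in>closure \<Omega>. \<forall>y\<in>closure \<Omega>. v x2 - \<eta> * (x2 \<bullet> x2) \<le> v y - \<eta> * (y \<bullet> y)"
    using x by (intro continuous_attains_inf) auto
  then obtain x2 where x2: "x2 \<in> closure \<Omega>"
    "\<And>y. y \<in> closure \<Omega> \<Longrightarrow> v x2 - \<eta> * (x2 \<bullet> x2) \<le> v y - \<eta> * (y \<bullet> y)"
    by blast
  have "x2 \<bullet> x2 \<le> R * R"
    using R[OF x2(1)] mult_mono'[of "norm x2" R "norm x2" R]
    by (simp add: dot_square_norm power2_eq_square)
  then have "\<eta> * (x2 \<bullet> x2) \<le> \<eta> * (R * R)" using eta by simp
  moreover have "\<eta> * (x \<bullet> x) \<ge> 0" using eta by simp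
  ultimately have neg: "v x2 < 0" using etaR x2(2)[OF x] by linarith
  then have "x2 \<notin> frontier \<Omega>" using bd by force
  then have x2\<Omega>: "x2 \<in> \<Omega>" using x2(1) \<Omega>(1) by (simp add: frontier_def interior_open)
  obtain e where e: "e > 0" "ball x2 e \<subseteq> \<Omega>" using \<Omega>(1) x2\<Omega> open_contains_ball by blast
  let ?t = "v x2 - \<eta> * (x2 \<bullet> x2)"
  have "F ((2 * \<eta>) *\<^sub>R mat 1) \<le> \<beta> (v x2)"
  proof (rule super_atD[OF visc_superD[OF super \<Omega>(1) x2\<Omega>] e(1) C2_on_paraboloid[of _ \<eta> 0 ?t]])
    fix y assume "y \<in> ball x2 e"
    then have "y \<in> closure \<Omega>" using e closure_subset by blast
    then show "\<eta> * ((y - 0) \<bullet> (y - 0)) + ?t \<le> v y" using x2(2)[of y] by simp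
  qed simp
  moreover have "F ((2 * \<eta>) *\<^sub>R mat 1) \<ge> lam * (2 * \<eta>)"
    using F_scaled_id_ge[of "2 * \<eta>"] eta by simp
  moreover have "lam * (2 * \<eta>) > 0" using lam_pos eta by simp
  ultimately show False using \<beta>[OF neg] by linarith
qed

text \<open>The paraboloid with coefficient \<open>\<kappa>\<close> exceeds the bound
  \<open>S\<close> on the sphere, yet its Hessian is too small for \<open>k\<close>, so a
  subsolution with large right-hand side is pressed below zero. Meant for the lower obstacle, whose
  right-hand side is the supremum of \<beta>.\<close>

lemma visc_sub_large_rhs_nonpos:
  assumes \<Omega>: "open \<Omega>" and sub: "visc_sub F (\<lambda>_. k) \<Omega> v" and v: "continuous_on \<Omega> v"
    and r: "r > 0" "cball Z r \<subseteq> \<Omega>" and S: "S \<ge> 0" "\<And>x. x \<in> cball Z r \<Longrightarrow> v x \<le> S"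
    and k: "k > Lam * (2 * ((S + 1) / r\<^sup>2))"
  shows "v Z \<le> 0"
proof (rule ccontr)
  assume ns: "\<not> v Z \<le> 0"
  define \<kappa> where "\<kappa> = (S + 1) / r\<^sup>2"
  have kap: "\<kappa> > 0" using S r by (simp add: \<kappa>_def)
  have "continuous_on (cball Z r) (\<lambda>y. v y - \<kappa> * ((y - Z) \<bullet> (y - Z)))"
    using continuous_on_subset[OF v r(2)] by (intro continuous_intros)
  then obtain x2 where x2: "x2 \<in> cball Z r"
    "\<And>y. y \<in> cball Z r \<Longrightarrow> v y - \<kappa> * ((y - Z) \<bullet> (y - Z)) \<le> v x2 - \<kappa> * ((x2 - Z) \<bullet> (x2 - Z))"
    using continuous_attains_sup[of "cball Z r"] r by (metis (no_types, lifting) cball_eq_empty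
        compact_cball not_less_iff_gr_or_eq)
  have pos: "v x2 - \<kappa> * ((x2 - Z) \<bullet> (x2 - Z)) > 0" using x2(2)[of Z] r ns by simp
  have "dist Z x2 \<noteq> r"
  proof
    assume "dist Z x2 = r"
    then have "(x2 - Z) \<bullet> (x2 - Z) = r\<^sup>2" by (simp add: dot_square_norm dist_norm norm_minus_commute)
    then have "\<kappa> * ((x2 - Z) \<bullet> (x2 - Z)) = S + 1" using r by (simp add: \<kappa>_def)
    then show False using pos S(2)[OF x2(1)] by simp
  qed
  then have "x2 \<in> ball Z r" using x2(1) by simp
  then obtain e where e: "e > 0" "ball x2 e \<subseteq> ball Z r" using open_ball open_contains_ball by metis
  let ?t = "v x2 - \<kappa> * ((x2 - Z) \<bullet> (x2 - Z))"
  have "k \<le> F ((2 * \<kappa>) *\<^sub>R mat 1)"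
  proof (rule visc_subD[OF sub \<Omega> _ e(1) C2_on_paraboloid[of _ "\<kappa>" Z ?t]])
    fix y assume "y \<in> ball x2 e"
    then have "y \<in> cball Z r" using e by auto
    then show "v y \<le> \<kappa> * ((y - Z) \<bullet> (y - Z)) + ?t" using x2(2)[of y] by simp
  qed (use x2 r in auto)
  moreover have "F ((2 * \<kappa>) *\<^sub>R mat 1) \<le> Lam * (2 * \<kappa>)"
    using F_scaled_id_le[of "2 * \<kappa>"] kap by simp
  ultimately show False using k by (simp add: \<kappa>_def)
qed

text \<open>\<open>P + mnorm P *\<^sub>R mat 1\<close> is semidefinite, which reduces a general
  symmetric increment to semidefinite ones.\<close>

lemma F_diff_le_mnorm:
  assumes M: "sym_mat M" and P: "sym_mat P"
  shows "F M - Lam * mnorm P \<le> F (M + P)"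
proof -
  define c where "c = mnorm P"
  have c: "c \<ge> 0" by (simp add: c_def mnorm_nonneg)
  have "psd_mat (P + c *\<^sub>R mat 1)"
    unfolding psd_mat_def
  proof (intro conjI allI)
    show "sym_mat (P + c *\<^sub>R mat 1)" using P by (intro sym_mat_intros)
    fix x
    have "- (x \<bullet> (P *v x)) \<le> norm x * norm (P *v x)"
      using Cauchy_Schwarz_ineq2[of x "P *v x"] by linarith
    also have "\<dots> \<le> norm x * (c * norm x)"
      unfolding c_def by (intro mult_left_mono le_mnorm) auto
    finally show "0 \<le> x \<bullet> ((P + c *\<^sub>R mat 1) *v x)"
      by (simp add: mat_vec_simps inner_add_right dot_square_norm power2_eq_square algebra_simps)
  qed
  then have "F M \<le> F (M + (P + c *\<^sub>R mat 1))" by (rule F_mono[OF M])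
  also have "\<dots> = F ((M + P) + c *\<^sub>R mat 1)" by (simp add: add.assoc)
  also have "\<dots> \<le> F (M + P) + Lam * c"
    using F_add_psd_le[OF _ psd_mat_scaled_id[OF c]] M P by (simp add: sym_mat_add mnorm_scaled_id c)
  finally show ?thesis by (simp add: c_def)
qed

text \<open>If a test function violates the inequality at \<open>x0\<close>, bending it down by a
  paraboloid makes the contact strict. A member of the family close to \<open>u\<close> at
  \<open>x0\<close> is then touched at a nearby point after a vertical shift, where continuity of
  \<beta> and of the Hessian preserves the violation.\<close>

lemma super_at_Inf:
  fixes u :: "real^'n \<Rightarrow> real"
  assumes \<Omega>: "open \<Omega>" and x0: "x0 \<in> \<Omega>" and \<beta>: "isCont \<beta> (u x0)"
    and W: "W \<noteq> {}" "\<And>w. w \<in> W \<Longrightarrow> continuous_on \<Omega> w" "\<And>w. w \<in> W \<Longrightarrow> visc_super F \<beta> \<Omega> w"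
    and u: "continuous_on \<Omega> u" "\<And>w x. w \<in> W \<Longrightarrow> x \<in> \<Omega> \<Longrightarrow> u x \<le> w x"
      "\<And>e. e > 0 \<Longrightarrow> \<exists>w\<in>W. w x0 < u x0 + e"
  shows "super_at F \<beta> u x0"
  unfolding super_at_def
proof (intro allI impI, elim conjE, rule ccontr)
  fix \<phi> D\<phi> H\<phi> r
  assume r: "r > 0" and C: "C2_on (ball x0 r) \<phi> D\<phi> H\<phi>" and eq: "\<phi> x0 = u x0"
    and le: "\<forall>y\<in>ball x0 r. \<phi> y \<le> u y" and "\<not> F (H\<phi> x0) \<le> \<beta> (u x0)"
  then have gap: "F (H\<phi> x0) > \<beta> (u x0)" by simp
  \<comment> \<open>A quarter of the gap, because three errors of this size follow: from the
    bending, from the variation of the Hessian and from that of \<beta>.\<close>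
  define \<kappa> where "\<kappa> = (F (H\<phi> x0) - \<beta> (u x0)) / 4"
  have kap: "\<kappa> > 0" using gap by (simp add: \<kappa>_def)
  define \<eta> where "\<eta> = \<kappa> / (2 * Lam)"
  have eta: "\<eta> > 0" "Lam * (2 * \<eta>) = \<kappa>" using kap Lam_pos by (auto simp: \<eta>_def)
  define \<psi> where "\<psi> = (\<lambda>x. \<phi> x - \<eta> * ((x - x0) \<bullet> (x - x0)))"
  define H where "H = (\<lambda>x. H\<phi> x - (2 * \<eta>) *\<^sub>R mat 1)"
  define D where "D = (\<lambda>x. D\<phi> x - \<eta> *\<^sub>R 2 *\<^sub>R (x - x0))"
  have C\<psi>: "C2_on (ball x0 r) \<psi> D H"
    unfolding \<psi>_def D_def H_def using C2_on_diff[OF C C2_on_paraboloid[of _ \<eta> x0 0]] by simp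
  have sym: "sym_mat (H\<phi> y)" if y: "y \<in> ball x0 r" for y
  proof -
    obtain s where "s > 0" "ball y s \<subseteq> ball x0 r" using openE[OF open_ball y] by blast
    then show ?thesis using C2_on_sym_mat C2_on_subset[OF C] by blast
  qed
  have FH: "F (H\<phi> y) \<le> F (H y) + \<kappa>" if "y \<in> ball x0 r" for y
    using F_add_psd_le[OF _ psd_mat_scaled_id, of "H y" "2 * \<eta>"] eta sym[OF that]
    by (simp add: H_def sym_mat_intros mnorm_scaled_id)
  obtain d1 where d1: "d1 > 0" "\<And>t. \<bar>t - u x0\<bar> < d1 \<Longrightarrow> \<bar>\<beta> t - \<beta> (u x0)\<bar> < \<kappa>"
    using \<beta> kap unfolding continuous_at_eps_delta dist_real_def by metis
  have cont: "continuous_on (ball x0 r) H\<phi>" using C by (simp add: C2_on_def)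
  have x0b: "x0 \<in> ball x0 r" using r by simp
  have "isCont (\<lambda>y. mnorm (H\<phi> y - H\<phi> x0)) x0"
  proof -
    have "isCont H\<phi> x0" using cont x0b continuous_on_eq_continuous_at open_ball by blast
    then have "(H\<phi> \<longlongrightarrow> H\<phi> x0) (at x0)" by (simp add: isCont_def)
    then have "((\<lambda>y. \<Sum>i\<in>UNIV. \<Sum>j\<in>UNIV. \<bar>(H\<phi> y - H\<phi> x0) $ i $ j\<bar>) \<longlongrightarrow>
      (\<Sum>i\<in>UNIV. \<Sum>j\<in>UNIV. \<bar>(H\<phi> x0 - H\<phi> x0) $ i $ j\<bar>)) (at x0)"
      by (intro tendsto_intros)
    then have "((\<lambda>y. \<Sum>i\<in>UNIV. \<Sum>j\<in>UNIV. \<bar>(H\<phi> y - H\<phi> x0) $ i $ j\<bar>) \<longlongrightarrow> 0) (at x0)"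
      by simp
    then have "((\<lambda>y. mnorm (H\<phi> y - H\<phi> x0)) \<longlongrightarrow> 0) (at x0)"
      by (rule Lim_null_comparison[rotated])
        (simp add: mnorm_def onorm_le_matrix_component_sum onorm_pos_le del: vector_minus_component)
    then show ?thesis by (simp add: isCont_def)
  qed
  then have "((\<lambda>y. mnorm (H\<phi> y - H\<phi> x0)) \<longlongrightarrow> mnorm (H\<phi> x0 - H\<phi> x0)) (nhds x0)"
    using tendsto_at_iff_tendsto_nhds[of "\<lambda>y. mnorm (H\<phi> y - H\<phi> x0)" x0]
    by (simp only: isCont_def)
  then have ev1: "eventually (\<lambda>y. mnorm (H\<phi> y - H\<phi> x0) < \<kappa> / Lam) (nhds x0)"
    by (rule order_tendstoD(2)) (use kap Lam_pos in simp)
  have \<psi>0: "\<psi> x0 = u x0" by (simp add: \<psi>_def eq)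
  have "isCont \<psi> x0"
    using C2_on_continuous(1)[OF C\<psi>] x0b continuous_on_eq_continuous_at open_ball by blast
  then have "(\<psi> \<longlongrightarrow> u x0) (nhds x0)"
    using tendsto_at_iff_tendsto_nhds[of \<psi> x0] by (simp only: isCont_def \<psi>0)
  then have "eventually (\<lambda>y. dist (\<psi> y) (u x0) < d1 / 2) (nhds x0)"
    using d1(1) by (intro tendstoD) auto
  moreover have "eventually (\<lambda>y. y \<in> \<Omega> \<inter> ball x0 r) (nhds x0)"
    using \<Omega> x0 x0b by (intro eventually_nhds_in_open) auto
  ultimately have "eventually (\<lambda>y. mnorm (H\<phi> y - H\<phi> x0) < \<kappa> / Lam \<and> dist (\<psi> y) (u x0) < d1 / 2
      \<and> y \<in> \<Omega> \<inter> ball x0 r) (nhds x0)"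
    using ev1 by eventually_elim auto
  then obtain d2 where d2: "d2 > 0" "\<And>y. dist y x0 < d2 \<Longrightarrow> mnorm (H\<phi> y - H\<phi> x0) < \<kappa> / Lam \<and>
      dist (\<psi> y) (u x0) < d1 / 2 \<and> y \<in> \<Omega> \<inter> ball x0 r"
    unfolding eventually_nhds_metric by blast
  define s where "s = d2 / 2"
  have s: "s > 0" using d2 by (simp add: s_def)
  have near: "mnorm (H\<phi> y - H\<phi> x0) < \<kappa> / Lam" "\<bar>\<psi> y - u x0\<bar> < d1 / 2" "y \<in> \<Omega>" "y \<in> ball x0 r"
    if "y \<in> cball x0 s" for y
    using d2(2)[of y] that d2(1) by (auto simp: s_def dist_commute dist_real_def)
  \<comment> \<open>The first bound in the minimum keeps the contact point off the sphere of radius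
    \<open>s\<close>, the second keeps \<open>w y1\<close> where \<beta> is nearly constant.\<close>
  obtain w where w: "w \<in> W" "w x0 < u x0 + min (\<eta> * s\<^sup>2) (d1 / 2)"
    using u(3)[of "min (\<eta> * s\<^sup>2) (d1 / 2)"] eta s d1(1) by auto
  have "continuous_on (cball x0 s) (\<lambda>y. w y - \<psi> y)"
    using W(2)[OF w(1)] C2_on_continuous(1)[OF C\<psi>] near
    by (intro continuous_intros) (meson continuous_on_subset subsetI)+
  then obtain y1 where y1: "y1 \<in> cball x0 s" "\<And>y. y \<in> cball x0 s \<Longrightarrow> w y1 - \<psi> y1 \<le> w y - \<psi> y"
    using continuous_attains_inf[of "cball x0 s" "\<lambda>y. w y - \<psi> y"] s by auto
  have low: "w y - \<psi> y \<ge> \<eta> * ((y - x0) \<bullet> (y - x0))" if "y \<in> cball x0 s" for y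
    using u(2)[OF w(1) near(3)[OF that]] le[rule_format, OF near(4)[OF that]] by (simp add: \<psi>_def)
  have up: "w y1 - \<psi> y1 < min (\<eta> * s\<^sup>2) (d1 / 2)"
  proof -
    have "w y1 - \<psi> y1 \<le> w x0 - \<psi> x0" using y1(2)[of x0] s by simp
    then show ?thesis using w(2) \<psi>0 by linarith
  qed
  have "dist x0 y1 \<noteq> s"
  proof
    assume "dist x0 y1 = s"
    then have "(y1 - x0) \<bullet> (y1 - x0) = s\<^sup>2" by (simp add: dot_square_norm dist_norm norm_minus_commute)
    then show False using low[OF y1(1)] up by simp
  qed
  then have "y1 \<in> ball x0 s" using y1(1) by simp
  then obtain e where e: "e > 0" "ball y1 e \<subseteq> ball x0 s" by (meson open_ball open_contains_ball)
  have esub: "ball y1 e \<subseteq> ball x0 r"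
    using e(2) near(4) by (meson ball_subset_cball subset_iff)
  have "F (H y1 + 0) \<le> \<beta> (w y1)"
  proof (rule super_atD[OF visc_superD[OF W(3)[OF w(1)] \<Omega> near(3)[OF y1(1)]] e(1)
        C2_on_add[OF C2_on_subset[OF C\<psi> esub] C2_on_const[of _ "w y1 - \<psi> y1"]]])
    fix y assume "y \<in> ball y1 e"
    then have "y \<in> cball x0 s" using e(2) ball_subset_cball by blast
    then show "\<psi> y + (w y1 - \<psi> y1) \<le> w y" using y1(2)[of y] by simp
  qed simp
  moreover have "\<bar>\<beta> (w y1) - \<beta> (u x0)\<bar> < \<kappa>"
  proof (rule d1(2))
    have "0 \<le> \<eta> * ((y1 - x0) \<bullet> (y1 - x0))" using eta by simp
    then show "\<bar>w y1 - u x0\<bar> < d1" using near(2)[OF y1(1)] up low[OF y1(1)] by linarith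
  qed
  moreover have "F (H\<phi> x0) - \<kappa> \<le> F (H\<phi> y1)"
  proof -
    have "Lam * mnorm (H\<phi> y1 - H\<phi> x0) \<le> \<kappa>"
      using near(1)[OF y1(1)] Lam_pos by (simp add: field_simps)
    then show ?thesis
      using F_diff_le_mnorm[of "H\<phi> x0" "H\<phi> y1 - H\<phi> x0"] sym[OF x0b] sym[OF near(4)[OF y1(1)]]
      by (simp add: sym_mat_intros)
  qed
  ultimately have "F (H\<phi> x0) < \<beta> (u x0) + 3 * \<kappa>"
    using FH[OF near(4)[OF y1(1)]] by simp
  then show False using gap by (simp add: \<kappa>_def field_simps)
qed

end

section \<open>Spreading of positivity\<close>

lemma Inf_image_attained:
  fixes f :: "'b::topological_space \<Rightarrow> real"
  assumes "compact K" "K \<noteq> {}" "continuous_on K f"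
  obtains y where "y \<in> K" "Inf (f ` K) = f y" "\<And>z. z \<in> K \<Longrightarrow> f y \<le> f z"
proof -
  obtain y where y: "y \<in> K" "\<forall>z\<in>K. f y \<le> f z"
    using continuous_attains_inf[OF assms] by blast
  then have "Inf (f ` K) = f y" by (intro cInf_eq_minimum) auto
  then show ?thesis using that y by blast
qed

text \<open>Two infima are compared by inserting the minimiser of one into the other; uniform
  continuity on the compact product controls the error.\<close>

lemma continuous_on_Inf_compact:
  fixes f :: "'a::metric_space \<Rightarrow> 'b::metric_space \<Rightarrow> real"
  assumes X: "compact X" and K: "compact K" "K \<noteq> {}"
    and f: "continuous_on (X \<times> K) (\<lambda>(x, y). f x y)"
  shows "continuous_on X (\<lambda>x. Inf (f x ` K))"
  unfolding continuous_on_iff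
proof (intro ballI allI impI)
  fix x e assume x: "x \<in> X" and e: "(e::real) > 0"
  have "uniformly_continuous_on (X \<times> K) (\<lambda>(x, y). f x y)"
    using f X K(1) by (intro compact_uniformly_continuous compact_Times)
  then obtain d where d: "d > 0" "\<And>p p'. p \<in> X \<times> K \<Longrightarrow> p' \<in> X \<times> K \<Longrightarrow> dist p' p < d \<Longrightarrow>
      dist (case p' of (x, y) \<Rightarrow> f x y) (case p of (x, y) \<Rightarrow> f x y) < e"
    using e unfolding uniformly_continuous_on_def by metis
  have sect: "continuous_on K (f z)" if "z \<in> X" for z
  proof -
    have "continuous_on K (\<lambda>y. (z, y))" by (intro continuous_intros)
    from continuous_on_compose2[OF f this] that show ?thesis by auto
  qed
  have *: "Inf (f a ` K) < Inf (f b ` K) + e" if ab: "a \<in> X" "b \<in> X" "dist a b < d" for a b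
  proof -
    obtain y where y: "y \<in> K" "Inf (f b ` K) = f b y"
      using Inf_image_attained[OF K sect[OF ab(2)]] by metis
    obtain z where z: "z \<in> K" "Inf (f a ` K) = f a z" "f a z \<le> f a y"
      using Inf_image_attained[OF K sect[OF ab(1)]] y(1) by metis
    have "dist (f a y) (f b y) < e"
      using d(2)[of "(b, y)" "(a, y)"] ab y(1) by (simp add: dist_Pair_Pair)
    then show ?thesis using y z by (simp add: dist_real_def)
  qed
  show "\<exists>d>0. \<forall>x'\<in>X. dist x' x < d \<longrightarrow> dist (Inf (f x' ` K)) (Inf (f x ` K)) < e"
  proof (intro exI conjI ballI impI)
    fix x' assume "x' \<in> X" "dist x' x < d"
    then show "dist (Inf (f x' ` K)) (Inf (f x ` K)) < e"
      using *[of x x'] *[of x' x] x by (simp add: dist_real_def dist_commute abs_if)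
  qed (rule d(1))
qed

context elliptic
begin

text \<open>The profile is \<open>s * (q + q powr (1 + \<gamma>))\<close> with \<open>q\<close> a
  Gaussian minus a level; \<open>p1\<close> and \<open>p2\<close> are its derivatives in the squared
  radius. Off the inner ball its linear part alone is a strict subsolution for zero right-hand side.
  The second derivative of the power contains \<open>q powr (\<gamma> - 1)\<close>, the same
  singularity as the reaction, and absorbs it however small \<open>q\<close> is.\<close>

lemma positivity_barrier_subsolution:
  fixes x x0 :: "real^'n"
  assumes \<gamma>: "0 < \<gamma>" "\<gamma> < 1" and pos: "0 < \<eta>" "0 < t" "0 < s" "0 < q"
    and k: "k = Lam / (lam * \<eta>\<^sup>2)"
    and s: "s powr (\<gamma> - 1) * t\<^sup>2 \<le> 4 * lam * \<eta>\<^sup>2 * k\<^sup>2 * exp (- (8 * k)) * s"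
    and \<sigma>: "\<sigma> = (x - x0) \<bullet> (x - x0)" "(\<eta> * t)\<^sup>2 \<le> \<sigma>" "\<sigma> \<le> 4 * t\<^sup>2"
    and E: "E = exp (- (k / t\<^sup>2 * \<sigma>))"
    and p1: "p1 = s * (1 + (1 + \<gamma>) * q powr \<gamma>) * (- (k / t\<^sup>2) * E)"
    and p2: "p2 = s * (1 + (1 + \<gamma>) * q powr \<gamma>) * ((k / t\<^sup>2)\<^sup>2 * E)
        + s * ((1 + \<gamma>) * \<gamma> * q powr (\<gamma> - 1)) * ((k / t\<^sup>2) * E)\<^sup>2"
  shows "\<gamma> * (s * q) powr (\<gamma> - 1) < F ((2 * p1) *\<^sub>R mat 1 + (4 * p2) *\<^sub>R outer (x - x0) (x - x0))"
proof -
  have kp: "k > 0" using k Lam_pos lam_pos pos by simp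
  define A where "A = s * (1 + (1 + \<gamma>) * q powr \<gamma>) * ((k / t\<^sup>2) * E)"
  define G where "G = s * ((1 + \<gamma>) * \<gamma> * q powr (\<gamma> - 1)) * ((k / t\<^sup>2) * E)\<^sup>2"
  have Ep: "E > 0" by (simp add: E)
  have "1 + (1 + \<gamma>) * q powr \<gamma> > 0" using \<gamma> by (intro add_pos_nonneg) auto
  then have A: "A > 0" unfolding A_def using pos kp Ep by (intro mult_pos_pos divide_pos_pos) auto
  have G0: "G \<ge> 0" unfolding G_def using pos \<gamma> by (intro mult_nonneg_nonneg) auto
  have p1A: "2 * p1 = - (2 * A)" by (simp add: p1 A_def)
  have p2A: "p2 = A * (k / t\<^sup>2) + G" by (simp add: p2 A_def G_def power2_eq_square)
  have p2pos: "4 * p2 \<ge> 0" using A kp G0 by (simp add: p2A)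
  have "lam * ((4 * p2) * \<sigma>) - Lam * (2 * A) \<le> F (- ((2 * A) *\<^sub>R mat 1) + (4 * p2) *\<^sub>R outer (x - x0) (x - x0))"
    using F_radial_ge[of "2 * A" "4 * p2" "x - x0"] A p2pos \<sigma>(1) by simp
  then have 1: "lam * ((4 * p2) * \<sigma>) - Lam * (2 * A)
      \<le> F ((2 * p1) *\<^sub>R mat 1 + (4 * p2) *\<^sub>R outer (x - x0) (x - x0))"
    by (simp add: p1A)
  have "lam * ((4 * p2) * \<sigma>) \<ge> lam * ((4 * p2) * (\<eta> * t)\<^sup>2)"
    using p2pos lam_pos \<sigma>(2) by (intro mult_left_mono) auto
  moreover have "lam * ((4 * p2) * (\<eta> * t)\<^sup>2) = 4 * A * (lam * \<eta>\<^sup>2 * k) + 4 * lam * \<eta>\<^sup>2 * (t\<^sup>2 * G)"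
    using pos by (simp add: p2A field_simps power2_eq_square)
  \<comment> \<open>The choice of \<open>k\<close> makes the gain of the first summand of
    \<open>p2\<close> twice the loss \<open>2 * (Lam * A)\<close>.\<close>
  moreover have "4 * A * (lam * \<eta>\<^sup>2 * k) = 4 * (Lam * A)" using k lam_pos pos by simp
  moreover have "Lam * A > 0" using Lam_pos A by simp
  moreover have "Lam * (2 * A) = 2 * (Lam * A)" by simp
  ultimately have 2: "4 * lam * \<eta>\<^sup>2 * (t\<^sup>2 * G) < lam * ((4 * p2) * \<sigma>) - Lam * (2 * A)"
    by linarith
  \<comment> \<open>Source of \<open>exp (- (8 * k))\<close>: the Gaussian is at least
    \<open>exp (- (4 * k))\<close> up to radius \<open>2 * t\<close>, and it enters \<open>G\<close>
    squared.\<close>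
  have "k / t\<^sup>2 * \<sigma> \<le> 4 * k"
    using \<sigma>(3) kp pos by (simp add: field_simps)
  then have "E \<ge> exp (- (4 * k))" by (simp add: E)
  then have "E\<^sup>2 \<ge> (exp (- (4 * k)))\<^sup>2" by (intro power_mono) auto
  also have "(exp (- (4 * k)))\<^sup>2 = exp (- (8 * k))" by (simp flip: exp_double)
  finally have E2: "exp (- (8 * k)) \<le> E\<^sup>2" .
  define Q where "Q = q powr (\<gamma> - 1)"
  have Q: "Q > 0" using pos by (simp add: Q_def)
  have "\<gamma> * (s * q) powr (\<gamma> - 1) = (\<gamma> * Q / t\<^sup>2) * (s powr (\<gamma> - 1) * t\<^sup>2)"
    using pos by (simp add: powr_mult Q_def)
  also have "\<dots> \<le> (\<gamma> * Q / t\<^sup>2) * (4 * lam * \<eta>\<^sup>2 * k\<^sup>2 * exp (- (8 * k)) * s)"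
    using s \<gamma> Q by (intro mult_left_mono) auto
  also have "\<dots> = 4 * lam * \<eta>\<^sup>2 * (t\<^sup>2 * (s * (1 * \<gamma> * Q) * ((k / t\<^sup>2)\<^sup>2 * exp (- (8 * k)))))"
    using pos by (simp add: field_simps power2_eq_square)
  also have "\<dots> \<le> 4 * lam * \<eta>\<^sup>2 * (t\<^sup>2 * (s * ((1 + \<gamma>) * \<gamma> * Q) * ((k / t\<^sup>2)\<^sup>2 * E\<^sup>2)))"
    using E2 \<gamma> Q pos lam_pos by (intro mult_left_mono mult_mono) auto
  also have "\<dots> = 4 * lam * \<eta>\<^sup>2 * (t\<^sup>2 * G)"
    by (simp add: G_def Q_def power_mult_distrib power_divide)
  finally show ?thesis using 1 2 by linarith
qed

lemma C2_on_positivity_barrier: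
  fixes x0 :: "real^'n"
  assumes "\<And>y. y \<in> U \<Longrightarrow> 0 < exp (- (a * ((y - x0) \<bullet> (y - x0)))) - c"
    and "\<And>\<sigma>. E \<sigma> = exp (- (a * \<sigma>))"
  shows "C2_on U (\<lambda>y. s * ((E ((y - x0) \<bullet> (y - x0)) - c) + (E ((y - x0) \<bullet> (y - x0)) - c) powr (1 + \<gamma>)))
   (\<lambda>y. (s * (1 + (1 + \<gamma>) * (E ((y - x0) \<bullet> (y - x0)) - c) powr \<gamma>) * (- a * E ((y - x0) \<bullet> (y - x0)))) *\<^sub>R 2 *\<^sub>R (y - x0))
   (\<lambda>y. (2 * (s * (1 + (1 + \<gamma>) * (E ((y - x0) \<bullet> (y - x0)) - c) powr \<gamma>) * (- a * E ((y - x0) \<bullet> (y - x0))))) *\<^sub>R mat 1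
    + (4 * (s * (1 + (1 + \<gamma>) * (E ((y - x0) \<bullet> (y - x0)) - c) powr \<gamma>) * (a\<^sup>2 * E ((y - x0) \<bullet> (y - x0)))
        + s * ((1 + \<gamma>) * \<gamma> * (E ((y - x0) \<bullet> (y - x0)) - c) powr (\<gamma> - 1)) * (a * E ((y - x0) \<bullet> (y - x0)))\<^sup>2)) *\<^sub>R outer (y - x0) (y - x0))"
proof (rule C2_on_radial)
  have dE: "(E has_real_derivative - a * E \<sigma>) (at \<sigma>)" for \<sigma>
    unfolding assms(2) by (auto intro!: derivative_eq_intros)
  fix y assume "y \<in> U"
  then have pos: "0 < E ((y - x0) \<bullet> (y - x0)) - c" using assms by simp
  show "((\<lambda>\<sigma>. s * ((E \<sigma> - c) + (E \<sigma> - c) powr (1 + \<gamma>))) has_real_derivative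
     s * (1 + (1 + \<gamma>) * (E ((y - x0) \<bullet> (y - x0)) - c) powr \<gamma>) * (- a * E ((y - x0) \<bullet> (y - x0))))
     (at ((y - x0) \<bullet> (y - x0)))"
    using pos by (auto intro!: derivative_eq_intros dE DERIV_fun_powr simp: algebra_simps)
  show "((\<lambda>\<sigma>. s * (1 + (1 + \<gamma>) * (E \<sigma> - c) powr \<gamma>) * (- a * E \<sigma>)) has_real_derivative
     s * (1 + (1 + \<gamma>) * (E ((y - x0) \<bullet> (y - x0)) - c) powr \<gamma>) * (a\<^sup>2 * E ((y - x0) \<bullet> (y - x0)))
        + s * ((1 + \<gamma>) * \<gamma> * (E ((y - x0) \<bullet> (y - x0)) - c) powr (\<gamma> - 1)) * (a * E ((y - x0) \<bullet> (y - x0)))\<^sup>2)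
     (at ((y - x0) \<bullet> (y - x0)))"
    using pos by (auto intro!: derivative_eq_intros dE DERIV_fun_powr simp: algebra_simps power2_eq_square)
next
  show "continuous_on ((\<lambda>y. (y - x0) \<bullet> (y - x0)) ` U)
     (\<lambda>\<sigma>. s * (1 + (1 + \<gamma>) * (E \<sigma> - c) powr \<gamma>) * (a\<^sup>2 * E \<sigma>)
        + s * ((1 + \<gamma>) * \<gamma> * (E \<sigma> - c) powr (\<gamma> - 1)) * (a * E \<sigma>)\<^sup>2)"
    unfolding assms(2) using assms(1) by (intro continuous_intros) force+
qed

text \<open>Barriers with level \<open>c\<close> are considered for \<open>c\<close> between
  \<open>chi\<close> and \<open>clo\<close>, the values of the Gaussian at radii
  \<open>\<eta> * t\<close> and \<open>3/2 * t\<close>. If the lowest level crossed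
  \<open>v\<close>, some level would give contact from below, against strict subsolution. Contact is
  essential because the reaction depends on \<open>v\<close>: it gives
  \<open>s * q \<le> v z\<close> and thereby an upper bound for \<open>\<beta> (v z)\<close>. The
  smallness condition says that the reaction is weak at height \<open>h\<close> and radius
  \<open>t\<close>.\<close>

lemma positivity_spreads:
  assumes \<gamma>: "0 < \<gamma>" "\<gamma> < 1" and \<eta>: "0 < \<eta>" "\<eta> < 1"
  shows "\<exists>c0>0. \<exists>c1>0. \<forall>\<beta> v (x0::real^'n) t h. 0 < t \<and> 0 < h \<and> continuous_on (cball x0 (2*t)) v
    \<and> (\<forall>x\<in>cball x0 (2*t). 0 \<le> v x) \<and> (\<forall>x\<in>ball x0 (2*t). super_at F \<beta> v x)
    \<and> \<beta> 0 \<le> 0 \<and> (\<forall>s>0. \<beta> s \<le> \<gamma> * s powr (\<gamma> - 1))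
    \<and> (\<forall>x\<in>cball x0 (\<eta>*t). h \<le> v x) \<and> h powr (\<gamma> - 1) * t\<^sup>2 \<le> c1 * h
    \<longrightarrow> (\<forall>x\<in>cball x0 t. c0 * h \<le> v x)"
proof -
  define k where "k = Lam / (lam * \<eta>\<^sup>2)"
  define c2 where "c2 = 4 * lam * \<eta>\<^sup>2 * k\<^sup>2 * exp (- (8 * k))"
  define chi where "chi = exp (- (k * \<eta>\<^sup>2))"
  define clo where "clo = exp (- (k * (9/4)))"
  \<comment> \<open>Lower bound, per unit of \<open>h\<close>, for the barrier of level
    \<open>clo\<close> at radius \<open>t\<close>; the 3 is that of
    \<open>s = h / 3\<close>.\<close>
  define c0 where "c0 = (exp (- k) - clo) / 3"
  have k: "k > 0" unfolding k_def using Lam_pos lam_pos \<eta> by simp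
  have c2: "c2 > 0" unfolding c2_def using lam_pos \<eta> k by simp
  have c0: "0 < c0" unfolding c0_def clo_def using k by simp
  have chi1: "chi \<le> 1" unfolding chi_def using k by simp
  have "\<eta>\<^sup>2 < 9/4" using \<eta> power_strict_mono[of \<eta> 1 2] by simp
  then have lohi: "clo \<le> chi" unfolding clo_def chi_def using k by simp
  have clo0: "clo > 0" by (simp add: clo_def)
  have c01: "c0 \<le> 1" using k by (simp add: c0_def clo_def) (smt (verit) exp_gt_zero exp_le_one_iff)
  show ?thesis
  proof (rule exI[of _ c0], rule conjI[OF c0], rule exI[of _ "c2/9"], intro conjI allI impI ballI;
      (elim conjE)?)
    show "0 < c2 / 9" using c2 by simp
    fix \<beta> v t h x and x0 :: "real^'n"
    assume t: "0 < t" and h: "0 < h" and v: "continuous_on (cball x0 (2*t)) v"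
      "\<forall>x\<in>cball x0 (2*t). 0 \<le> v x" "\<forall>x\<in>ball x0 (2*t). super_at F \<beta> v x"
      and b: "\<beta> 0 \<le> 0" "\<forall>s>0. \<beta> s \<le> \<gamma> * s powr (\<gamma> - 1)"
      and vh: "\<forall>x\<in>cball x0 (\<eta>*t). h \<le> v x" and small: "h powr (\<gamma> - 1) * t\<^sup>2 \<le> c2 / 9 * h"
      and x: "x \<in> cball x0 t"
    \<comment> \<open>As \<open>\<Phi>\<close> is at most 2 for \<open>q \<le> 1\<close>, a third of
      \<open>h\<close> keeps the barrier strictly below \<open>h\<close> on the inner
      sphere.\<close>
    define s where "s = h / 3"
    have s: "s > 0" using h by (simp add: s_def)
    have ssmall: "s powr (\<gamma> - 1) * t\<^sup>2 \<le> c2 * s"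
    proof -
      have "s powr (\<gamma> - 1) = 3 powr (1 - \<gamma>) * h powr (\<gamma> - 1)"
        using h by (simp add: s_def powr_divide powr_diff)
      moreover have "3 powr (1 - \<gamma>) \<le> (3::real) powr 1" using \<gamma> by (intro powr_mono) auto
      ultimately have "s powr (\<gamma> - 1) * t\<^sup>2 \<le> 3 * (h powr (\<gamma> - 1) * t\<^sup>2)"
        by (simp add: mult_right_mono mult.assoc)
      also have "\<dots> \<le> c2 * s" using small by (simp add: s_def)
      finally show ?thesis .
    qed
    define a where "a = k / t\<^sup>2"
    have a: "a > 0" using k t by (simp add: a_def)
    define E where "E = (\<lambda>\<sigma>. exp (- (a * \<sigma>)))"
    define \<sigma> where "\<sigma> = (\<lambda>y. (y - x0) \<bullet> (y - x0))"
    have \<sigma>d: "\<sigma> y = (dist x0 y)\<^sup>2" for y by (simp add: \<sigma>_def dot_square_norm dist_norm norm_minus_commute)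
    \<comment> \<open>Only the power is truncated, so the barrier is negative where
      \<open>q < 0\<close> and contact there contradicts \<open>v \<ge> 0\<close>.\<close>
    define \<Phi> where "\<Phi> = (\<lambda>q::real. q + (max q 0) powr (1 + \<gamma>))"
    have Phi_neg: "\<Phi> q \<le> 0" "q < 0 \<Longrightarrow> \<Phi> q < 0" if "q \<le> 0" for q using that by (auto simp: \<Phi>_def)
    have Phi_ge: "q \<le> \<Phi> q" for q by (simp add: \<Phi>_def)
    have Phi_le2: "\<Phi> q \<le> 2" if "q \<le> 1" for q
      using powr_mono2[of "1 + \<gamma>" "max q 0" 1] \<gamma> that by (simp add: \<Phi>_def)
    define K where "K = cball x0 (2*t) - ball x0 (\<eta>*t)"
    have K: "compact K" unfolding K_def by (intro compact_diff) auto
    have et: "\<eta> * t < t" using \<eta> t by simp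
    have memK: "y \<in> K \<longleftrightarrow> \<eta> * t \<le> dist x0 y \<and> dist x0 y \<le> 2 * t" for y by (auto simp: K_def)
    have \<sigma>K: "(\<eta> * t)\<^sup>2 \<le> \<sigma> y" "\<sigma> y \<le> 4 * t\<^sup>2" if "y \<in> K" for y
      using that \<eta> t power_mono[of "\<eta> * t" "dist x0 y" 2] power_mono[of "dist x0 y" "2 * t" 2]
      by (auto simp: memK \<sigma>d power_mult_distrib)
    define f where "f = (\<lambda>c y. v y - s * \<Phi> (E (\<sigma> y) - c))"
    have cf: "continuous_on ({clo..chi} \<times> K) (\<lambda>(c, y). f c y)"
    proof -
      have "continuous_on ({clo..chi} \<times> K) (\<lambda>p. v (snd p))"
        by (rule continuous_on_compose2[OF v(1)]) (auto intro!: continuous_intros simp: K_def)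
      moreover have "continuous_on UNIV (\<lambda>q. \<Phi> q)"
        unfolding \<Phi>_def using \<gamma> by (intro continuous_intros continuous_on_powr') auto
      then have "continuous_on ({clo..chi} \<times> K) (\<lambda>p. \<Phi> (E (\<sigma> (snd p)) - fst p))"
        unfolding E_def \<sigma>_def
        by (rule continuous_on_compose2) (auto intro!: continuous_intros)
      ultimately show ?thesis unfolding f_def split_def by (intro continuous_intros)
    qed
    have sect: "continuous_on K (f c)" if "c \<in> {clo..chi}" for c
    proof -
      have "continuous_on K (\<lambda>y. (c, y))" by (intro continuous_intros)
      from continuous_on_compose2[OF cf this] that show ?thesis by (auto simp: image_subset_iff)
    qed
    have "\<forall>y\<in>K. 0 \<le> f clo y"
    proof (rule ccontr)
      assume "\<not> (\<forall>y\<in>K. 0 \<le> f clo y)"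
      then obtain y0 where y0: "y0 \<in> K" "f clo y0 < 0" by force
      then have Kne: "K \<noteq> {}" by blast
      \<comment> \<open>Least gap between \<open>v\<close> and the barrier; continuity in the level
        produces a contact by the intermediate value theorem.\<close>
      define m where "m = (\<lambda>c. Inf (f c ` K))"
      have "m clo \<le> 0"
        using Inf_image_attained[OF K Kne sect[of clo]] y0 lohi unfolding m_def
        by (metis atLeastAtMost_iff order.strict_implies_order order.trans order_refl)
      moreover have "m chi \<ge> 0"
      proof -
        obtain y where y: "y \<in> K" "m chi = f chi y"
          using Inf_image_attained[OF K Kne sect[of chi]] lohi unfolding m_def
          by (metis atLeastAtMost_iff order_refl)
        have "k * \<eta>\<^sup>2 \<le> a * \<sigma> y"
          using \<sigma>K(1)[OF y(1)] k t by (simp add: a_def field_simps power_mult_distrib)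
        then have "E (\<sigma> y) \<le> chi" by (simp add: E_def chi_def)
        then have "s * \<Phi> (E (\<sigma> y) - chi) \<le> 0" using s Phi_neg(1) by (simp add: mult_le_0_iff)
        then show ?thesis using v(2) y by (force simp: f_def K_def)
      qed
      moreover have "continuous_on {clo..chi} m"
        unfolding m_def by (rule continuous_on_Inf_compact[OF _ K Kne cf]) simp
      ultimately obtain c where c: "clo \<le> c" "c \<le> chi" "m c = 0"
        using IVT'[of m clo 0 chi] lohi by auto
      obtain z where z: "z \<in> K" "f c z = 0" "\<And>y. y \<in> K \<Longrightarrow> 0 \<le> f c y"
        using Inf_image_attained[OF K Kne sect[of c]] c unfolding m_def
        by (metis atLeastAtMost_iff)
      define q where "q = E (\<sigma> z) - c"
      have vz: "v z = s * \<Phi> q" using z(2) by (simp add: f_def q_def)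
      have E1: "E (\<sigma> y) \<le> 1" for y using a by (simp add: E_def \<sigma>d)
      have "dist x0 z \<noteq> \<eta> * t"
      proof
        assume "dist x0 z = \<eta> * t"
        then have "h \<le> v z" using vh by simp
        moreover have "s * \<Phi> q \<le> s * 2"
          using Phi_le2[of q] E1[of z] c clo0 s unfolding q_def by (intro mult_left_mono) auto
        ultimately show False using vz h by (simp add: s_def)
      qed
      moreover have qnn: "q \<ge> 0"
      proof (rule ccontr)
        assume "\<not> q \<ge> 0"
        then have "s * \<Phi> q < 0" using Phi_neg(2)[of q] s by (simp add: mult_pos_neg)
        then show False using vz v(2) z(1) by (force simp: K_def)
      qed
      \<comment> \<open>Every level is at least \<open>clo\<close>, so the barrier is already
        negative at radius \<open>2 * t\<close>.\<close>
      moreover have "dist x0 z \<noteq> 2 * t"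
      proof
        assume "dist x0 z = 2 * t"
        then have "E (\<sigma> z) = exp (- (4 * k))" using t by (simp add: \<sigma>d E_def a_def power_mult_distrib)
        also have "\<dots> < clo" using k by (simp add: clo_def)
        finally show False using c qnn by (simp add: q_def)
      qed
      ultimately have zint: "z \<in> ball x0 (2*t) - cball x0 (\<eta>*t)" using z(1) by (auto simp: memK)
      have opn: "open (ball x0 (2*t) - cball x0 (\<eta>*t))" by (intro open_Diff) auto
      have subK: "ball x0 (2*t) - cball x0 (\<eta>*t) \<subseteq> K" by (auto simp: K_def)
      have sup: "super_at F \<beta> v z" using v(3) zint by simp
      show False
      \<comment> \<open>At \<open>q = 0\<close> the truncated power is not twice differentiable,
        since \<gamma> < 1. The linear part is tested instead, which suffices because
        \<open>v z = 0\<close> and \<open>\<beta> 0 \<le> 0\<close>.\<close>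
      proof (cases "q = 0")
        case True
        obtain e where e: "e > 0" "ball z e \<subseteq> ball x0 (2*t) - cball x0 (\<eta>*t)"
          using openE[OF opn zint] by blast
        have "\<And>\<sigma>. (E has_real_derivative - a * E \<sigma>) (at \<sigma>)"
          unfolding E_def by (auto intro!: derivative_eq_intros)
        then have C: "C2_on (ball z e) (\<lambda>y. s * (E ((y - x0) \<bullet> (y - x0)) - c))
           (\<lambda>y. (s * (- a * E ((y - x0) \<bullet> (y - x0)))) *\<^sub>R 2 *\<^sub>R (y - x0))
           (\<lambda>y. (2 * (s * (- a * E ((y - x0) \<bullet> (y - x0))))) *\<^sub>R mat 1
              + (4 * (s * (a * a * E ((y - x0) \<bullet> (y - x0))))) *\<^sub>R outer (y - x0) (y - x0))"
          by (intro C2_on_radial[where \<psi> = "\<lambda>\<sigma>. s * (E \<sigma> - c)" and \<psi>' = "\<lambda>\<sigma>. s * (- a * E \<sigma>)"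
                and \<psi>'' = "\<lambda>\<sigma>. s * (a * a * E \<sigma>)"])
            (auto intro!: derivative_eq_intros continuous_intros simp: E_def)
        define A where "A = s * (a * E ((z - x0) \<bullet> (z - x0)))"
        have A: "A > 0" unfolding A_def E_def using s a by simp
        have "F ((2 * (s * (- a * E ((z - x0) \<bullet> (z - x0))))) *\<^sub>R mat 1
              + (4 * (s * (a * a * E ((z - x0) \<bullet> (z - x0))))) *\<^sub>R outer (z - x0) (z - x0)) \<le> \<beta> (v z)"
        proof (rule super_atD[OF sup e(1) C])
          show "s * (E ((z - x0) \<bullet> (z - x0)) - c) = v z"
            using True vz Phi_ge[of 0] by (simp add: q_def \<sigma>_def \<Phi>_def)
          fix y assume "y \<in> ball z e"
          then have "0 \<le> f c y" using e(2) subK z(3) by blast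
          moreover have "s * (E (\<sigma> y) - c) \<le> s * \<Phi> (E (\<sigma> y) - c)"
            using s Phi_ge by (intro mult_left_mono) auto
          ultimately show "s * (E ((y - x0) \<bullet> (y - x0)) - c) \<le> v y" by (simp add: f_def \<sigma>_def)
        qed
        also have "v z = 0" using vz True by (simp add: \<Phi>_def)
        finally have "F (- ((2 * A) *\<^sub>R mat 1) + (4 * (A * a)) *\<^sub>R outer (z - x0) (z - x0)) \<le> 0"
          using b(1) by (simp add: A_def mult_ac)
        moreover have "lam * ((4 * (A * a)) * \<sigma> z) - Lam * (2 * A)
            \<le> F (- ((2 * A) *\<^sub>R mat 1) + (4 * (A * a)) *\<^sub>R outer (z - x0) (z - x0))"
          unfolding \<sigma>_def by (rule F_radial_ge) (use A a in auto)
        ultimately have "lam * ((4 * (A * a)) * \<sigma> z) \<le> Lam * (2 * A)" by linarith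
        then have "A * (4 * (lam * (a * \<sigma> z))) \<le> A * (2 * Lam)" by (simp only: mult_ac)
        then have "4 * (lam * (a * \<sigma> z)) \<le> 2 * Lam" using A by (rule mult_left_le_imp_le)
        moreover have "Lam \<le> lam * (a * \<sigma> z)"
        proof -
          have "lam * (a * (\<eta> * t)\<^sup>2) \<le> lam * (a * \<sigma> z)"
            using lam_pos a \<sigma>K(1)[OF z(1)] by (intro mult_left_mono) auto
          moreover have "lam * (a * (\<eta> * t)\<^sup>2) = Lam"
            using lam_pos \<eta> t by (simp add: a_def k_def field_simps)
          ultimately show ?thesis by simp
        qed
        ultimately show False using Lam_pos by linarith
      next
        case False
        then have q: "q > 0" using qnn by simp
        have "open ({y. 0 < E (\<sigma> y) - c} \<inter> (ball x0 (2*t) - cball x0 (\<eta>*t)))"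
          unfolding E_def \<sigma>_def
          by (intro open_Int opn open_Collect_less continuous_intros)
        moreover have "z \<in> {y. 0 < E (\<sigma> y) - c} \<inter> (ball x0 (2*t) - cball x0 (\<eta>*t))"
          using q zint by (simp add: q_def)
        ultimately obtain e where e: "e > 0"
          "ball z e \<subseteq> {y. 0 < E (\<sigma> y) - c} \<inter> (ball x0 (2*t) - cball x0 (\<eta>*t))"
          using openE by blast
        have pos: "0 < exp (- (a * ((y - x0) \<bullet> (y - x0)))) - c" if "y \<in> ball z e" for y
          using e(2) that by (auto simp: E_def \<sigma>_def)
        note C = C2_on_positivity_barrier[of "ball z e" a x0 c E s \<gamma>, OF pos]
        have "F ((2 * (s * (1 + (1 + \<gamma>) * (E (\<sigma> z) - c) powr \<gamma>) * (- a * E (\<sigma> z)))) *\<^sub>R mat 1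
            + (4 * (s * (1 + (1 + \<gamma>) * (E (\<sigma> z) - c) powr \<gamma>) * (a\<^sup>2 * E (\<sigma> z))
              + s * ((1 + \<gamma>) * \<gamma> * (E (\<sigma> z) - c) powr (\<gamma> - 1)) * (a * E (\<sigma> z))\<^sup>2)) *\<^sub>R outer (z - x0) (z - x0))
            \<le> \<beta> (v z)"
          unfolding \<sigma>_def
        proof (rule super_atD[OF sup e(1) C])
          show "E \<sigma> = exp (- (a * \<sigma>))" for \<sigma> by (simp add: E_def)
          show "s * (E ((z - x0) \<bullet> (z - x0)) - c + (E ((z - x0) \<bullet> (z - x0)) - c) powr (1 + \<gamma>)) = v z"
            using q vz by (simp add: q_def \<sigma>_def \<Phi>_def max_def)
          fix y assume y: "y \<in> ball z e"
          then have "0 \<le> f c y" using e(2) subK z(3) by blast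
          then show "s * (E ((y - x0) \<bullet> (y - x0)) - c + (E ((y - x0) \<bullet> (y - x0)) - c) powr (1 + \<gamma>)) \<le> v y"
            using pos[OF y] by (simp add: f_def \<sigma>_def \<Phi>_def max_def E_def)
        qed
        moreover have "\<beta> (v z) \<le> \<gamma> * (s * q) powr (\<gamma> - 1)"
        proof -
          have "s * q \<le> v z" unfolding vz using s Phi_ge by (intro mult_left_mono) auto
          moreover have "0 < s * q" using s q by simp
          ultimately have "v z powr (\<gamma> - 1) \<le> (s * q) powr (\<gamma> - 1)" and "v z > 0"
            using \<gamma> by (auto intro: powr_mono2')
          then show ?thesis using b(2) \<gamma>
            by (meson mult_left_mono less_imp_le order_trans)
        qed
        ultimately show False
          using positivity_barrier_subsolution[OF \<gamma> \<eta>(1) t s q k_def ssmall[unfolded c2_def]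
              \<sigma>_def[THEN fun_cong] \<sigma>K[OF z(1)] _ refl refl, of "E (\<sigma> z)"]
          unfolding q_def a_def E_def by simp
      qed
    qed
    show "c0 * h \<le> v x"
    proof (cases "x \<in> K")
      case True
      then have "s * \<Phi> (E (\<sigma> x) - clo) \<le> v x"
        using \<open>\<forall>y\<in>K. 0 \<le> f clo y\<close> by (simp add: f_def)
      moreover have "s * (E (\<sigma> x) - clo) \<le> s * \<Phi> (E (\<sigma> x) - clo)"
        using s Phi_ge by (intro mult_left_mono) auto
      moreover have "s * (exp (- k) - clo) \<le> s * (E (\<sigma> x) - clo)"
      proof -
        have "\<sigma> x \<le> t\<^sup>2" using x t unfolding \<sigma>d by (intro power_mono) auto
        then have "a * \<sigma> x \<le> k" using k t by (simp add: a_def field_simps)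
        then show ?thesis using s by (simp add: E_def)
      qed
      moreover have "c0 * h = s * (exp (- k) - clo)" by (simp add: c0_def s_def)
      ultimately show ?thesis by linarith
    next
      case False
      then have "h \<le> v x" using vh x t by (auto simp: memK)
      moreover have "c0 * h \<le> 1 * h" using c01 h by (intro mult_right_mono) auto
      ultimately show ?thesis by simp
    qed
  qed
qed

end

section \<open>Interior modulus of continuity\<close>

text \<open>Minimality in the form of a comparison on balls. The supersolution property of
  \<open>w\<close> is required only where \<open>w < u\<close>, since elsewhere the competitor
  \<open>min u w\<close> coincides with \<open>u\<close>.\<close>

definition least_super :: "(real^'n^'n \<Rightarrow> real) \<Rightarrow> (real \<Rightarrow> real) \<Rightarrow> (real^'n) set \<Rightarrow> (real^'n \<Rightarrow> real) \<Rightarrow> bool" where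
  "least_super F \<beta> U u \<longleftrightarrow> (\<forall>Z r w. 0 < r \<and> cball Z r \<subseteq> U \<and> continuous_on (cball Z r) w
     \<and> (\<forall>x\<in>cball Z r. 0 \<le> w x) \<and> (\<forall>x\<in>sphere Z r. u x \<le> w x)
     \<and> (\<forall>x\<in>ball Z r. w x < u x \<longrightarrow> super_at F \<beta> w x) \<longrightarrow> (\<forall>x\<in>cball Z r. u x \<le> w x))"

lemma least_superD:
  assumes "least_super F \<beta> U u" "0 < r" "cball Z r \<subseteq> U" "continuous_on (cball Z r) w"
    "\<And>x. x \<in> cball Z r \<Longrightarrow> 0 \<le> w x" "\<And>x. x \<in> sphere Z r \<Longrightarrow> u x \<le> w x"
    "\<And>x. x \<in> ball Z r \<Longrightarrow> w x < u x \<Longrightarrow> super_at F \<beta> w x" "x \<in> cball Z r"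
  shows "u x \<le> w x"
  using assms unfolding least_super_def by blast

text \<open>With \<open>a = H *v e\<close> the congruence expands to \<open>H + outer a b + outer b
  a + (e \<bullet> a) *\<^sub>R outer b b\<close>. Taking \<open>b\<close> along \<open>a\<close>
  keeps the perturbation of rank one; what remains is to make its coefficient large whatever the
  sign of the curvature of \<open>H\<close> along \<open>e\<close>. The number \<open>K\<close>
  stands for the concavity of the penalty.\<close>

lemma rank_one_coupling:
  fixes H :: "real^'n^'n" and e :: "real^'n"
  assumes H: "sym_mat H" and e: "norm e = 1" and K: "K > 0"
  obtains b \<xi> l where "0 \<le> l" "4 * K \<le> l * (\<xi> \<bullet> \<xi>)"
    "transpose (mat 1 + outer e b) ** H ** (mat 1 + outer e b) + K *\<^sub>R outer b b = H + l *\<^sub>R outer \<xi> \<xi>"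
proof -
  note result = that
  define a where "a = H *v e"
  define q where "q = - (e \<bullet> a) - K"
  have ax: "e \<bullet> (H *v x) = a \<bullet> x" for x using sym_mat_inner[OF H] by (simp add: a_def)
  have expand: "(transpose (mat 1 + outer e b) ** H ** (mat 1 + outer e b) + K *\<^sub>R outer b b) *v x
      = H *v x + (b \<bullet> x) *\<^sub>R a + (a \<bullet> x) *\<^sub>R b - (q * (b \<bullet> x)) *\<^sub>R b" for b x
    by (simp add: transpose_add transpose_outer matrix_vector_mul_assoc[symmetric] mat_vec_simps
        ax a_def[symmetric] inner_add_right q_def algebra_simps del: transpose_matrix_vector)
  have ee: "e \<bullet> e = 1" using e by (simp add: dot_square_norm)
  have mult_a: thesis if l: "0 \<le> 2 * \<theta> - q * \<theta>\<^sup>2" "4 * K \<le> (2 * \<theta> - q * \<theta>\<^sup>2) * (a \<bullet> a)" for \<theta>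
  proof (rule result[OF l, of "\<theta> *\<^sub>R a"])
    show "transpose (mat 1 + outer e (\<theta> *\<^sub>R a)) ** H ** (mat 1 + outer e (\<theta> *\<^sub>R a))
        + K *\<^sub>R outer (\<theta> *\<^sub>R a) (\<theta> *\<^sub>R a) = H + (2 * \<theta> - q * \<theta>\<^sup>2) *\<^sub>R outer a a"
      unfolding matrix_eq expand
      by (simp add: mat_vec_simps power2_eq_square algebra_simps flip: scaleR_add_left)
  qed
  consider "a = 0" | "a \<noteq> 0" "q \<le> 0" | "q > 0" by linarith
  then show thesis
  proof cases
    case 1
    \<comment> \<open>Here \<open>a\<close> offers no direction, so \<open>b\<close> is taken along
      \<open>e\<close>; its factor 2 squares to the constant 4.\<close>
    show thesis
    proof (rule that[of "4 * K" e "2 *\<^sub>R e"])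
      show "transpose (mat 1 + outer e (2 *\<^sub>R e)) ** H ** (mat 1 + outer e (2 *\<^sub>R e))
          + K *\<^sub>R outer (2 *\<^sub>R e) (2 *\<^sub>R e) = H + (4 * K) *\<^sub>R outer e e"
        unfolding matrix_eq expand using 1 by (simp add: mat_vec_simps q_def algebra_simps)
    qed (use K ee in auto)
  next
    case 2
    define \<theta> where "\<theta> = 2 * K / (a \<bullet> a)"
    have aa: "a \<bullet> a > 0" using 2 by simp
    have th: "\<theta> > 0" "2 * \<theta> * (a \<bullet> a) = 4 * K" using aa K by (auto simp: \<theta>_def)
    have "2 * \<theta> \<le> 2 * \<theta> - q * \<theta>\<^sup>2" using 2 by (simp add: mult_nonpos_nonneg)
    moreover from this have "2 * \<theta> * (a \<bullet> a) \<le> (2 * \<theta> - q * \<theta>\<^sup>2) * (a \<bullet> a)"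
      using aa by (intro mult_right_mono) auto
    ultimately show thesis using th by (intro mult_a[of \<theta>]) auto
  next
    case 3
    \<comment> \<open>The choice \<open>\<theta> = 1 / q\<close> maximises the coefficient, and
      \<open>(q + K)\<^sup>2 \<ge> 4 * K * q\<close> gives the constant 4 again.\<close>
    have "(e \<bullet> a)\<^sup>2 \<le> (a \<bullet> a)" using Cauchy_Schwarz_ineq[of e a] ee by simp
    moreover have "(e \<bullet> a)\<^sup>2 = (q + K)\<^sup>2" by (simp add: q_def power2_eq_square algebra_simps)
    moreover have "(q + K)\<^sup>2 \<ge> 4 * K * q" using zero_le_power2[of "q - K"]
      by (simp add: power2_eq_square algebra_simps)
    ultimately have "4 * K * q \<le> a \<bullet> a" by linarith
    moreover have "2 * (1 / q) - q * (1 / q)\<^sup>2 = 1 / q" using 3 by (simp add: power2_eq_square)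
    ultimately show thesis using 3 by (intro mult_a[of "1 / q"]) (auto simp: field_simps)
  qed
qed

text \<open>Second-order information on \<open>w(x) = inf\<^sub>y (u(y) + p \<bar>x - y\<bar>)\<close> is obtained by moving the pair \<open>(x, y)\<close>
  along \<open>(x0 + T z, y0 + z)\<close>, where \<open>T - I\<close> has range along \<open>x0 - y0\<close>, so that the penalty becomes a
  function of one variable; optimising over \<open>T\<close> turns the concavity of \<open>p\<close> into a gain in the
  Hessian.\<close>

lemma (in elliptic) inf_convolution_gain:
  fixes x0 y0 :: "real^'n"
  assumes sup: "super_at F \<beta> u y0" and r: "r > 0" and \<phi>: "C2_on (ball x0 r) \<phi> D\<phi> H"
    and t: "t = dist x0 y0" "0 < t"
    and p: "\<And>s. s > 0 \<Longrightarrow> (p has_real_derivative p' s) (at s)"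
      "\<And>s. s > 0 \<Longrightarrow> (p' has_real_derivative p'' s) (at s)" "continuous_on {0<..} p''"
    and conc: "p'' t < 0" and e: "0 < e"
    and eq: "\<phi> x0 = u y0 + p t"
    and le: "\<And>x y. x \<in> ball x0 r \<Longrightarrow> y \<in> ball y0 e \<Longrightarrow> \<phi> x \<le> u y + p (dist x y)"
  shows "F (H x0) + lam * (4 * (- p'' t)) \<le> \<beta> (u y0)"
proof -
  define d where "d = (1 / t) *\<^sub>R (x0 - y0)"
  have d: "norm d = 1" "x0 - y0 = t *\<^sub>R d" using t by (auto simp: d_def dist_norm)
  have H: "sym_mat (H x0)" by (rule C2_on_sym_mat[OF \<phi> r])
  have gain: "- p'' t > 0" using conc by simp
  obtain b \<xi> l where b: "0 \<le> l" "4 * (- p'' t) \<le> l * (\<xi> \<bullet> \<xi>)"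
    "transpose (mat 1 + outer d b) ** H x0 ** (mat 1 + outer d b) + (- p'' t) *\<^sub>R outer b b
      = H x0 + l *\<^sub>R outer \<xi> \<xi>"
    by (rule rank_one_coupling[OF H d(1) gain])
  define T where "T = mat 1 + outer d b"
  have Tz: "T *v z = z + (b \<bullet> z) *\<^sub>R d" for z by (simp add: T_def mat_vec_simps)
  \<comment> \<open>Keeps the moved point in the domain of \<open>\<phi>\<close> and the distance
    \<open>b \<bullet> (y - y0) + t\<close> positive, where the penalty is smooth.\<close>
  define \<epsilon> where "\<epsilon> = min e (min r t / (2 * (1 + norm b)))"
  have eps: "\<epsilon> > 0" using e r t(2) by (simp add: \<epsilon>_def add_pos_nonneg)
  have small: "norm (T *v (y - y0)) < r" "\<bar>b \<bullet> (y - y0)\<bar> < t" "y \<in> ball y0 e" if "y \<in> ball y0 \<epsilon>" for y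
  proof -
    define z where "z = y - y0"
    have z: "norm z < \<epsilon>" using that by (simp add: z_def dist_norm norm_minus_commute)
    have "(1 + norm b) * norm z < (1 + norm b) * (min r t / (2 * (1 + norm b)))"
      using z by (intro mult_strict_left_mono) (auto simp: \<epsilon>_def add_pos_nonneg)
    also have "\<dots> = min r t / 2" using norm_ge_zero[of b] by (simp add: field_simps del: norm_ge_zero)
    finally have *: "norm z + norm b * norm z < min r t / 2" by (simp add: algebra_simps)
    have bz: "\<bar>b \<bullet> z\<bar> \<le> norm b * norm z" by (rule Cauchy_Schwarz_ineq2)
    have "norm (T *v z) \<le> norm z + \<bar>b \<bullet> z\<bar>"
      unfolding Tz using norm_triangle_ineq[of z "(b \<bullet> z) *\<^sub>R d"] d(1) by simp
    then show "norm (T *v (y - y0)) < r" using * bz r t(2) unfolding z_def[symmetric] by linarith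
    show "\<bar>b \<bullet> (y - y0)\<bar> < t" using * bz r t(2) norm_ge_zero[of z] unfolding z_def[symmetric] by linarith
    show "y \<in> ball y0 e" using z by (simp add: z_def \<epsilon>_def dist_norm norm_minus_commute)
  qed
  have C1: "C2_on (ball y0 \<epsilon>) (\<lambda>y. \<phi> (x0 + T *v (y - y0))) (\<lambda>y. transpose T *v D\<phi> (x0 + T *v (y - y0)))
      (\<lambda>y. transpose T ** H (x0 + T *v (y - y0)) ** T)"
    by (rule C2_on_compose_affine[OF \<phi>]) (use small(1) in \<open>simp add: dist_norm\<close>)
  have C2: "C2_on (ball y0 \<epsilon>) (\<lambda>y. p (b \<bullet> (y - y0) + t)) (\<lambda>y. p' (b \<bullet> (y - y0) + t) *\<^sub>R b)
      (\<lambda>y. p' (b \<bullet> (y - y0) + t) *\<^sub>R 0 + p'' (b \<bullet> (y - y0) + t) *\<^sub>R outer b b)"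
  proof (rule C2_on_scalar_comp[OF C2_on_affine])
    fix y assume "y \<in> ball y0 \<epsilon>"
    from small(2)[OF this] have "b \<bullet> (y - y0) + t > 0" by linarith
    then show "(p has_real_derivative p' (b \<bullet> (y - y0) + t)) (at (b \<bullet> (y - y0) + t))"
      "(p' has_real_derivative p'' (b \<bullet> (y - y0) + t)) (at (b \<bullet> (y - y0) + t))"
      using p by auto
  next
    have "b \<bullet> (y - y0) + t > 0" if "y \<in> ball y0 \<epsilon>" for y using small(2)[OF that] by linarith
    then show "continuous_on ((\<lambda>y. b \<bullet> (y - y0) + t) ` ball y0 \<epsilon>) p''"
      by (intro continuous_on_subset[OF p(3)]) auto
  qed
  have "F (transpose T ** H (x0 + T *v (y0 - y0)) ** T
      - (p' (b \<bullet> (y0 - y0) + t) *\<^sub>R 0 + p'' (b \<bullet> (y0 - y0) + t) *\<^sub>R outer b b)) \<le> \<beta> (u y0)"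
  proof (rule super_atD[OF sup eps C2_on_diff[OF C1 C2]])
    show "\<phi> (x0 + T *v (y0 - y0)) - p (b \<bullet> (y0 - y0) + t) = u y0" by (simp add: eq)
    fix y assume y: "y \<in> ball y0 \<epsilon>"
    have "x0 + T *v (y - y0) - y = (b \<bullet> (y - y0) + t) *\<^sub>R d"
      using d(2) by (simp add: Tz scaleR_add_left algebra_simps)
    then have "dist (x0 + T *v (y - y0)) y = b \<bullet> (y - y0) + t"
      using small(2)[OF y] d(1) by (simp add: dist_norm)
    moreover have "\<phi> (x0 + T *v (y - y0)) \<le> u y + p (dist (x0 + T *v (y - y0)) y)"
      by (rule le) (use small[OF y] in \<open>auto simp: dist_norm\<close>)
    ultimately show "\<phi> (x0 + T *v (y - y0)) - p (b \<bullet> (y - y0) + t) \<le> u y" by simp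
  qed
  then have "F (H x0 + l *\<^sub>R outer \<xi> \<xi>) \<le> \<beta> (u y0)"
    using b(3) by (simp add: T_def)
  moreover have "F (H x0) + lam * (l * (\<xi> \<bullet> \<xi>)) \<le> F (H x0 + l *\<^sub>R outer \<xi> \<xi>)"
    using F_add_psd_ge[OF H psd_mat_outer[OF b(1)], of \<xi>] b(1) by (simp add: mnorm_outer)
  moreover have "lam * (4 * (- p'' t)) \<le> lam * (l * (\<xi> \<bullet> \<xi>))"
    using b(2) lam_pos by (intro mult_left_mono) auto
  ultimately show ?thesis by linarith
qed

text \<open>The exponent gives a second derivative of order \<open>s powr (\<gamma> - 1)\<close>,
  the order of the reaction at values comparable to \<open>s\<close>. The factor 8 keeps the penalty
  between \<open>3/4\<close> and 1 times \<open>a * s\<close> up to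
  \<open>s = 2 * D\<close>.\<close>

definition concave_penalty :: "real \<Rightarrow> real \<Rightarrow> real \<Rightarrow> real \<Rightarrow> real" where
  "concave_penalty a \<gamma> D s = a * (s - s powr (1 + \<gamma>) / (8 * D powr \<gamma>))"

context
  fixes a \<gamma> D :: real
  assumes a: "0 < a" and \<gamma>: "0 < \<gamma>" "\<gamma> < 1" and D: "0 < D"
begin

lemma concave_penalty_le: "concave_penalty a \<gamma> D s \<le> a * s"
  unfolding concave_penalty_def using a D by (intro mult_left_mono) auto

lemma concave_penalty_ge:
  assumes "0 \<le> s" "s \<le> 2 * D" shows "a * (s * (3/4)) \<le> concave_penalty a \<gamma> D s"
proof -
  have "s powr (1 + \<gamma>) = s * s powr \<gamma>" using assms by (simp add: powr_add powr_one)
  moreover have "s powr \<gamma> \<le> (2 * D) powr \<gamma>" using assms \<gamma> by (intro powr_mono2) auto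
  moreover have "(2 * D) powr \<gamma> \<le> 2 * D powr \<gamma>"
    using D powr_mono[of \<gamma> 1 2] \<gamma> by (simp add: powr_mult)
  ultimately have "s powr (1 + \<gamma>) \<le> s * (2 * D powr \<gamma>)"
    using assms by (simp add: mult_left_mono)
  then have "s powr (1 + \<gamma>) / (8 * D powr \<gamma>) \<le> s / 4" using D by (simp add: field_simps)
  then show ?thesis unfolding concave_penalty_def using a by (intro mult_left_mono) auto
qed

lemma concave_penalty_deriv:
  assumes "s > 0"
  shows "(concave_penalty a \<gamma> D has_real_derivative a * (1 - (1 + \<gamma>) * s powr \<gamma> / (8 * D powr \<gamma>))) (at s)"
    "((\<lambda>s. a * (1 - (1 + \<gamma>) * s powr \<gamma> / (8 * D powr \<gamma>))) has_real_derivative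
      - (a * ((1 + \<gamma>) * \<gamma> * s powr (\<gamma> - 1) / (8 * D powr \<gamma>)))) (at s)"
  unfolding concave_penalty_def[abs_def] using assms D
  by (auto intro!: derivative_eq_intros simp: field_simps)

lemma continuous_on_concave_penalty: "continuous_on {0..} (concave_penalty a \<gamma> D)"
  unfolding concave_penalty_def[abs_def] using \<gamma> D by (intro continuous_intros continuous_on_powr') auto

end

text \<open>The last hypothesis bounds the reaction in units where size and radius are 1. The bound
  on the reaction at the minimiser and the concavity of the penalty both scale like
  \<open>\<tau> powr (\<gamma> - 1)\<close> with \<open>\<tau> = t / D\<close>, but only the
  concavity carries the factor \<open>L\<close>; hence one large \<open>L\<close> wins at every
  distance. Evaluation at the centre removes the added paraboloid.\<close>

lemma (in elliptic) interior_modulus: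
  assumes \<gamma>: "0 < \<gamma>" "\<gamma> < 1" and \<kappa>: "0 \<le> \<kappa>"
  shows "\<exists>L>0. \<forall>\<beta> u (Y::real^'n) D m U. 0 < D \<and> 0 < m \<and> cball Y D \<subseteq> U \<and> continuous_on (cball Y D) u
    \<and> (\<forall>x\<in>cball Y D. 0 \<le> u x \<and> u x \<le> 4 * m) \<and> (\<forall>x\<in>ball Y D. super_at F \<beta> u x)
    \<and> (\<forall>s. 0 \<le> \<beta> s) \<and> \<beta> 0 \<le> 0 \<and> (\<forall>s>0. \<beta> s \<le> \<gamma> * s powr (\<gamma> - 1))
    \<and> least_super F \<beta> U u \<and> m powr (\<gamma> - 1) * D\<^sup>2 \<le> \<kappa> * m
    \<longrightarrow> (\<forall>y\<in>cball Y D. u Y \<le> u y + L * m / D * dist Y y)"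
proof -
  obtain c0 c1 where c0: "c0 > 0" and c1: "c1 > 0" and spread:
    "\<And>\<beta> v (x0::real^'n) t h x. 0 < t \<Longrightarrow> 0 < h \<Longrightarrow> continuous_on (cball x0 (2*t)) v \<Longrightarrow>
    (\<forall>x\<in>cball x0 (2*t). 0 \<le> v x) \<Longrightarrow> (\<forall>x\<in>ball x0 (2*t). super_at F \<beta> v x)
    \<Longrightarrow> \<beta> 0 \<le> 0 \<Longrightarrow> (\<forall>s>0. \<beta> s \<le> \<gamma> * s powr (\<gamma> - 1))
    \<Longrightarrow> (\<forall>x\<in>cball x0 (1/2*t). h \<le> v x) \<Longrightarrow> h powr (\<gamma> - 1) * t\<^sup>2 \<le> c1 * h
    \<Longrightarrow> x\<in>cball x0 t \<Longrightarrow> c0 * h \<le> v x"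
    using positivity_spreads[OF \<gamma>, of "1/2"] by (auto 0 3)
  \<comment> \<open>The summands serve, in order, \<open>t < D / 4\<close>,
    \<open>1 \<le> c0 * (L / 4)\<close>, the smallness condition for spreading positivity, and the
    final balance of concavity against reaction and paraboloid.\<close>
  define L where "L = 32 + 4 / c0 + 4 * \<kappa> / c1 + 2 * (32 * Lam + \<kappa>) / (lam * \<gamma>)"
  have Lpos: "0 \<le> 4 / c0" "0 \<le> 4 * \<kappa> / c1" "0 \<le> 2 * (32 * Lam + \<kappa>) / (lam * \<gamma>)"
    using c0 c1 \<kappa> Lam_pos lam_pos \<gamma> by auto
  then have L: "32 \<le> L" "4 / c0 \<le> L" "4 * \<kappa> / c1 \<le> L" "2 * (32 * Lam + \<kappa>) / (lam * \<gamma>) \<le> L"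
    unfolding L_def by linarith+
  have L1: "1 \<le> c0 * (L / 4)" using L(2) c0 by (simp add: field_simps)
  have L2: "\<kappa> \<le> c1 * (L / 4)" using L(3) c1 by (simp add: field_simps)
  have L3: "32 * Lam + \<kappa> \<le> lam * L * \<gamma> / 2" using L(4) lam_pos \<gamma> by (simp add: field_simps)
  have L0: "L > 0" using L(1) by simp
  show ?thesis
  proof (rule exI[of _ L], rule conjI[OF L0], intro allI impI ballI, elim conjE)
    fix \<beta> u D m U y and Y :: "real^'n"
    assume D: "0 < D" and m: "0 < m" and U: "cball Y D \<subseteq> U" and cu: "continuous_on (cball Y D) u"
      and ub: "\<forall>x\<in>cball Y D. 0 \<le> u x \<and> u x \<le> 4 * m" and sup: "\<forall>x\<in>ball Y D. super_at F \<beta> u x"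
      and b0: "\<forall>s. 0 \<le> \<beta> s" "\<beta> 0 \<le> 0" and b: "\<forall>s>0. \<beta> s \<le> \<gamma> * s powr (\<gamma> - 1)"
      and least: "least_super F \<beta> U u" and small: "m powr (\<gamma> - 1) * D\<^sup>2 \<le> \<kappa> * m" and y: "y \<in> cball Y D"
    define a where "a = L * m / D"
    have a: "a > 0" unfolding a_def using L0 m D by simp
    define p where "p = concave_penalty a \<gamma> D"
    note p_le = concave_penalty_le[OF a \<gamma> D, folded p_def]
    note p_ge = concave_penalty_ge[OF a \<gamma> D, folded p_def]
    define G where "G = (\<lambda>x y. u y + p (dist x y))"
    define w where "w = (\<lambda>x. Inf (G x ` cball Y D))"
    \<comment> \<open>Calibrated so that the paraboloid alone reaches \<open>4 * m\<close> on the
      sphere of radius \<open>D / 2\<close>.\<close>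
    define C where "C = 16 * m / D\<^sup>2"
    define W where "W = (\<lambda>x. w x + C * ((x - Y) \<bullet> (x - Y)))"
    have C: "C > 0" using m D by (simp add: C_def)
    have cG: "continuous_on (cball Y (D/2) \<times> cball Y D) (\<lambda>(x, y). G x y)"
    proof -
      have "continuous_on (cball Y (D/2) \<times> cball Y D) (\<lambda>z. u (snd z))"
        by (rule continuous_on_compose2[OF cu]) (auto intro!: continuous_intros)
      moreover have "continuous_on (cball Y (D/2) \<times> cball Y D) (\<lambda>z. p (dist (fst z) (snd z)))"
        unfolding p_def by (rule continuous_on_compose2[OF continuous_on_concave_penalty[OF a \<gamma> D]])
          (auto intro!: continuous_intros)
      ultimately show ?thesis unfolding G_def split_def by (intro continuous_intros)
    qed
    have Kne: "cball Y D \<noteq> {}" using D by simp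
    have cw: "continuous_on (cball Y (D/2)) w"
      unfolding w_def using continuous_on_Inf_compact[OF compact_cball compact_cball Kne cG] .
    have attained: "\<exists>y0\<in>cball Y D. w x = G x y0 \<and> (\<forall>y\<in>cball Y D. G x y0 \<le> G x y)"
      if x: "x \<in> cball Y (D/2)" for x
    proof -
      have "continuous_on (cball Y D) (\<lambda>y. (x, y))" by (intro continuous_intros)
      from continuous_on_compose2[OF cG this] x have "continuous_on (cball Y D) (G x)"
        by (auto simp: image_subset_iff)
      from Inf_image_attained[OF compact_cball Kne this] show ?thesis unfolding w_def by metis
    qed
    have d2: "dist x y \<le> 3/2 * D" if "x \<in> cball Y (D/2)" "y \<in> cball Y D" for x y
      using that dist_triangle3[of x y Y] by simp
    have G0: "0 \<le> G x y" if "x \<in> cball Y (D/2)" "y \<in> cball Y D" for x y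
    proof -
      have "0 \<le> a * (dist x y * (3/4))" using a by simp
      also have "\<dots> \<le> p (dist x y)" using d2[OF that] D by (intro p_ge) auto
      finally show ?thesis using ub that(2) by (simp add: G_def)
    qed
    have w0: "0 \<le> w x" if "x \<in> cball Y (D/2)" for x using attained[OF that] G0[OF that] by metis
    have "u Y \<le> W Y"
    proof (rule least_superD[OF least, of "D/2" Y W])
      show "0 < D / 2" using D by simp
      show "cball Y (D/2) \<subseteq> U" using U D by (metis cball_subset_cball_iff subset_trans
          dist_self add_0 less_eq_real_def half_gt_zero_iff field_sum_of_halves linorder_not_less le_add_same_cancel1)
      show "continuous_on (cball Y (D/2)) W" unfolding W_def using cw by (intro continuous_intros)
      show "0 \<le> W x" if "x \<in> cball Y (D/2)" for x using w0[OF that] C by (simp add: W_def)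
      show "u x \<le> W x" if "x \<in> sphere Y (D/2)" for x
      proof -
        have "norm (x - Y) = D/2" using that by (simp add: dist_norm norm_minus_commute)
        then have sq: "(x - Y) \<bullet> (x - Y) = (D/2)\<^sup>2" by (simp only: dot_square_norm)
        have "C * ((x - Y) \<bullet> (x - Y)) = 4 * m" unfolding sq C_def using D by (simp add: power_divide)
        moreover have "u x \<le> 4 * m" using ub that D by simp
        moreover have "0 \<le> w x" using that by (intro w0) simp
        ultimately show ?thesis by (simp add: W_def)
      qed
      show "Y \<in> cball Y (D/2)" using D by simp
    next
      fix x0 assume x0: "x0 \<in> ball Y (D/2)" and Wu: "W x0 < u x0"
      then have x0c: "x0 \<in> cball Y (D/2)" and x0D: "x0 \<in> cball Y D" using D by auto
      obtain y0 where y0: "y0 \<in> cball Y D" "w x0 = G x0 y0" "\<And>y. y \<in> cball Y D \<Longrightarrow> G x0 y0 \<le> G x0 y"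
        using attained[OF x0c] by blast
      define t where "t = dist x0 y0"
      have wu: "w x0 < u x0" using Wu C by (simp add: W_def) (smt (verit) inner_ge_zero mult_nonneg_nonneg)
      have uy0: "0 \<le> u y0" using ub y0(1) by simp
      \<comment> \<open>The distance is not smooth on the diagonal; a minimiser
        \<open>y0 = x0\<close> would give \<open>w x0 \<ge> u x0\<close>.\<close>
      have t0: "t > 0"
      proof (rule ccontr)
        assume "\<not> t > 0"
        then have "x0 = y0" by (simp add: t_def)
        then show False using wu y0(2) p_ge[of 0] D by (simp add: G_def)
      qed
      have t2D: "t \<le> 2 * D" using d2[OF x0c y0(1)] D by (simp add: t_def)
      have tD: "t < D / 4"
      proof (rule ccontr)
        assume "\<not> t < D / 4"
        then have "a * (D / 4 * (3/4)) \<le> a * (t * (3/4))" using a by (intro mult_left_mono) auto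
        also have "\<dots> \<le> p t" using t2D t0 by (intro p_ge) auto
        also have "\<dots> \<le> w x0" using y0(2) uy0 by (simp add: G_def t_def)
        also have "\<dots> < 4 * m" using wu ub x0D by force
        finally have "L * m * (3/16) < 4 * m" using D by (simp add: a_def)
        moreover have "32 * m \<le> L * m" using L(1) m by (intro mult_right_mono) auto
        ultimately show False using m by linarith
      qed
      have y0b: "y0 \<in> ball Y D"
        using x0 tD D dist_triangle[of Y y0 x0] by (simp add: t_def)
      define h where "h = L * m * (t / D) / 4"
      have h: "h > 0" unfolding h_def using L0 m t0 D by simp
      have at: "a * t = 4 * h" by (simp add: a_def h_def)
      have sub2t: "cball x0 (2*t) \<subseteq> cball Y D" "ball x0 (2*t) \<subseteq> ball Y D"
        using x0 tD dist_triangle[of Y _ x0] by (auto intro: order_trans le_less_trans simp: less_imp_le)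
          (smt (verit, best) dist_triangle)+
      \<comment> \<open>Replacing \<open>y0\<close> by \<open>z\<close> saves at least
        \<open>a * t / 4\<close> of penalty, so minimality of \<open>y0\<close> forces
        \<open>u z\<close> to be at least that large.\<close>
      have hlow: "h \<le> u z" if z: "z \<in> cball x0 (1/2*t)" for z
      proof -
        have "z \<in> cball x0 (2*t)" using z t0 by simp
        then have zD: "z \<in> cball Y D" using sub2t(1) by blast
        have "u y0 + p t \<le> u z + p (dist x0 z)"
          using y0(3)[OF zD] by (simp add: G_def t_def)
        moreover have "a * dist x0 z \<le> a * (t / 2)" using a z by (intro mult_left_mono) auto
        then have "p (dist x0 z) \<le> a * (t / 2)" using p_le[of "dist x0 z"] by linarith
        moreover have "a * (t * (3/4)) \<le> p t" using t2D t0 by (intro p_ge) auto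
        ultimately show ?thesis using uy0 at by simp
      qed
      define \<tau> where "\<tau> = t / D"
      have tau: "0 < \<tau>" "\<tau> \<le> 1" using t0 tD D by (auto simp: \<tau>_def)
      have tDtau: "t = D * \<tau>" using D by (simp add: \<tau>_def)
      have L4: "L / 4 \<ge> 1" using L(1) by simp
      have L4p: "(L / 4) powr (\<gamma> - 1) \<le> 1"
        using L4 \<gamma> powr_mono[of "\<gamma> - 1" 0 "L/4"] by simp
      have hpow: "h powr (\<gamma> - 1) = (L/4) powr (\<gamma> - 1) * \<tau> powr (\<gamma> - 1) * m powr (\<gamma> - 1)"
        using L0 m tau by (simp add: h_def \<tau>_def[symmetric] powr_mult[symmetric] mult_ac)
      have "h powr (\<gamma> - 1) * t\<^sup>2 = (L/4) powr (\<gamma> - 1) * (\<tau> powr (\<gamma> - 1) * \<tau>\<^sup>2) * (m powr (\<gamma> - 1) * D\<^sup>2)"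
        unfolding hpow by (simp add: tDtau power_mult_distrib)
      also have "\<dots> \<le> 1 * \<tau> * (\<kappa> * m)"
      proof (rule mult_mono[OF mult_mono[OF L4p] small])
        have "\<tau> powr (\<gamma> - 1) * \<tau>\<^sup>2 = \<tau> powr (\<gamma> + 1)"
          using tau by (simp add: powr_add[symmetric] add.commute flip: powr_numeral)
        also have "\<dots> \<le> \<tau> powr 1" using tau \<gamma> by (intro powr_mono') auto
        finally show "\<tau> powr (\<gamma> - 1) * \<tau>\<^sup>2 \<le> \<tau>" using tau by simp
      qed (use tau in auto)
      also have "\<dots> = \<kappa> * (\<tau> * m)" by simp
      also have "\<dots> \<le> c1 * (L / 4) * (\<tau> * m)" using L2 tau m by (intro mult_right_mono) auto
      also have "\<dots> = c1 * h" by (simp add: h_def \<tau>_def mult_ac)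
      finally have hsmall: "h powr (\<gamma> - 1) * t\<^sup>2 \<le> c1 * h" .
      \<comment> \<open>The minimiser is at distance exactly \<open>t\<close> from
        \<open>x0\<close>, within reach of the spreading estimate.\<close>
      have "c0 * h \<le> u y0"
      proof (rule spread[OF t0 h, of x0 u \<beta>])
        show "continuous_on (cball x0 (2 * t)) u" using cu sub2t(1) by (rule continuous_on_subset)
        show "\<forall>x\<in>cball x0 (2 * t). 0 \<le> u x" using ub sub2t(1) by auto
        show "\<forall>x\<in>ball x0 (2 * t). super_at F \<beta> u x" using sup sub2t(2) by auto
      qed (use b0 b hlow hsmall in \<open>auto simp: t_def\<close>)
      then have "u y0 powr (\<gamma> - 1) \<le> (c0 * h) powr (\<gamma> - 1)" and uy0p: "u y0 > 0"
        using c0 h \<gamma> by (auto intro!: powr_mono2' intro: less_le_trans[OF mult_pos_pos])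
      then have "\<beta> (u y0) \<le> \<gamma> * (c0 * h) powr (\<gamma> - 1)"
        using b \<gamma> by (meson mult_left_mono less_imp_le order_trans)
      also have "\<dots> = \<gamma> * ((c0 * (L / 4)) powr (\<gamma> - 1) * \<tau> powr (\<gamma> - 1) * m powr (\<gamma> - 1))"
        using c0 L0 tau m by (simp add: h_def \<tau>_def[symmetric] powr_mult[symmetric] mult_ac)
      also have "\<dots> \<le> \<gamma> * (1 * \<tau> powr (\<gamma> - 1) * (\<kappa> * m / D\<^sup>2))"
      proof (intro mult_left_mono mult_mono)
        show "(c0 * (L / 4)) powr (\<gamma> - 1) \<le> 1"
          using L1 \<gamma> c0 L0 powr_mono[of "\<gamma> - 1" 0 "c0 * (L/4)"] by simp
        show "m powr (\<gamma> - 1) \<le> \<kappa> * m / D\<^sup>2" using small D by (simp add: field_simps)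
      qed (use \<gamma> in auto)
      finally have bound: "\<beta> (u y0) \<le> \<gamma> * (\<tau> powr (\<gamma> - 1) * (\<kappa> * m / D\<^sup>2))" by simp
      show "super_at F \<beta> W x0"
        unfolding super_at_def
      proof (intro allI impI, elim conjE)
        fix \<phi> D\<phi> H\<phi> r
        assume r: "r > 0" and C\<phi>: "C2_on (ball x0 r) \<phi> D\<phi> H\<phi>" and eq: "\<phi> x0 = W x0"
          and le: "\<forall>y\<in>ball x0 r. \<phi> y \<le> W y"
        obtain e1 where e1: "e1 > 0" "ball x0 e1 \<subseteq> ball Y (D/2)" using openE[OF open_ball x0] by blast
        obtain e2 where e2: "e2 > 0" "ball y0 e2 \<subseteq> ball Y D" using openE[OF open_ball y0b] by blast
        define r' where "r' = min r e1"
        have r': "r' > 0" using r e1 by (simp add: r'_def)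
        define \<psi> where "\<psi> = (\<lambda>x. \<phi> x - (C * ((x - Y) \<bullet> (x - Y)) + 0))"
        define H where "H = (\<lambda>x. H\<phi> x - (2 * C) *\<^sub>R mat 1)"
        have "C2_on (ball x0 r') \<phi> D\<phi> H\<phi>" using C\<phi> by (rule C2_on_subset) (auto simp: r'_def)
        from C2_on_diff[OF this C2_on_paraboloid]
        have C\<psi>: "C2_on (ball x0 r') \<psi> (\<lambda>x. D\<phi> x - C *\<^sub>R 2 *\<^sub>R (x - Y)) H"
          unfolding \<psi>_def H_def .
        define p'' where "p'' = (\<lambda>s. - (a * ((1 + \<gamma>) * \<gamma> * s powr (\<gamma> - 1) / (8 * D powr \<gamma>))))"
        have "F (H x0) + lam * (4 * (- p'' t)) \<le> \<beta> (u y0)"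
        proof (rule inf_convolution_gain[OF _ r' C\<psi> t_def t0 _ _ _ _ e2(1), where \<beta> = \<beta> and u = u and p = p
              and p' = "\<lambda>s. a * (1 - (1 + \<gamma>) * s powr \<gamma> / (8 * D powr \<gamma>))" and p'' = p''])
          show "super_at F \<beta> u y0" using sup y0b by simp
          show "(p has_real_derivative a * (1 - (1 + \<gamma>) * s powr \<gamma> / (8 * D powr \<gamma>))) (at s)" if "s > 0" for s
            unfolding p_def by (rule concave_penalty_deriv[OF a \<gamma> D that])
          show "((\<lambda>s. a * (1 - (1 + \<gamma>) * s powr \<gamma> / (8 * D powr \<gamma>))) has_real_derivative p'' s) (at s)" if "s > 0" for s
            unfolding p''_def by (rule concave_penalty_deriv[OF a \<gamma> D that])
          show "continuous_on {0<..} p''" unfolding p''_def using D by (intro continuous_intros) auto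
          show "p'' t < 0" using a \<gamma> t0 D by (simp add: p''_def)
          show "\<psi> x0 = u y0 + p t" using eq y0(2) by (simp add: \<psi>_def W_def G_def t_def)
          fix x y assume x: "x \<in> ball x0 r'" and y: "y \<in> ball y0 e2"
          have xc: "x \<in> cball Y (D/2)" using x e1(2) by (auto simp: r'_def)
          have yc: "y \<in> cball Y D" using y e2(2) by auto
          have "\<phi> x \<le> W x" using le x by (simp add: r'_def)
          then have "\<psi> x \<le> w x" by (simp add: \<psi>_def W_def)
          also have "w x \<le> G x y" using attained[OF xc] yc by metis
          finally show "\<psi> x \<le> u y + p (dist x y)" by (simp add: G_def)
        qed
        moreover have K: "- p'' t = L * m / D\<^sup>2 * ((1 + \<gamma>) * \<gamma> * \<tau> powr (\<gamma> - 1) / 8)"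
        proof -
          have eq: "t powr (\<gamma> - 1) = D powr \<gamma> / D * \<tau> powr (\<gamma> - 1)"
            using D tau by (simp add: tDtau powr_mult powr_diff)
          show ?thesis
            unfolding p''_def a_def eq using D by (simp add: power2_eq_square field_simps)
        qed
        moreover have "F (H\<phi> x0) \<le> F (H x0) + Lam * (2 * C)"
        proof -
          have "F (H x0 + (2 * C) *\<^sub>R mat 1) \<le> F (H x0) + Lam * (2 * C)"
            using F_add_psd_le[OF C2_on_sym_mat[OF C\<psi> r'] psd_mat_scaled_id, of "2 * C"] C
            by (simp add: mnorm_scaled_id)
          then show ?thesis by (simp add: H_def)
        qed
        moreover have "lam * (4 * (- p'' t)) = lam * (L * m / D\<^sup>2 * ((1 + \<gamma>) * \<gamma> * \<tau> powr (\<gamma> - 1) / 2))"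
          unfolding K by (simp add: mult_ac)
        moreover have "Lam * (2 * C) = Lam * (32 * (m / D\<^sup>2))" by (simp add: C_def)
        ultimately have "F (H\<phi> x0) \<le> \<gamma> * (\<tau> powr (\<gamma> - 1) * (\<kappa> * m / D\<^sup>2)) + Lam * (32 * (m / D\<^sup>2))
            - lam * (L * m / D\<^sup>2 * ((1 + \<gamma>) * \<gamma> * \<tau> powr (\<gamma> - 1) / 2))"
          using bound by linarith
        also have "\<dots> = (m / D\<^sup>2) * (\<gamma> * \<kappa> * \<tau> powr (\<gamma> - 1) + 32 * Lam * 1
            - (lam * L * \<gamma> / 2) * (1 + \<gamma>) * \<tau> powr (\<gamma> - 1))"
        proof -
          define q where "q = m / D\<^sup>2"
          have "\<kappa> * m / D\<^sup>2 = \<kappa> * q" "L * m / D\<^sup>2 = L * q" by (simp_all add: q_def)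
          then show ?thesis unfolding q_def[symmetric] by (simp add: algebra_simps)
        qed
        also have "\<dots> \<le> 0"
        proof (rule mult_nonneg_nonpos)
          define P where "P = \<tau> powr (\<gamma> - 1)"
          have P: "P \<ge> 1" using powr_mono'[of "\<gamma> - 1" 0 \<tau>] \<gamma> tau by (simp add: P_def)
          have "32 * Lam * 1 \<le> 32 * Lam * P" using P Lam_pos by (intro mult_left_mono) auto
          moreover have "\<gamma> * \<kappa> * P \<le> 1 * \<kappa> * P" using \<gamma> \<kappa> P by (intro mult_right_mono) auto
          moreover have "(32 * Lam + \<kappa>) * P \<le> (lam * L * \<gamma> / 2) * P" using L3 P by (intro mult_right_mono) auto
          moreover have "(lam * L * \<gamma> / 2) * P * 1 \<le> (lam * L * \<gamma> / 2) * P * (1 + \<gamma>)"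
            using lam_pos L0 \<gamma> P by (intro mult_left_mono) auto
          ultimately show "\<gamma> * \<kappa> * \<tau> powr (\<gamma> - 1) + 32 * Lam * 1 - (lam * L * \<gamma> / 2) * (1 + \<gamma>) * \<tau> powr (\<gamma> - 1) \<le> 0"
            unfolding P_def[symmetric] by (simp add: algebra_simps)
        qed (use m in simp)
        \<comment> \<open>With \<open>F\<close> already forced to be nonpositive, the sign of
          \<beta> at \<open>W x0\<close> closes the estimate.\<close>
        also have "0 \<le> \<beta> (W x0)" using b0 by simp
        finally show "F (H\<phi> x0) \<le> \<beta> (W x0)" .
      qed
    qed
    also have "W Y = w Y" by (simp add: W_def)
    also have "w Y \<le> G Y y" using attained[of Y] y D by (metis centre_in_cball half_gt_zero less_imp_le)
    also have "\<dots> \<le> u y + a * dist Y y" using p_le by (simp add: G_def)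
    finally show "u Y \<le> u y + L * m / D * dist Y y" by (simp add: a_def)
  qed
qed

section \<open>Minimal solutions\<close>

text \<open>With no admissible function the infimum is that of the empty set, one number for all
  points; hence the first alternative. Otherwise a local competitor \<open>w\<close> is glued into
  \<open>u\<close> by taking the minimum. It respects the upper obstacle as \<open>u\<close> does,
  and the lower one because \<open>u\<close> and \<open>w\<close> are nonnegative while a large
  \<open>Sup (range \<beta>)\<close> makes that obstacle nonpositive at centres of balls of radius
  \<open>r\<close> in \<open>\<Omega>\<close>.\<close>

lemma (in elliptic) minimal_solution_properties:
  fixes u :: "real^'n \<Rightarrow> real"
  assumes \<Omega>: "open \<Omega>" "bounded \<Omega>" and \<beta>: "\<And>t. isCont \<beta> t" "\<And>t. t \<le> 0 \<Longrightarrow> \<beta> t = 0"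
    and bdd: "bdd_above (range \<beta>)"
    and f: "\<And>x. x \<in> frontier \<Omega> \<Longrightarrow> 0 \<le> f x" "\<And>x. x \<in> frontier \<Omega> \<Longrightarrow> f x \<le> S" and S: "0 \<le> S"
    and min: "minimal_solution F f \<beta> \<Omega> u" and cu: "continuous_on \<Omega> u"
  shows "(\<exists>c. \<forall>x\<in>\<Omega>. u x = c) \<or>
    (\<forall>x\<in>\<Omega>. 0 \<le> u x \<and> u x \<le> S) \<and> (\<forall>x\<in>\<Omega>. super_at F \<beta> u x) \<and>
    (\<forall>K r. 0 < r \<and> (\<forall>x\<in>K. cball x r \<subseteq> \<Omega>) \<and> Lam * (2 * ((S + 1) / r\<^sup>2)) < Sup (range \<beta>)
       \<longrightarrow> least_super F \<beta> K u)"
proof -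
  define k where "k = Sup (range \<beta>)"
  have "\<beta> 0 \<le> k" unfolding k_def by (rule cSup_upper[OF _ bdd]) simp
  then have k0: "k \<ge> 0" using \<beta>(2) by simp
  obtain ulo uhi where lo: "dirichlet_sol F (\<lambda>_. k) f \<Omega> ulo" and hi: "dirichlet_sol F (\<lambda>_. 0) f \<Omega> uhi"
    and u: "\<forall>x\<in>closure \<Omega>. u x = Inf {w x | w. continuous_on (closure \<Omega>) w \<and>
         (\<forall>y\<in>closure \<Omega>. ulo y \<le> w y \<and> w y \<le> uhi y) \<and> visc_super F \<beta> \<Omega> w}"
    using min unfolding minimal_solution_def k_def by blast
  define A where "A = {w. continuous_on (closure \<Omega>) w \<and>
         (\<forall>y\<in>closure \<Omega>. ulo y \<le> w y \<and> w y \<le> uhi y) \<and> visc_super F \<beta> \<Omega> w}"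
  have uA: "u x = (INF w\<in>A. w x)" if "x \<in> closure \<Omega>" for x
  proof -
    have "{w x | w. continuous_on (closure \<Omega>) w \<and>
         (\<forall>y\<in>closure \<Omega>. ulo y \<le> w y \<and> w y \<le> uhi y) \<and> visc_super F \<beta> \<Omega> w} = (\<lambda>w. w x) ` A"
      by (auto simp: A_def)
    then show ?thesis using u that by simp
  qed
  have cl: "x \<in> closure \<Omega>" if "x \<in> \<Omega>" for x using that closure_subset by blast
  show ?thesis
  proof (cases "A = {}")
    case True
    then show ?thesis using uA cl by auto
  next
    case False
    have clo: "continuous_on (closure \<Omega>) ulo" and chi: "continuous_on (closure \<Omega>) uhi"
      and subs: "visc_sub F (\<lambda>_. k) \<Omega> ulo" "visc_sub F (\<lambda>_. 0) \<Omega> uhi"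
      and bd: "\<And>x. x \<in> frontier \<Omega> \<Longrightarrow> ulo x = f x" "\<And>x. x \<in> frontier \<Omega> \<Longrightarrow> uhi x = f x"
      using lo hi by (auto simp: dirichlet_sol_def visc_sol_def)
    have loS: "ulo x \<le> S" and hiS: "uhi x \<le> S" if "x \<in> closure \<Omega>" for x
      using visc_sub_le_boundary[OF \<Omega> clo subs(1) k0 _ that] visc_sub_le_boundary[OF \<Omega> chi subs(2) _ _ that]
        bd f(2) by auto
    have A0: "0 \<le> w x" if "w \<in> A" "x \<in> closure \<Omega>" for w x
    proof (rule visc_super_nonneg[OF \<Omega> _ _ _ _ that(2)])
      fix y assume "y \<in> frontier \<Omega>"
      then show "0 \<le> w y" using that(1) bd(1)[of y] f(1)[of y] by (fastforce simp: A_def frontier_def)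
    qed (use that \<beta> in \<open>auto simp: A_def\<close>)
    have below: "bdd_below ((\<lambda>w. w x) ` A)" if "x \<in> closure \<Omega>" for x
      using A0 that by (intro bdd_belowI2[of _ 0]) auto
    have u_le: "u x \<le> w x" if "w \<in> A" "x \<in> closure \<Omega>" for w x
      unfolding uA[OF that(2)] by (rule cINF_lower[OF below[OF that(2)] that(1)])
    have u_ge: "c \<le> u x" if "x \<in> closure \<Omega>" "\<And>w. w \<in> A \<Longrightarrow> c \<le> w x" for c x
      unfolding uA[OF that(1)] by (rule cINF_greatest[OF False that(2)])
    have u0: "0 \<le> u x" and ulo_u: "ulo x \<le> u x" if "x \<in> closure \<Omega>" for x
      using u_ge[OF that] A0 that by (auto simp: A_def)
    have u_uhi: "u x \<le> uhi x" if "x \<in> closure \<Omega>" for x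
    proof -
      obtain w where w: "w \<in> A" using False by blast
      then have "w x \<le> uhi x" using that by (simp add: A_def)
      then show ?thesis using u_le[OF w that] by simp
    qed
    \<comment> \<open>Competitors have to be continuous up to the frontier; there both obstacles
      take the value \<open>f\<close> and squeeze \<open>u\<close>.\<close>
    have cuc: "continuous_on (closure \<Omega>) u"
      unfolding continuous_on_eq_continuous_within
    proof
      fix x assume x: "x \<in> closure \<Omega>"
      show "continuous (at x within closure \<Omega>) u"
      proof (cases "x \<in> \<Omega>")
        case True
        then have "isCont u x" using cu \<Omega>(1) continuous_on_eq_continuous_at by blast
        then show ?thesis by (rule continuous_at_imp_continuous_at_within)
      next
        case False
        then have fr: "x \<in> frontier \<Omega>" using x \<Omega>(1) by (simp add: frontier_def interior_open)
        have ux: "u x = f x" using ulo_u[OF x] u_uhi[OF x] bd[OF fr] by simp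
        have "(ulo \<longlongrightarrow> f x) (at x within closure \<Omega>)" "(uhi \<longlongrightarrow> f x) (at x within closure \<Omega>)"
          using clo chi x bd[OF fr] by (auto simp: continuous_on_def)
        then have "(u \<longlongrightarrow> f x) (at x within closure \<Omega>)"
          by (rule tendsto_sandwich[rotated 2]) (auto simp: eventually_at_filter ulo_u u_uhi)
        then show ?thesis by (simp add: continuous_within ux)
      qed
    qed
    have sup: "super_at F \<beta> u x" if x: "x \<in> \<Omega>" for x
    proof (rule super_at_Inf[OF \<Omega>(1) x \<beta>(1) False])
      show "continuous_on \<Omega> w" "visc_super F \<beta> \<Omega> w" if "w \<in> A" for w
        using that closure_subset by (auto simp: A_def intro: continuous_on_subset)
      show "\<exists>w\<in>A. w x < u x + e" if "e > 0" for e
        using cINF_less_iff[OF False below[OF cl[OF x]], of "u x + e"] uA[OF cl[OF x]] that by simp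
    qed (use cu u_le cl in auto)
    have "least_super F \<beta> K u"
      if r: "0 < r" and K: "\<forall>x\<in>K. cball x r \<subseteq> \<Omega>" and large: "Lam * (2 * ((S + 1) / r\<^sup>2)) < k" for K r
      unfolding least_super_def
    proof (intro allI impI ballI, elim conjE)
      fix Z s w x
      assume s: "0 < s" and ZK: "cball Z s \<subseteq> K" and cw: "continuous_on (cball Z s) w"
        and w0: "\<forall>x\<in>cball Z s. 0 \<le> w x" and wu: "\<forall>x\<in>sphere Z s. u x \<le> w x"
        and ws: "\<forall>x\<in>ball Z s. w x < u x \<longrightarrow> super_at F \<beta> w x" and x: "x \<in> cball Z s"
      have K\<Omega>: "K \<subseteq> \<Omega>" using K r by (meson centre_in_cball less_imp_le subset_iff)
      have ulo0: "ulo y \<le> 0" if "y \<in> K" for y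
      proof (rule visc_sub_large_rhs_nonpos[OF \<Omega>(1) subs(1) _ r _ S _ large])
        show "continuous_on \<Omega> ulo" using clo closure_subset by (rule continuous_on_subset)
        show "cball y r \<subseteq> \<Omega>" using K that by blast
        then show "ulo x \<le> S" if "x \<in> cball y r" for x using loS that cl by blast
      qed
      define v where "v = (\<lambda>x. if x \<in> cball Z s then min (u x) (w x) else u x)"
      have vu: "v y \<le> u y" for y by (simp add: v_def)
      have "v \<in> A"
        unfolding A_def
      proof (intro CollectI conjI ballI)
        have "cball Z s \<subseteq> closure \<Omega>" using ZK K\<Omega> cl by blast
        then have "closure \<Omega> = cball Z s \<union> (closure \<Omega> - ball Z s)" by auto
        moreover have "continuous_on (cball Z s \<union> (closure \<Omega> - ball Z s)) v"
          unfolding v_def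
        proof (rule continuous_on_cases)
          show "closed (closure \<Omega> - ball Z s)" by (intro closed_Diff) auto
          show "continuous_on (cball Z s) (\<lambda>x. min (u x) (w x))"
            using cw continuous_on_subset[OF cuc \<open>cball Z s \<subseteq> closure \<Omega>\<close>] by (intro continuous_intros)
          show "continuous_on (closure \<Omega> - ball Z s) u" using cuc by (rule continuous_on_subset) auto
          show "\<forall>x. x \<in> cball Z s \<and> x \<notin> cball Z s \<or> x \<in> closure \<Omega> - ball Z s \<and> x \<in> cball Z s \<longrightarrow>
              min (u x) (w x) = u x"
            using wu by (auto simp: min_def)
        qed simp
        ultimately show "continuous_on (closure \<Omega>) v" by simp
        fix y assume y: "y \<in> closure \<Omega>"
        show "v y \<le> uhi y" using vu[of y] u_uhi[OF y] by simp
        show "ulo y \<le> v y"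
        proof (cases "y \<in> cball Z s")
          case True
          then have "ulo y \<le> 0" using ulo0 ZK by blast
          then show ?thesis using True u0[OF y] w0 by (force simp: v_def)
        next
          case False then show ?thesis using ulo_u[OF y] by (simp add: v_def)
        qed
      next
        show "visc_super F \<beta> \<Omega> v"
          unfolding visc_super_iff_super_at[OF \<Omega>(1)]
        proof
          fix y assume y: "y \<in> \<Omega>"
          show "super_at F \<beta> v y"
          \<comment> \<open>Inside the ball \<open>v\<close> lies below \<open>w\<close>, and
            everywhere below \<open>u\<close>; it inherits the property from the one it
            equals.\<close>
          proof (cases "y \<in> ball Z s \<and> w y < u y")
            case True
            then obtain e where e: "e > 0" "ball y e \<subseteq> ball Z s" using openE[OF open_ball] by blast
            show ?thesis
            proof (rule super_at_touching[OF _ e(1)])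
              show "super_at F \<beta> w y" using ws True by blast
              show "v y = w y" using True by (simp add: v_def)
              show "v z \<le> w z" if "z \<in> ball y e" for z using e(2) that by (force simp: v_def)
            qed
          next
            case False
            show ?thesis
            proof (rule super_at_touching[OF sup[OF y] zero_less_one])
              show "v y = u y"
                using False wu by (cases "y \<in> sphere Z s") (auto simp: v_def min_def)
            qed (rule vu)
          qed
        qed
      qed
      moreover have "x \<in> closure \<Omega>" using x ZK K\<Omega> cl by blast
      ultimately have "u x \<le> v x" by (rule u_le)
      then show "u x \<le> w x" using x by (simp add: v_def)
    qed
    moreover have "0 \<le> u x \<and> u x \<le> S" if "x \<in> \<Omega>" for x
      using u0 u_uhi hiS cl that order_trans by blast
    ultimately show ?thesis using sup unfolding k_def by blast
  qed
qed

section \<open>The cutoff and the regularised reaction\<close>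

context
  fixes \<rho> :: "real \<Rightarrow> real"
  assumes \<rho>: "smooth_fun \<rho>" "\<forall>t. \<rho> t \<ge> 0" "{t. \<rho> t \<noteq> 0} \<subseteq> {0..1}" "integral {0..1} \<rho> = 1"
begin

lemma rho_integrable: "\<rho> integrable_on {a..b}"
proof -
  have "\<rho> differentiable (at x)" for x
    using \<rho>(1)[unfolded smooth_fun_def, rule_format, of 0] by simp
  then have "continuous_on {a..b} \<rho>"
    by (meson continuous_at_imp_continuous_on differentiable_imp_continuous_within)
  then show ?thesis by (rule integrable_continuous_real)
qed

lemma rho_integral_nonneg: "0 \<le> integral {0..s} \<rho>"
  using \<rho>(2) by (intro integral_nonneg rho_integrable) auto

lemma rho_integral_eq_1:
  assumes "1 \<le> s" shows "integral {0..s} \<rho> = 1"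
proof -
  \<comment> \<open>The support condition leaves the value at the endpoint 1 open; a single point
    does not affect the integral.\<close>
  have "integral {1..s} \<rho> = integral {1..s} (\<lambda>_. 0)"
    by (rule integral_spike[of "{1}"]) (use \<rho>(3) in auto)
  then show ?thesis
    using Henstock_Kurzweil_Integration.integral_combine[of 0 1 s \<rho>] assms rho_integrable \<rho>(4) by simp
qed

lemma rho_integral_le_1: "integral {0..s} \<rho> \<le> 1"
proof -
  have "integral {0..s} \<rho> \<le> integral {0..max 1 s} \<rho>"
    using \<rho>(2) by (intro integral_subset_le rho_integrable) auto
  then show ?thesis by (simp add: rho_integral_eq_1)
qed

lemma rho_integral_eq_0: "s \<le> 0 \<Longrightarrow> integral {0..s} \<rho> = 0"
  by (cases "s = 0") auto

text \<open>Composition with \<open>max 0\<close> carries continuity of the indefinite integral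
  across 0, below which the interval of integration is empty.\<close>

lemma continuous_on_rho_integral: "continuous_on UNIV (\<lambda>s. integral {0..s} \<rho>)"
proof -
  have "isCont (\<lambda>s. integral {0..s} \<rho>) s" for s
  proof -
    have "continuous_on {..s+1} (\<lambda>s. integral {0..max 0 s} \<rho>)"
      by (rule continuous_on_compose2[OF indefinite_integral_continuous_1[OF rho_integrable, of 0 "max 0 (s+1)"]])
        (auto intro!: continuous_intros)
    moreover have "integral {0..max 0 s} \<rho> = integral {0..s} \<rho>" for s
      by (cases "s \<le> 0") (auto simp: rho_integral_eq_0 max_def)
    ultimately have "continuous_on {..s+1} (\<lambda>s. integral {0..s} \<rho>)" by simp
    then have "continuous_on {..<s+1} (\<lambda>s. integral {0..s} \<rho>)" by (rule continuous_on_subset) auto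
    then show ?thesis by (simp add: continuous_on_eq_continuous_at)
  qed
  then show ?thesis by (simp add: continuous_at_imp_continuous_on)
qed

context
  fixes \<gamma> \<sigma>0 \<epsilon> :: real
  assumes \<gamma>: "0 < \<gamma>" "\<gamma> < 1" and \<sigma>0: "0 < \<sigma>0" "\<sigma>0 < 1/2" and \<epsilon>: "0 < \<epsilon>"
begin

lemma B_eps_eq_0: "t \<le> \<sigma>0 * \<epsilon> powr alpha_exp \<gamma> \<Longrightarrow> B_eps \<gamma> \<rho> \<sigma>0 \<epsilon> t = 0"
  unfolding B_eps_def using \<epsilon> by (intro rho_integral_eq_0) (simp add: divide_nonpos_pos)

lemma beta_eps_nonpos_arg: "t \<le> 0 \<Longrightarrow> beta_eps \<gamma> \<rho> \<sigma>0 \<epsilon> t = 0"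
  by (simp add: beta_eps_def)

lemma beta_eps_nonneg: "0 \<le> beta_eps \<gamma> \<rho> \<sigma>0 \<epsilon> t"
  using \<gamma> by (simp add: beta_eps_def B_eps_def rho_integral_nonneg)

lemma beta_eps_le: "t > 0 \<Longrightarrow> beta_eps \<gamma> \<rho> \<sigma>0 \<epsilon> t \<le> \<gamma> * t powr (\<gamma> - 1)"
  using \<gamma> mult_left_mono[OF rho_integral_le_1, of "\<gamma> * t powr (\<gamma> - 1)"]
  by (simp add: beta_eps_def B_eps_def)

text \<open>The cutoff is complete from \<open>1 + \<sigma>0\<close> times the scale on, and
  \<open>\<sigma>0 < 1/2\<close> makes 2 a sufficient factor.\<close>

lemma beta_eps_eq:
  assumes "2 * \<epsilon> powr alpha_exp \<gamma> \<le> t" shows "beta_eps \<gamma> \<rho> \<sigma>0 \<epsilon> t = \<gamma> * t powr (\<gamma> - 1)"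
proof -
  define e where "e = \<epsilon> powr alpha_exp \<gamma>"
  have e: "e > 0" using \<epsilon> by (simp add: e_def)
  have "\<sigma>0 * e \<le> 1/2 * e" using \<sigma>0 e by (intro mult_right_mono) auto
  then have "1 * e \<le> t - \<sigma>0 * e" using assms e unfolding e_def[symmetric] by linarith
  then have "1 \<le> (t - \<sigma>0 * e) / e" using e by (simp add: pos_le_divide_eq)
  then show ?thesis
    using rho_integral_eq_1 assms e by (auto simp: beta_eps_def B_eps_def e_def[symmetric])
qed

text \<open>The cutoff vanishes up to the threshold, so truncating the base of the power there
  changes nothing and removes the singularity at 0. Continuity and boundedness can then be read
  off.\<close>

lemma beta_eps_eq_max:
  "beta_eps \<gamma> \<rho> \<sigma>0 \<epsilon> t = \<gamma> * max t (\<sigma>0 * \<epsilon> powr alpha_exp \<gamma>) powr (\<gamma> - 1) * B_eps \<gamma> \<rho> \<sigma>0 \<epsilon> t"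
proof (cases "t \<le> \<sigma>0 * \<epsilon> powr alpha_exp \<gamma>")
  case False
  moreover have "0 < \<sigma>0 * \<epsilon> powr alpha_exp \<gamma>" using \<sigma>0 \<epsilon> by simp
  ultimately show ?thesis by (simp add: beta_eps_def max_def)
qed (simp add: B_eps_eq_0 beta_eps_def)

lemma isCont_beta_eps: "isCont (beta_eps \<gamma> \<rho> \<sigma>0 \<epsilon>) t"
proof -
  have c: "0 < \<sigma>0 * \<epsilon> powr alpha_exp \<gamma>" using \<sigma>0 \<epsilon> by simp
  have "continuous_on UNIV (B_eps \<gamma> \<rho> \<sigma>0 \<epsilon>)"
    unfolding B_eps_def[abs_def] using \<epsilon>
    by (intro continuous_on_compose2[OF continuous_on_rho_integral] continuous_intros) auto
  then have "continuous_on UNIV (beta_eps \<gamma> \<rho> \<sigma>0 \<epsilon>)"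
    unfolding beta_eps_eq_max[abs_def] using c by (intro continuous_intros) (auto simp: max_def)
  then show ?thesis by (simp add: continuous_on_eq_continuous_at)
qed

lemma bdd_above_beta_eps: "bdd_above (range (beta_eps \<gamma> \<rho> \<sigma>0 \<epsilon>))"
proof (rule bdd_aboveI2)
  fix t
  have c: "0 < \<sigma>0 * \<epsilon> powr alpha_exp \<gamma>" using \<sigma>0 \<epsilon> by simp
  have "beta_eps \<gamma> \<rho> \<sigma>0 \<epsilon> t \<le> \<gamma> * max t (\<sigma>0 * \<epsilon> powr alpha_exp \<gamma>) powr (\<gamma> - 1) * 1"
    unfolding beta_eps_eq_max B_eps_def using \<gamma> by (intro mult_left_mono rho_integral_le_1) auto
  also have "\<dots> \<le> \<gamma> * (\<sigma>0 * \<epsilon> powr alpha_exp \<gamma>) powr (\<gamma> - 1)"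
    using \<gamma> c by (auto intro!: mult_left_mono powr_mono2')
  finally show "beta_eps \<gamma> \<rho> \<sigma>0 \<epsilon> t \<le> \<gamma> * (\<sigma>0 * \<epsilon> powr alpha_exp \<gamma>) powr (\<gamma> - 1)" .
qed

text \<open>The lower bound grows without limit as \<open>\<epsilon>\<close> tends to 0, which is
  what pushes the lower obstacle below zero in the interior.\<close>

lemma Sup_beta_eps_ge: "\<gamma> * (2 * \<epsilon> powr alpha_exp \<gamma>) powr (\<gamma> - 1) \<le> Sup (range (beta_eps \<gamma> \<rho> \<sigma>0 \<epsilon>))"
  using cSup_upper[OF rangeI bdd_above_beta_eps, of "2 * \<epsilon> powr alpha_exp \<gamma>"] beta_eps_eq by simp

end
end

lemma eventually_powr_neg_gt:
  fixes X :: "nat \<Rightarrow> real"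
  assumes "\<And>k. X k > 0" "X \<longlonglongrightarrow> 0" "p < 0" "c > 0"
  shows "\<forall>\<^sub>F k in sequentially. M < c * X k powr p"
proof -
  define B where "B = (max 1 M / c + 1) powr (1 / p)"
  have pos: "max 1 M / c + 1 > 0" using assms(4) by (simp add: add_pos_pos)
  then have "B > 0" by (simp add: B_def)
  with assms(2) have "\<forall>\<^sub>F k in sequentially. X k < B" by (rule order_tendstoD(2))
  then show ?thesis
  proof eventually_elim
    case (elim k)
    have "max 1 M / c + 1 = B powr p" using pos assms(3) by (simp add: B_def powr_powr)
    also have "\<dots> \<le> X k powr p" using elim assms(1)[of k] assms(3) by (intro powr_mono2') auto
    finally have "c * (max 1 M / c + 1) \<le> c * X k powr p" using assms(4) by simp
    moreover have "c * (max 1 M / c + 1) = max 1 M + c" using assms(4) by (simp add: field_simps)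
    ultimately show ?case using assms(4) by linarith
  qed
qed

section \<open>Nondegeneracy and growth\<close>

text \<open>\<open>(D\<^sup>2) powr (1 / (2 - \<gamma>))\<close> is D to the power \<alpha>, the
  size at which the reaction \<open>m powr (\<gamma> - 1)\<close> and the diffusion
  \<open>m / D\<^sup>2\<close> balance. Sizes above \<open>C\<close> times it keep their quotient
  bounded.\<close>

lemma scale_ineq:
  fixes \<gamma> C D m :: real
  assumes \<gamma>: "0 < \<gamma>" "\<gamma> < 1" and C: "0 < C" and D: "0 < D" and m: "C * (D\<^sup>2) powr (1 / (2 - \<gamma>)) \<le> m"
  shows "m powr (\<gamma> - 1) * D\<^sup>2 \<le> C powr (\<gamma> - 2) * m"
proof -
  have m0: "m > 0" using m C D by (smt (verit) mult_pos_pos powr_gt_zero zero_less_power)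
  have "C powr (2 - \<gamma>) * D\<^sup>2 = (C * (D\<^sup>2) powr (1 / (2 - \<gamma>))) powr (2 - \<gamma>)"
    using C D \<gamma> by (simp add: powr_mult powr_powr)
  also have "\<dots> \<le> m powr (2 - \<gamma>)" using m C \<gamma> by (intro powr_mono2) auto
  finally have "C powr (\<gamma> - 2) * (C powr (2 - \<gamma>) * D\<^sup>2) \<le> C powr (\<gamma> - 2) * m powr (2 - \<gamma>)"
    by (intro mult_left_mono) auto
  then have "D\<^sup>2 \<le> C powr (\<gamma> - 2) * m powr (2 - \<gamma>)"
    using C by (simp add: mult.assoc[symmetric] powr_add[symmetric])
  then have "m powr (\<gamma> - 1) * D\<^sup>2 \<le> m powr (\<gamma> - 1) * (C powr (\<gamma> - 2) * m powr (2 - \<gamma>))"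
    by (intro mult_left_mono) auto
  also have "\<dots> = C powr (\<gamma> - 2) * (m powr (\<gamma> - 1) * m powr (2 - \<gamma>))" by simp
  also have "m powr (\<gamma> - 1) * m powr (2 - \<gamma>) = m" using m0 by (simp add: powr_add[symmetric])
  finally show ?thesis .
qed

text \<open>The barrier is \<open>A \<bar>x - Z\<bar>\<^sup>\<alpha>\<close>, which has the homogeneity of the limiting equation, regularised at its
  vertex so that its minimum is \<open>T\<close>.\<close>

lemma (in elliptic) nondegeneracy:
  fixes Z :: "real^'n"
  assumes \<gamma>: "0 < \<gamma>" "\<gamma> < 1" and A: "0 < A" "2 * Lam / (2 - \<gamma>) * A \<le> \<gamma> * A powr (\<gamma> - 1)"
    and T: "0 < T" and \<beta>: "\<And>t. T \<le> t \<Longrightarrow> \<beta> t = \<gamma> * t powr (\<gamma> - 1)"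
    and least: "least_super F \<beta> U u" and r: "0 < r" "cball Z r \<subseteq> U"
    and sph: "\<And>x. x \<in> sphere Z r \<Longrightarrow> u x \<le> A * (r\<^sup>2) powr (1 / (2 - \<gamma>))"
  shows "u Z \<le> T"
proof -
  define a where "a = 1 / (2 - \<gamma>)"
  \<comment> \<open>The identity \<open>a * (\<gamma> - 1) = a - 1\<close> is the homogeneity that
    gives the Hessian of the barrier and the reaction at its value the same power of
    \<open>Q\<close>.\<close>
  have a: "0 < a" "a < 1" "a * (\<gamma> - 1) = a - 1" using \<gamma> by (auto simp: a_def field_simps)
  define \<kappa> where "\<kappa> = (T / A) powr (1 / a)"
  have kap: "\<kappa> > 0" "A * \<kappa> powr a = T" using T A a by (auto simp: \<kappa>_def powr_powr)
  define \<Theta> where "\<Theta> = (\<lambda>x. A * ((x - Z) \<bullet> (x - Z) + \<kappa>) powr a)"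
  have q: "(x - Z) \<bullet> (x - Z) + \<kappa> > 0" for x using kap(1) by (simp add: add_nonneg_pos)
  have q2: "(x - Z) \<bullet> (x - Z) + \<kappa> \<noteq> 0" for x using q[of x] by simp
  have "u Z \<le> \<Theta> Z"
  proof (rule least_superD[OF least r])
    show "continuous_on (cball Z r) \<Theta>" unfolding \<Theta>_def using q2 by (intro continuous_intros) auto
    show "0 \<le> \<Theta> x" for x using A by (simp add: \<Theta>_def)
    show "u x \<le> \<Theta> x" if "x \<in> sphere Z r" for x
    proof -
      have "norm (x - Z) = r" using that by (simp add: dist_norm norm_minus_commute)
      then have "(x - Z) \<bullet> (x - Z) = r\<^sup>2" by (simp only: dot_square_norm)
      then have "A * (r\<^sup>2) powr a \<le> \<Theta> x"
        unfolding \<Theta>_def using A a kap by (intro mult_left_mono powr_mono2) auto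
      then show ?thesis using sph[OF that] by (simp add: a_def)
    qed
    show "Z \<in> cball Z r" using r by simp
  next
    fix x
    define Q where "Q = (x - Z) \<bullet> (x - Z) + \<kappa>"
    have Q: "Q > 0" "\<kappa> \<le> Q" using q[of x] by (auto simp: Q_def)
    have C: "C2_on (ball x 1) (\<lambda>y. A * ((y - Z) \<bullet> (y - Z) + \<kappa>) powr a)
      (\<lambda>y. (A * (a * ((y - Z) \<bullet> (y - Z) + \<kappa>) powr (a - 1))) *\<^sub>R 2 *\<^sub>R (y - Z))
      (\<lambda>y. (2 * (A * (a * ((y - Z) \<bullet> (y - Z) + \<kappa>) powr (a - 1)))) *\<^sub>R mat 1
        + (4 * (A * (a * ((a - 1) * ((y - Z) \<bullet> (y - Z) + \<kappa>) powr (a - 2))))) *\<^sub>R outer (y - Z) (y - Z))"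
      using q
      by (intro C2_on_radial[where \<psi> = "\<lambda>\<sigma>. A * (\<sigma> + \<kappa>) powr a" and \<psi>' = "\<lambda>\<sigma>. A * (a * (\<sigma> + \<kappa>) powr (a - 1))"
            and \<psi>'' = "\<lambda>\<sigma>. A * (a * ((a - 1) * (\<sigma> + \<kappa>) powr (a - 2)))"])
        (auto intro!: derivative_eq_intros continuous_intros simp: q2)
    \<comment> \<open>Since \<open>a < 1\<close>, the barrier is concave in the squared radius and
      only the isotropic part is charged.\<close>
    have "F ((2 * (A * (a * Q powr (a - 1)))) *\<^sub>R mat 1
        + (4 * (A * (a * ((a - 1) * Q powr (a - 2))))) *\<^sub>R outer (x - Z) (x - Z))
        \<le> Lam * (2 * (A * (a * Q powr (a - 1))))"
      using A a by (intro F_radial_le) (auto simp: mult_nonneg_nonpos mult_nonpos_nonneg)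
    also have "\<dots> = (2 * Lam / (2 - \<gamma>) * A) * Q powr (a - 1)" by (simp add: a_def)
    also have "\<dots> \<le> (\<gamma> * A powr (\<gamma> - 1)) * Q powr (a - 1)" using A(2) by (rule mult_right_mono) simp
    also have "\<dots> = \<gamma> * (A * Q powr a) powr (\<gamma> - 1)" using A Q by (simp add: powr_mult powr_powr a(3))
    \<comment> \<open>The minimum \<open>T\<close> of the barrier places all its values where
      \<beta> is the pure power.\<close>
    also have "\<dots> = \<beta> (\<Theta> x)"
    proof -
      have "\<kappa> powr a \<le> Q powr a" using Q kap a by (intro powr_mono2) auto
      then have "A * \<kappa> powr a \<le> A * Q powr a" using A by simp
      then show ?thesis using \<beta>[of "A * Q powr a"] kap(2) by (simp add: \<Theta>_def Q_def)
    qed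
    finally show "super_at F \<beta> \<Theta> x"
      unfolding \<Theta>_def Q_def by (rule super_at_classical[OF zero_less_one C])
  qed
  also have "\<Theta> Z = T" using kap by (simp add: \<Theta>_def)
  finally show ?thesis .
qed

text \<open>Comparing with the value at a maximiser of \<open>v(Y) / (d + \<bar>Y - Y0\<bar>)\<^sup>2\<close> selects a scale on which \<open>v\<close> is
  bounded by a multiple of its central value.\<close>

lemma growth_at_zeros:
  fixes v :: "real^'n \<Rightarrow> real"
  assumes \<gamma>: "0 < \<gamma>" "\<gamma> < 1" and R: "0 < R" and L: "1 \<le> L"
    and cu: "continuous_on (cball X R) v" and bd: "\<And>x. x \<in> cball X R \<Longrightarrow> 0 \<le> v x \<and> v x \<le> S"
    and modulus: "\<And>Y D m y. 0 < D \<Longrightarrow> 0 < m \<Longrightarrow> cball Y D \<subseteq> cball X R \<Longrightarrow> (\<And>x. x \<in> cball Y D \<Longrightarrow> v x \<le> 4 * m)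
      \<Longrightarrow> m powr (\<gamma> - 1) * D\<^sup>2 \<le> m \<Longrightarrow> y \<in> cball Y D \<Longrightarrow> v Y \<le> v y + L * m / D * dist Y y"
    and spread: "\<And>x0 t h x. 0 < t \<Longrightarrow> 0 < h \<Longrightarrow> cball x0 (2*t) \<subseteq> cball X R
      \<Longrightarrow> (\<And>x. x \<in> cball x0 (1 / (2 * L) * t) \<Longrightarrow> h \<le> v x) \<Longrightarrow> h powr (\<gamma> - 1) * t\<^sup>2 \<le> c1 * h
      \<Longrightarrow> x \<in> cball x0 t \<Longrightarrow> 0 < v x"
    and C: "1 \<le> C" "(C / 2) powr (\<gamma> - 2) \<le> c1" "S \<le> C * ((R / 16)\<^sup>2) powr (1 / (2 - \<gamma>))"
    and X: "v X = 0" and d: "0 < d" "d \<le> R / 4" "dist X Y0 \<le> d"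
  shows "v Y0 \<le> C * (d\<^sup>2) powr (1 / (2 - \<gamma>))"
proof (rule ccontr)
  define a where "a = 1 / (2 - \<gamma>)"
  have a: "0 < a" "a < 1" using \<gamma> by (auto simp: a_def)
  assume "\<not> v Y0 \<le> C * (d\<^sup>2) powr (1 / (2 - \<gamma>))"
  then have big: "C * (d\<^sup>2) powr a < v Y0" by (simp add: a_def)
  define B where "B = cball Y0 (R / 4)"
  have BX: "B \<subseteq> cball X R"
  proof
    fix y assume "y \<in> B"
    then show "y \<in> cball X R" using d R dist_triangle[of X y Y0] by (simp add: B_def)
  qed
  have den: "d + dist Y0 y > 0" for y using d by (simp add: add_pos_nonneg)
  have "continuous_on B (\<lambda>y. v y / (d + dist Y0 y)\<^sup>2)"
    using continuous_on_subset[OF cu BX] den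
    by (intro continuous_intros) (auto simp: less_imp_neq[symmetric])
  then obtain Y where Y: "Y \<in> B" "\<And>y. y \<in> B \<Longrightarrow> v y / (d + dist Y0 y)\<^sup>2 \<le> v Y / (d + dist Y0 Y)\<^sup>2"
    using continuous_attains_sup[of B "\<lambda>y. v y / (d + dist Y0 y)\<^sup>2"] R by (auto simp: B_def)
  define D where "D = d + dist Y0 Y"
  have D: "D > 0" "d \<le> D" using den d by (auto simp: D_def)
  define m where "m = v Y"
  \<comment> \<open>The exponent 2 of the weight exceeds \<alpha>, so the assumed excess at radius
    \<open>d\<close> passes to the larger radius \<open>D\<close>.\<close>
  have "C * (D\<^sup>2) powr a \<le> m"
  proof -
    have "(D\<^sup>2) powr a / D\<^sup>2 = (D\<^sup>2) powr (a - 1)" using D by (simp add: powr_diff)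
    also have "\<dots> \<le> (d\<^sup>2) powr (a - 1)" using a d D by (intro powr_mono2') auto
    also have "\<dots> = (d\<^sup>2) powr a / d\<^sup>2" using d by (simp add: powr_diff)
    finally have "C * ((D\<^sup>2) powr a / D\<^sup>2) \<le> C * ((d\<^sup>2) powr a / d\<^sup>2)" using C(1) by (intro mult_left_mono) auto
    also have "\<dots> \<le> v Y0 / d\<^sup>2" using big by (simp add: divide_right_mono)
    also have "\<dots> \<le> m / D\<^sup>2" using Y(2)[of Y0] R by (simp add: B_def m_def D_def)
    finally show ?thesis using D by (simp add: field_simps)
  qed
  note mD = this
  have m: "m > 0" using mD C(1) D by (smt (verit) mult_pos_pos powr_gt_zero zero_less_power)
  \<comment> \<open>A larger \<open>D\<close> would push \<open>v Y\<close> above the global bound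
    \<open>S\<close>, by the lower bound on \<open>C\<close>.\<close>
  have DR: "D \<le> R / 16"
  proof (rule ccontr)
    assume "\<not> D \<le> R / 16"
    then have "((R / 16)\<^sup>2) powr a < (D\<^sup>2) powr a"
      using R a by (intro powr_less_mono2 power_strict_mono) auto
    then have "C * ((R / 16)\<^sup>2) powr a < C * (D\<^sup>2) powr a" using C(1) by simp
    then show False using C(3) mD bd[of Y] Y(1) BX by (force simp: m_def a_def)
  qed
  have near: "cball Y (2 * D) \<subseteq> B"
  proof
    fix y assume "y \<in> cball Y (2 * D)"
    then show "y \<in> B" using DR d(1) R dist_triangle[of Y0 y Y] by (simp add: B_def D_def)
  qed
  \<comment> \<open>On \<open>cball Y D\<close> the distance term at most doubles, and the square of
    2 is the factor 4 that the modulus estimate allows.\<close>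
  have le4: "v y \<le> 4 * m" if "y \<in> cball Y D" for y
  proof -
    have yB: "y \<in> B" using near that D by auto
    have "d + dist Y0 y \<le> 2 * D" using that dist_triangle[of Y0 y Y] by (simp add: D_def)
    then have "(d + dist Y0 y)\<^sup>2 \<le> (2 * D)\<^sup>2" using den[of y] by (intro power_mono) auto
    then have "v y / (2 * D)\<^sup>2 \<le> v y / (d + dist Y0 y)\<^sup>2"
      using bd[of y] yB BX den[of y] D(1) by (intro divide_left_mono mult_pos_pos zero_less_power) auto
    also have "\<dots> \<le> m / D\<^sup>2" using Y(2)[OF yB] by (simp add: m_def D_def)
    finally show ?thesis using D by (simp add: power_mult_distrib field_simps)
  qed
  have sub: "cball Y D \<subseteq> cball X R" "cball Y (2 * D) \<subseteq> cball X R" using near BX D by force+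
  have "C powr (\<gamma> - 2) \<le> 1" using C(1) \<gamma> powr_mono[of "\<gamma> - 2" 0 C] by simp
  then have "C powr (\<gamma> - 2) * m \<le> m" using m by simp
  then have mm: "m powr (\<gamma> - 1) * D\<^sup>2 \<le> m"
    using scale_ineq[OF \<gamma> _ D(1) mD[unfolded a_def]] C(1) by simp
  have half: "m / 2 \<le> v y" if y: "y \<in> cball Y (1 / (2 * L) * D)" for y
  proof -
    have "1 / (2 * L) * D \<le> 1 * D" using L D by (intro mult_right_mono) auto
    then have "y \<in> cball Y D" using y by simp
    then have "m \<le> v y + L * m / D * dist Y y" using modulus[OF D(1) m sub(1) le4 mm] by (simp add: m_def)
    moreover have "L * m / D * dist Y y \<le> L * m / D * (1 / (2 * L) * D)"
      using y L m D by (intro mult_left_mono) auto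
    moreover have "L * m / D * (1 / (2 * L) * D) = m / 2" using L D by simp
    ultimately show ?thesis by simp
  qed
  \<comment> \<open>As \<open>dist X Y0 \<le> d\<close>, the zero \<open>X\<close> lies in
    \<open>cball Y D\<close>, which the positivity spreading from \<open>Y\<close> covers.\<close>
  have "0 < v X"
  proof (rule spread[OF D(1) _ sub(2) half])
    show "0 < m / 2" using m by simp
    have "C / 2 * (D\<^sup>2) powr (1 / (2 - \<gamma>)) \<le> m / 2" using mD by (simp add: a_def)
    from scale_ineq[OF \<gamma> _ D(1) this] C(1)
    have "(m / 2) powr (\<gamma> - 1) * D\<^sup>2 \<le> (C / 2) powr (\<gamma> - 2) * (m / 2)" by simp
    also have "\<dots> \<le> c1 * (m / 2)" using C(2) m by (intro mult_right_mono) auto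
    finally show "(m / 2) powr (\<gamma> - 1) * D\<^sup>2 \<le> c1 * (m / 2)" .
    show "X \<in> cball Y D" using d(3) dist_triangle[of Y X Y0] by (simp add: D_def dist_commute)
  qed
  then show False using X by simp
qed

lemma measure_ball_ratio:
  fixes X Y :: "real^'n"
  assumes "0 < \<delta>" "0 < \<theta>" "ball Y (\<theta> * \<delta>) \<subseteq> ball X \<delta> \<inter> P" "open P"
  shows "\<theta> ^ CARD('n) \<le> measure lebesgue (ball X \<delta> \<inter> P) / measure lebesgue (ball X \<delta>)"
proof -
  have "measure lebesgue (ball Y (\<theta> * \<delta>)) \<le> measure lebesgue (ball X \<delta> \<inter> P)"
  proof (rule measure_mono_fmeasurable[OF assms(3)])
    show "ball X \<delta> \<inter> P \<in> lmeasurable"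
      using assms(4) by (intro bounded_set_imp_lmeasurable lmeasurable_open bounded_Int) auto
  qed simp
  moreover have "measure lebesgue (ball Y (\<theta> * \<delta>)) = \<theta> ^ CARD('n) * measure lebesgue (ball X \<delta>)"
    using assms(1,2) by (simp add: content_ball power_mult_distrib)
  moreover have "measure lebesgue (ball X \<delta>) > 0"
    using assms(1) by (simp add: content_ball)
  ultimately show ?thesis by (simp add: pos_le_divide_eq)
qed

section \<open>Density of the positivity set\<close>

text \<open>Each estimate loses at most a fixed factor under a small uniform error, so every
  instance takes a single sufficiently close approximation. In the last one the threshold
  \<open>T\<close> is chosen below half of \<open>u0 Z\<close>.\<close>

lemma (in elliptic) limit_estimates:
  fixes U :: "(real^'n) set"
  assumes \<gamma>: "0 < \<gamma>" "\<gamma> < 1" and U: "compact U" and cu0: "continuous_on U u0"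
    and modulus: "\<forall>\<beta> u (Y::real^'n) D m U. 0 < D \<and> 0 < m \<and> cball Y D \<subseteq> U \<and> continuous_on (cball Y D) u
      \<and> (\<forall>x\<in>cball Y D. 0 \<le> u x \<and> u x \<le> 4 * m) \<and> (\<forall>x\<in>ball Y D. super_at F \<beta> u x)
      \<and> (\<forall>s. 0 \<le> \<beta> s) \<and> \<beta> 0 \<le> 0 \<and> (\<forall>s>0. \<beta> s \<le> \<gamma> * s powr (\<gamma> - 1))
      \<and> least_super F \<beta> U u \<and> m powr (\<gamma> - 1) * D\<^sup>2 \<le> 1 * m
      \<longrightarrow> (\<forall>y\<in>cball Y D. u Y \<le> u y + L * m / D * dist Y y)"
    and spread: "\<forall>\<beta> v (x0::real^'n) t h. 0 < t \<and> 0 < h \<and> continuous_on (cball x0 (2*t)) v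
      \<and> (\<forall>x\<in>cball x0 (2*t). 0 \<le> v x) \<and> (\<forall>x\<in>ball x0 (2*t). super_at F \<beta> v x)
      \<and> \<beta> 0 \<le> 0 \<and> (\<forall>s>0. \<beta> s \<le> \<gamma> * s powr (\<gamma> - 1))
      \<and> (\<forall>x\<in>cball x0 (\<eta>*t). h \<le> v x) \<and> h powr (\<gamma> - 1) * t\<^sup>2 \<le> c1 * h
      \<longrightarrow> (\<forall>x\<in>cball x0 t. c0 * h \<le> v x)"
    and c0: "0 < c0" and L: "0 < L" and \<eta>: "\<eta> \<le> 1"
    and A: "0 < A" "2 * Lam / (2 - \<gamma>) * A \<le> \<gamma> * A powr (\<gamma> - 1)"
    and pick': "\<forall>e>0. \<exists>u \<beta> T.  0 < T \<and> T < e \<and> (\<forall>x\<in>U. \<bar>u x - u0 x\<bar> < e) \<and> continuous_on U u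
      \<and> (\<forall>x\<in>U. 0 \<le> u x) \<and> (\<forall>x\<in>U. super_at F \<beta> u x) \<and> least_super F \<beta> U u
      \<and> (\<forall>s. 0 \<le> \<beta> s) \<and> \<beta> 0 \<le> 0 \<and> (\<forall>s>0. \<beta> s \<le> \<gamma> * s powr (\<gamma> - 1))
      \<and> (\<forall>t\<ge>T. \<beta> t = \<gamma> * t powr (\<gamma> - 1))"
  shows "\<lbrakk>0 < D; 0 < m; cball Y D \<subseteq> U; \<And>x. x \<in> cball Y D \<Longrightarrow> u0 x \<le> 4 * m; m powr (\<gamma> - 1) * D\<^sup>2 \<le> m;
      y \<in> cball Y D\<rbrakk> \<Longrightarrow> u0 Y \<le> u0 y + (2 * L) * m / D * dist Y y"
    and "\<lbrakk>0 < t; 0 < h; cball x0 (2*t) \<subseteq> U; \<And>x. x \<in> cball x0 (\<eta> * t) \<Longrightarrow> h \<le> u0 x;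
      h powr (\<gamma> - 1) * t\<^sup>2 \<le> c1 / 4 * h; x \<in> cball x0 t\<rbrakk> \<Longrightarrow> 0 < u0 x"
    and "\<lbrakk>0 < r; cball Z r \<subseteq> U; 0 < u0 Z\<rbrakk> \<Longrightarrow> \<exists>x\<in>sphere Z r. A * (r\<^sup>2) powr (1 / (2 - \<gamma>)) \<le> u0 x"
proof -
  assume D: "0 < D" and m: "0 < m" and YU: "cball Y D \<subseteq> U" and le: "\<And>x. x \<in> cball Y D \<Longrightarrow> u0 x \<le> 4 * m"
    and small: "m powr (\<gamma> - 1) * D\<^sup>2 \<le> m" and y: "y \<in> cball Y D"
  show "u0 Y \<le> u0 y + (2 * L) * m / D * dist Y y"
  proof (rule field_le_epsilon)
    fix e :: real assume e: "e > 0"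
    \<comment> \<open>An error of at most \<open>4 * m\<close> leaves \<open>u\<close> below
      \<open>4 * (2 * m)\<close>; applying the estimate with \<open>2 * m\<close> doubles
      \<open>L\<close>.\<close>
    have "0 < min (e / 2) (4 * m)" using e m by simp
    from pick'[rule_format, OF this]
    obtain u \<beta> and T :: real where T: "0 < T" "\<forall>x\<in>U. \<bar>u x - u0 x\<bar> < min (e / 2) (4 * m)" "continuous_on U u"
      "\<forall>x\<in>U. 0 \<le> u x" "\<forall>x\<in>U. super_at F \<beta> u x" "least_super F \<beta> U u"
      "\<forall>s. 0 \<le> \<beta> s" "\<beta> 0 \<le> 0" "\<forall>s>0. \<beta> s \<le> \<gamma> * s powr (\<gamma> - 1)"
      by blast
    have "(2 * m) powr (\<gamma> - 1) \<le> m powr (\<gamma> - 1)" using m \<gamma> by (intro powr_mono2') auto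
    then have "(2 * m) powr (\<gamma> - 1) * D\<^sup>2 \<le> m powr (\<gamma> - 1) * D\<^sup>2" by (intro mult_right_mono) auto
    then have sm: "(2 * m) powr (\<gamma> - 1) * D\<^sup>2 \<le> 1 * (2 * m)" using small m by linarith
    have "\<forall>x\<in>cball Y D. 0 \<le> u x \<and> u x \<le> 4 * (2 * m)"
    proof
      fix x assume x: "x \<in> cball Y D"
      then have "x \<in> U" using YU by blast
      then have "\<bar>u x - u0 x\<bar> < 4 * m" "0 \<le> u x" using T(2,4) by auto
      then show "0 \<le> u x \<and> u x \<le> 4 * (2 * m)" using le[OF x] by linarith
    qed
    moreover have "\<forall>x\<in>ball Y D. super_at F \<beta> u x" using T(5) YU by (auto simp: subset_iff)
    moreover have "0 < 2 * m" using m by simp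
    ultimately have "u Y \<le> u y + L * (2 * m) / D * dist Y y"
      using modulus[rule_format, of D "2 * m" Y U u \<beta> y] D m YU continuous_on_subset[OF T(3) YU] T sm y
      by blast
    moreover have "\<bar>u Y - u0 Y\<bar> < e / 2" "\<bar>u y - u0 y\<bar> < e / 2"
      using T(2) YU y D by (auto simp: subset_iff)
    ultimately have "u0 Y \<le> u0 y + e + L * (2 * m) / D * dist Y y" by linarith
    then show "u0 Y \<le> u0 y + (2 * L) * m / D * dist Y y + e" by (simp add: mult_ac)
  qed
next
  assume t: "0 < t" and h: "0 < h" and xU: "cball x0 (2*t) \<subseteq> U" and hu: "\<And>x. x \<in> cball x0 (\<eta> * t) \<Longrightarrow> h \<le> u0 x"
    and small: "h powr (\<gamma> - 1) * t\<^sup>2 \<le> c1 / 4 * h" and x: "x \<in> cball x0 t"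
  \<comment> \<open>The first bound keeps half of the height on the small ball, the second keeps the
    conclusion positive. Passing to \<open>h / 2\<close> costs the factor 4 in
    \<open>c1\<close>.\<close>
  define e where "e = min (h / 2) (c0 * h / 4)"
  have e: "e > 0" using h c0 by (simp add: e_def)
  from pick'[rule_format, OF e]
  obtain u \<beta> and T :: real where T: "0 < T" "\<forall>x\<in>U. \<bar>u x - u0 x\<bar> < e" "continuous_on U u"
    "\<forall>x\<in>U. 0 \<le> u x" "\<forall>x\<in>U. super_at F \<beta> u x" "least_super F \<beta> U u"
    "\<forall>s. 0 \<le> \<beta> s" "\<beta> 0 \<le> 0" "\<forall>s>0. \<beta> s \<le> \<gamma> * s powr (\<gamma> - 1)"
    by blast
  have "(h / 2) powr (\<gamma> - 1) = h powr (\<gamma> - 1) * 2 powr (1 - \<gamma>)"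
    using h by (simp add: powr_divide powr_diff)
  also have "\<dots> \<le> h powr (\<gamma> - 1) * 2 powr 1" using \<gamma> by (intro mult_left_mono powr_mono) auto
  finally have "(h / 2) powr (\<gamma> - 1) * t\<^sup>2 \<le> (h powr (\<gamma> - 1) * 2) * t\<^sup>2" by (intro mult_right_mono) auto
  also have "\<dots> \<le> c1 * (h / 2)" using small by simp
  finally have sm: "(h / 2) powr (\<gamma> - 1) * t\<^sup>2 \<le> c1 * (h / 2)" .
  have bl: "\<forall>x\<in>ball x0 (2*t). super_at F \<beta> u x" "\<forall>x\<in>cball x0 (2*t). 0 \<le> u x" using T(4,5) xU by (auto simp: subset_iff)
  have "\<forall>x\<in>cball x0 (\<eta> * t). h / 2 \<le> u x"
  proof
    fix z assume z: "z \<in> cball x0 (\<eta> * t)"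
    have "\<eta> * t \<le> 1 * t" using \<eta> t by (intro mult_right_mono) auto
    moreover have "dist x0 z \<le> \<eta> * t" using z by simp
    ultimately have "dist x0 z \<le> 2 * t" using t by linarith
    then have "z \<in> cball x0 (2 * t)" by simp
    then have "\<bar>u z - u0 z\<bar> < h / 2" using T(2) xU by (auto simp: e_def)
    then show "h / 2 \<le> u z" using hu[OF z] by linarith
  qed
  then have "c0 * (h / 2) \<le> u x"
    using spread[rule_format, of t "h / 2" x0 u \<beta> x] t h continuous_on_subset[OF T(3) xU] bl T sm x
    by (smt (verit) half_gt_zero)
  moreover have "x \<in> U" using x t xU by auto
  then have "\<bar>u x - u0 x\<bar> < c0 * h / 4" using T(2) by (auto simp: e_def)
  moreover have "c0 * h > 0" using c0 h by simp
  moreover have "c0 * (h / 2) = c0 * h / 2" by simp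
  ultimately show "0 < u0 x" by linarith
next
  assume r: "0 < r" and ZU: "cball Z r \<subseteq> U" and pos: "0 < u0 Z"
  define M where "M = A * (r\<^sup>2) powr (1 / (2 - \<gamma>))"
  have sU: "sphere Z r \<subseteq> U" using ZU by (auto simp: subset_iff)
  have "sphere Z r \<noteq> {}" using r by simp
  then obtain z where z: "z \<in> sphere Z r" "\<forall>x\<in>sphere Z r. u0 x \<le> u0 z"
    using continuous_attains_sup[OF compact_sphere _ continuous_on_subset[OF cu0 sU]] by blast
  have "M \<le> u0 z"
  proof (rule ccontr)
    assume "\<not> M \<le> u0 z"
    then have "min (M - u0 z) (u0 Z / 2) > 0" using pos by simp
    from pick'[rule_format, OF this] obtain u \<beta> T where T: "0 < T" "T < min (M - u0 z) (u0 Z / 2)"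
      "\<forall>x\<in>U. \<bar>u x - u0 x\<bar> < min (M - u0 z) (u0 Z / 2)" "least_super F \<beta> U u"
      "\<forall>t\<ge>T. \<beta> t = \<gamma> * t powr (\<gamma> - 1)" by blast
    have "u x \<le> M" if "x \<in> sphere Z r" for x
    proof -
      have "\<bar>u x - u0 x\<bar> < M - u0 z" using T(3) sU that by (auto simp: subset_iff)
      then show ?thesis using z(2) that by fastforce
    qed
    then have "u Z \<le> T"
      using T by (intro nondegeneracy[OF \<gamma> A T(1) _ T(4) r ZU]) (auto simp: M_def)
    moreover have "\<bar>u Z - u0 Z\<bar> < u0 Z / 2" using T(3) ZU r by (auto simp: subset_iff)
    moreover have "T < u0 Z / 2" using T(2) by simp
    ultimately show False by linarith
  qed
  then show "\<exists>x\<in>sphere Z r. A * (r\<^sup>2) powr (1 / (2 - \<gamma>)) \<le> u0 x" using z(1) unfolding M_def by blast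
qed

theorem theorem8p4:
  fixes F :: "real^'n^'n \<Rightarrow> real"
    and \<Omega> \<Omega>' :: "(real^'n) set"
    and f :: "real^'n \<Rightarrow> real"
    and \<gamma> lam Lam \<tau> \<sigma>0 :: real
    and \<rho> :: "real \<Rightarrow> real"
  assumes "CARD('n) \<ge> 2"
    and "lipschitz_domain \<Omega>"
    and "continuous_on (frontier \<Omega>) f" and "\<forall>x\<in>frontier \<Omega>. f x \<ge> 0"
    and "0 < \<gamma>" and "\<gamma> < 1"
    and "C1_on_sym_minus0 F" and "F 0 = 0"
    and "unif_elliptic F lam Lam"
    and "0 < \<tau>" and "\<tau> < 1" and "interior_C2tau_estimates F \<tau>"
    and "smooth_fun \<rho>" and "\<forall>t. \<rho> t \<ge> 0" and "{t. \<rho> t \<noteq> 0} \<subseteq> {0..1}"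
    and "integral {0..1} \<rho> = 1"
    and "0 < \<sigma>0" and "\<sigma>0 < 1/2"
    and "open \<Omega>'" and "bounded \<Omega>'" and "closure \<Omega>' \<subseteq> \<Omega>"
  shows "\<exists>c \<delta>0. 0 < c \<and> c \<le> 1 \<and> 0 < \<delta>0 \<and>
    (\<forall>(\<epsilon>s :: nat \<Rightarrow> real) (u :: nat \<Rightarrow> real^'n \<Rightarrow> real) (u0 :: real^'n \<Rightarrow> real).
       (\<forall>k. \<epsilon>s k > 0) \<and> \<epsilon>s \<longlonglongrightarrow> 0 \<and>
       (\<forall>k. minimal_solution F f (beta_eps \<gamma> \<rho> \<sigma>0 (\<epsilon>s k)) \<Omega> (u k)) \<and>
       C1_loc_conv \<Omega> u u0 \<longrightarrow>
       (\<forall>X \<in> frontier {x\<in>\<Omega>. u0 x > 0} \<inter> \<Omega> \<inter> \<Omega>'. \<forall>\<delta>. 0 < \<delta> \<and> \<delta> \<le> \<delta>0 \<longrightarrow>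
          measure lebesgue (ball X \<delta> \<inter> {x\<in>\<Omega>. u0 x > 0}) / measure lebesgue (ball X \<delta>) \<ge> c))"
proof -
  interpret elliptic F lam Lam by unfold_locales (use assms in auto)
  note \<gamma> = \<open>0 < \<gamma>\<close> \<open>\<gamma> < 1\<close>
  note \<sigma>0 = \<open>0 < \<sigma>0\<close> \<open>\<sigma>0 < 1/2\<close>
  note \<rho> = \<open>smooth_fun \<rho>\<close> \<open>\<forall>t. \<rho> t \<ge> 0\<close> \<open>{t. \<rho> t \<noteq> 0} \<subseteq> {0..1}\<close> \<open>integral {0..1} \<rho> = 1\<close>
  have \<Omega>: "open \<Omega>" "bounded \<Omega>" using \<open>lipschitz_domain \<Omega>\<close> by (auto simp: lipschitz_domain_def)
  define a where "a = 1 / (2 - \<gamma>)"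
  have a: "0 < a" "a < 1" using \<gamma> by (auto simp: a_def)
  have "compact (frontier \<Omega>)" using \<Omega>(2) by (rule compact_frontier_bounded)
  then have "bounded (f ` frontier \<Omega>)"
    using \<open>continuous_on (frontier \<Omega>) f\<close> compact_continuous_image compact_imp_bounded by blast
  then obtain S0 where S0: "\<forall>x\<in>f ` frontier \<Omega>. norm x \<le> S0" using bounded_iff by blast
  define S where "S = max 0 S0"
  have S: "0 \<le> S" and fS: "\<And>x. x \<in> frontier \<Omega> \<Longrightarrow> f x \<le> S" using S0 by (force simp: S_def)+
  have "compact (closure \<Omega>')" using \<open>bounded \<Omega>'\<close> by simp
  then obtain R0 where R0: "0 < R0" "(\<Union>x\<in>closure \<Omega>'. cball x R0) \<subseteq> \<Omega>"
    using compact_subset_open_imp_cball_epsilon_subset[OF _ \<Omega>(1) \<open>closure \<Omega>' \<subseteq> \<Omega>\<close>] by blast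
  \<comment> \<open>Half of \<open>R0\<close>, so that the neighbourhood \<open>U\<close> of radius
    \<open>R\<close> still has room \<open>R\<close> inside \<open>\<Omega>\<close>.\<close>
  define R where "R = R0 / 2"
  have R: "0 < R" using R0 by (simp add: R_def)
  define U where "U = (\<Union>x\<in>closure \<Omega>'. cball x R)"
  have cU: "compact U" unfolding U_def using \<open>compact (closure \<Omega>')\<close> by (rule compact_minkowski_sum_cball)
  have UR: "cball x R \<subseteq> \<Omega>" if xU: "x \<in> U" for x
  proof
    fix y assume y: "y \<in> cball x R"
    obtain z where z: "z \<in> closure \<Omega>'" "x \<in> cball z R" using xU by (auto simp: U_def)
    have "y \<in> cball z R0" using y z(2) dist_triangle[of z y x] by (simp add: R_def)
    then show "y \<in> \<Omega>" using R0(2) z(1) by blast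
  qed
  have U\<Omega>: "U \<subseteq> \<Omega>" using UR R by (meson centre_in_cball less_imp_le subset_iff)
  obtain L where L: "0 < L" and modulus: "\<forall>\<beta> u (Y::real^'n) D m U. 0 < D \<and> 0 < m \<and> cball Y D \<subseteq> U \<and> continuous_on (cball Y D) u
      \<and> (\<forall>x\<in>cball Y D. 0 \<le> u x \<and> u x \<le> 4 * m) \<and> (\<forall>x\<in>ball Y D. super_at F \<beta> u x)
      \<and> (\<forall>s. 0 \<le> \<beta> s) \<and> \<beta> 0 \<le> 0 \<and> (\<forall>s>0. \<beta> s \<le> \<gamma> * s powr (\<gamma> - 1))
      \<and> least_super F \<beta> U u \<and> m powr (\<gamma> - 1) * D\<^sup>2 \<le> 1 * m
      \<longrightarrow> (\<forall>y\<in>cball Y D. u Y \<le> u y + L * m / D * dist Y y)"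
    using interior_modulus[OF \<gamma> zero_le_one] by blast
  \<comment> \<open>The limit has the constant \<open>2 * L\<close>; the added 1 meets the lower
    bound that growth asks for. It precedes \<open>c0\<close> and \<open>c1\<close>, which depend on
    the ratio of radii \<open>1 / (2 * M)\<close>.\<close>
  define M where "M = 1 + 2 * L"
  have M: "1 \<le> M" "2 * L \<le> M" using L by (auto simp: M_def)
  have \<eta>: "0 < 1 / (2 * M)" "1 / (2 * M) < 1" "1 / (2 * M) \<le> 1" using M by auto
  obtain c0 c1 where c0: "0 < c0" and c1: "0 < c1" and
    spread: "\<forall>\<beta> v (x0::real^'n) t h. 0 < t \<and> 0 < h \<and> continuous_on (cball x0 (2*t)) v
      \<and> (\<forall>x\<in>cball x0 (2*t). 0 \<le> v x) \<and> (\<forall>x\<in>ball x0 (2*t). super_at F \<beta> v x)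
      \<and> \<beta> 0 \<le> 0 \<and> (\<forall>s>0. \<beta> s \<le> \<gamma> * s powr (\<gamma> - 1))
      \<and> (\<forall>x\<in>cball x0 (1 / (2 * M) * t). h \<le> v x) \<and> h powr (\<gamma> - 1) * t\<^sup>2 \<le> c1 * h
      \<longrightarrow> (\<forall>x\<in>cball x0 t. c0 * h \<le> v x)"
    using positivity_spreads[OF \<gamma> \<eta>(1,2)] by (elim exE conjE)
  \<comment> \<open>Solves the barrier condition with equality.\<close>
  define A where "A = (\<gamma> * (2 - \<gamma>) / (2 * Lam)) powr a"
  have A0: "0 < A" using \<gamma> Lam_pos by (simp add: A_def)
  have A: "2 * Lam / (2 - \<gamma>) * A \<le> \<gamma> * A powr (\<gamma> - 1)"
  proof -
    have "A powr (2 - \<gamma>) = \<gamma> * (2 - \<gamma>) / (2 * Lam)"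
      using \<gamma> Lam_pos by (simp add: A_def a_def powr_powr)
    moreover have "A = A powr (2 - \<gamma>) * A powr (\<gamma> - 1)" using A0 by (simp add: powr_add[symmetric])
    ultimately have "A = \<gamma> * (2 - \<gamma>) / (2 * Lam) * A powr (\<gamma> - 1)" by simp
    then have "2 * Lam / (2 - \<gamma>) * A = 2 * Lam / (2 - \<gamma>) * (\<gamma> * (2 - \<gamma>) / (2 * Lam) * A powr (\<gamma> - 1))" by simp
    also have "\<dots> = \<gamma> * A powr (\<gamma> - 1)" using \<gamma> Lam_pos by simp
    finally show ?thesis by simp
  qed
  \<comment> \<open>Solves \<open>B powr (\<gamma> - 2) = c1 / 4\<close>. The summands of
    \<open>C\<close> secure \<open>1 \<le> C\<close>, the smallness condition at height
    \<open>m / 2\<close>, and the bound \<open>S\<close> at radius \<open>R / 16\<close>.\<close>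
  define B where "B = (c1 / 4) powr (1 / (\<gamma> - 2))"
  define C where "C = 1 + 2 * B + S / ((R / 16)\<^sup>2) powr a"
  have B: "B > 0" using c1 by (simp add: B_def)
  have SR: "0 \<le> S / ((R / 16)\<^sup>2) powr a" using S by simp
  have C: "1 \<le> C" "B \<le> C / 2" "S / ((R / 16)\<^sup>2) powr a \<le> C" using B SR by (auto simp: C_def)
  have C2: "(C / 2) powr (\<gamma> - 2) \<le> c1 / 4"
  proof -
    have "(C / 2) powr (\<gamma> - 2) \<le> B powr (\<gamma> - 2)" using C B \<gamma> by (intro powr_mono2') auto
    also have "\<dots> = c1 / 4" using c1 \<gamma> by (simp add: B_def powr_powr)
    finally show ?thesis .
  qed
  have C3: "S \<le> C * ((R / 16)\<^sup>2) powr (1 / (2 - \<gamma>))"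
    using C(3) R by (simp add: a_def[symmetric] pos_divide_le_eq)
  \<comment> \<open>With \<open>r = \<delta> / 4\<close> the height at \<open>Y\<close> is at least
    \<open>A * (r\<^sup>2) powr a\<close> and the slope at most \<open>M * m / r\<close>;
    \<open>\<theta>\<close> keeps the drop over distance \<open>\<theta> * \<delta>\<close> below
    the height. The minimum with 1 keeps the small ball inside \<open>cball Y r\<close>.\<close>
  define \<theta> where "\<theta> = min 1 (A / (16 powr a * (M * C))) / 4"
  have th0: "0 < \<theta>" using A0 M C by (simp add: \<theta>_def)
  have th1: "\<theta> \<le> 1 / 4" "\<theta> * 4 \<le> A / (16 powr a * (M * C))" by (auto simp: \<theta>_def)
  show ?thesis
  proof (rule exI[of _ "\<theta> ^ CARD('n)"], rule exI[of _ "R / 4"], intro conjI allI impI ballI; (elim conjE)?)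
    show "0 < \<theta> ^ CARD('n)" using th0 by simp
    show "\<theta> ^ CARD('n) \<le> 1" using th0 th1 by (intro power_le_one) auto
    show "0 < R / 4" using R by simp
    fix \<epsilon>s u u0 X \<delta>
    assume \<epsilon>: "\<forall>k. 0 < \<epsilon>s k" "\<epsilon>s \<longlonglongrightarrow> 0"
      and min: "\<forall>k. minimal_solution F f (beta_eps \<gamma> \<rho> \<sigma>0 (\<epsilon>s k)) \<Omega> (u k)"
      and conv: "C1_loc_conv \<Omega> u u0"
      and X: "X \<in> frontier {x \<in> \<Omega>. 0 < u0 x} \<inter> \<Omega> \<inter> \<Omega>'" and \<delta>: "0 < \<delta>" "\<delta> \<le> R / 4"
    define P where "P = {x \<in> \<Omega>. 0 < u0 x}"
    define \<beta> where "\<beta> k = beta_eps \<gamma> \<rho> \<sigma>0 (\<epsilon>s k)" for k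
    define T where "T k = 2 * \<epsilon>s k powr alpha_exp \<gamma>" for k
    have ep: "0 < \<epsilon>s k" for k using \<epsilon>(1) by simp
    have T0: "0 < T k" for k using ep[of k] by (simp add: T_def)
    have al: "0 < alpha_exp \<gamma>" using \<gamma> by (simp add: alpha_exp_def add_pos_pos)
    have "(\<lambda>k. 2 * \<epsilon>s k powr alpha_exp \<gamma>) \<longlonglongrightarrow> 2 * 0"
      using \<epsilon> al by (intro tendsto_mult tendsto_const tendsto_zero_powrI[OF \<epsilon>(2) tendsto_const])
        (auto simp: less_imp_le)
    then have Tlim: "T \<longlonglongrightarrow> 0" by (simp add: T_def[abs_def])
    have cuk: "continuous_on \<Omega> (u k)" for k
      using conv unfolding C1_loc_conv_def
      by (meson continuous_at_imp_continuous_on has_derivative_continuous)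
    have cu0: "continuous_on \<Omega> u0"
      using conv unfolding C1_loc_conv_def
      by (meson continuous_at_imp_continuous_on has_derivative_continuous)
    have ulim: "uniform_limit K u u0 sequentially" if "compact K" "K \<subseteq> \<Omega>" for K
      using conv that unfolding C1_loc_conv_def by blast
    have lim: "(\<lambda>k. u k x) \<longlonglongrightarrow> u0 x" if "x \<in> \<Omega>" for x
      using tendsto_uniform_limitI[OF ulim[of "{x}"]] that by auto
    have oP: "open P"
    proof -
      have "P = \<Omega> \<inter> u0 -` {0<..}" by (auto simp: P_def)
      then show ?thesis using continuous_open_preimage[OF cu0 \<Omega>(1), of "{0<..}"] by auto
    qed
    have XP: "X \<in> \<Omega>" "X \<in> \<Omega>'" "X \<in> closure P" "X \<notin> P"
      using X oP by (auto simp: P_def[symmetric] frontier_def interior_open)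
    have near: "\<exists>Z\<in>P. dist Z X < e" if "e > 0" for e
      using XP(3) that closure_approachable by blast
    have XU: "cball X R \<subseteq> U" unfolding U_def using XP(2) closure_subset by blast
    have X0: "X \<in> U" using XU R by auto
    define G where "G k \<longleftrightarrow> (\<forall>x\<in>\<Omega>. 0 \<le> u k x \<and> u k x \<le> S) \<and> (\<forall>x\<in>\<Omega>. super_at F (\<beta> k) (u k) x) \<and>
      (\<forall>K r. 0 < r \<and> (\<forall>x\<in>K. cball x r \<subseteq> \<Omega>) \<and> Lam * (2 * ((S + 1) / r\<^sup>2)) < Sup (range (\<beta> k))
       \<longrightarrow> least_super F (\<beta> k) K (u k))" for k
    have alt: "(\<exists>c. \<forall>x\<in>\<Omega>. u k x = c) \<or> G k" for k
      unfolding G_def \<beta>_def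
      by (rule minimal_solution_properties[OF \<Omega> isCont_beta_eps[OF \<rho> \<gamma> \<sigma>0 ep]
            beta_eps_nonpos_arg[OF \<rho> \<gamma> \<sigma>0 ep] bdd_above_beta_eps[OF \<rho> \<gamma> \<sigma>0 ep] _ fS S min[rule_format] cuk])
        (use \<open>\<forall>x\<in>frontier \<Omega>. f x \<ge> 0\<close> in auto)
    \<comment> \<open>If no supersolution lies between the two obstacles, \<open>Inf {}\<close> makes \<open>u k\<close> constant; should this happen
      for infinitely many \<open>k\<close>, the limit has no free boundary.\<close>
    have "\<forall>\<^sub>F k in sequentially. G k"
    proof (rule ccontr)
      assume "\<not> (\<forall>\<^sub>F k in sequentially. G k)"
      then have fr: "\<exists>\<^sub>F k in sequentially. \<exists>c. \<forall>x\<in>\<Omega>. u k x = c"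
        unfolding not_eventually by (rule frequently_elim1) (use alt in blast)
      have eq: "u0 x = u0 y" if "x \<in> \<Omega>" "y \<in> \<Omega>" for x y
      proof (rule ccontr)
        assume "u0 x \<noteq> u0 y"
        then have "u0 x - u0 y \<noteq> 0" by simp
        moreover have "(\<lambda>k. u k x - u k y) \<longlonglongrightarrow> u0 x - u0 y" using lim that by (intro tendsto_intros)
        ultimately have "\<forall>\<^sub>F k in sequentially. u k x - u k y \<noteq> 0" by (rule tendsto_imp_eventually_ne[rotated])
        with fr have "\<exists>\<^sub>F k in sequentially. (\<exists>c. \<forall>x\<in>\<Omega>. u k x = c) \<and> u k x - u k y \<noteq> 0"
          by (rule frequently_eventually_frequently)
        then show False using that by (auto dest!: frequently_ex)
      qed
      obtain Z where "Z \<in> P" using near[of 1] by auto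
      then have "0 < u0 Z" "Z \<in> \<Omega>" by (auto simp: P_def)
      then show False using eq[of Z X] XP by (simp add: P_def)
    qed
    \<comment> \<open>Since \<open>\<gamma> - 1\<close> is negative and \<open>T k\<close> tends to
      0, the supremum of \<beta> eventually passes the level that makes the lower obstacle
      nonpositive on \<open>U\<close>.\<close>
    moreover have "\<forall>\<^sub>F k in sequentially. Lam * (2 * ((S + 1) / R\<^sup>2)) < \<gamma> * T k powr (\<gamma> - 1)"
      using eventually_powr_neg_gt[OF T0 Tlim] \<gamma> by simp
    ultimately have evG: "\<forall>\<^sub>F k in sequentially. G k \<and> least_super F (\<beta> k) U (u k)"
    proof eventually_elim
      case (elim k)
      then have large: "Lam * (2 * ((S + 1) / R\<^sup>2)) < Sup (range (\<beta> k))"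
        using Sup_beta_eps_ge[OF \<rho> \<gamma> \<sigma>0 ep, of k] by (simp add: T_def \<beta>_def)
      have "\<forall>x\<in>U. cball x R \<subseteq> \<Omega>" using UR by blast
      with R large elim(1) have "least_super F (\<beta> k) U (u k)" unfolding G_def by blast
      with elim(1) show ?case by blast
    qed
    have pick_all: "\<forall>e>0. \<exists>u \<beta> T. 0 < T \<and> T < e \<and> (\<forall>x\<in>U. \<bar>u x - u0 x\<bar> < e) \<and> continuous_on U u
      \<and> (\<forall>x\<in>U. 0 \<le> u x) \<and> (\<forall>x\<in>U. super_at F \<beta> u x) \<and> least_super F \<beta> U u
      \<and> (\<forall>s. 0 \<le> \<beta> s) \<and> \<beta> 0 \<le> 0 \<and> (\<forall>s>0. \<beta> s \<le> \<gamma> * s powr (\<gamma> - 1))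
      \<and> (\<forall>t\<ge>T. \<beta> t = \<gamma> * t powr (\<gamma> - 1))"
    proof (intro allI impI)
      fix e :: real assume e: "0 < e"
      have "\<forall>\<^sub>F k in sequentially. \<forall>x\<in>U. dist (u k x) (u0 x) < e"
        using uniform_limitD[OF ulim[OF cU U\<Omega>] e] .
      moreover have "\<forall>\<^sub>F k in sequentially. T k < e" using Tlim e by (rule order_tendstoD(2))
      ultimately have "\<forall>\<^sub>F k in sequentially. (\<forall>x\<in>U. dist (u k x) (u0 x) < e) \<and> T k < e \<and> G k
          \<and> least_super F (\<beta> k) U (u k)"
        using evG by eventually_elim auto
      then obtain k where k: "\<forall>x\<in>U. dist (u k x) (u0 x) < e" "T k < e" "G k" "least_super F (\<beta> k) U (u k)"
        using eventually_happens'[OF sequentially_bot] by blast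
      show "\<exists>u \<beta> T. 0 < T \<and> T < e \<and> (\<forall>x\<in>U. \<bar>u x - u0 x\<bar> < e) \<and> continuous_on U u
        \<and> (\<forall>x\<in>U. 0 \<le> u x) \<and> (\<forall>x\<in>U. super_at F \<beta> u x) \<and> least_super F \<beta> U u
        \<and> (\<forall>s. 0 \<le> \<beta> s) \<and> \<beta> 0 \<le> 0 \<and> (\<forall>s>0. \<beta> s \<le> \<gamma> * s powr (\<gamma> - 1))
        \<and> (\<forall>t\<ge>T. \<beta> t = \<gamma> * t powr (\<gamma> - 1))"
      proof (intro exI[of _ "u k"] exI[of _ "\<beta> k"] exI[of _ "T k"] conjI allI impI ballI)
        show "continuous_on U (u k)" using cuk U\<Omega> by (rule continuous_on_subset)
        show "0 \<le> \<beta> k s" for s unfolding \<beta>_def by (rule beta_eps_nonneg[OF \<rho> \<gamma> \<sigma>0 ep])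
        show "\<beta> k 0 \<le> 0" by (simp add: \<beta>_def beta_eps_def)
        show "\<beta> k s \<le> \<gamma> * s powr (\<gamma> - 1)" if "0 < s" for s
          unfolding \<beta>_def by (rule beta_eps_le[OF \<rho> \<gamma> \<sigma>0 ep that])
        show "\<beta> k t = \<gamma> * t powr (\<gamma> - 1)" if "T k \<le> t" for t
          unfolding \<beta>_def using that by (intro beta_eps_eq[OF \<rho> \<gamma> \<sigma>0 ep]) (simp add: T_def)
      qed (use k T0 U\<Omega> in \<open>auto simp: G_def dist_real_def\<close>)
    qed
    have cu0U: "continuous_on U u0" using cu0 U\<Omega> by (rule continuous_on_subset)
    note est = limit_estimates[OF \<gamma> cU cu0U modulus spread c0 L \<eta>(3) A0 A pick_all]
    have bd: "0 \<le> u0 x \<and> u0 x \<le> S" if "x \<in> U" for x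
    proof -
      have x: "x \<in> \<Omega>" using that U\<Omega> by blast
      have "\<forall>\<^sub>F k in sequentially. 0 \<le> u k x" "\<forall>\<^sub>F k in sequentially. u k x \<le> S"
        using evG x by (auto simp: G_def elim: eventually_mono)
      then show ?thesis using tendsto_lowerbound[OF lim[OF x]] tendsto_upperbound[OF lim[OF x]] by simp
    qed
    have X00: "u0 X = 0" using bd[OF X0] XP by (simp add: P_def)
    have modulus0: "u0 Y \<le> u0 y + M * m / D * dist Y y"
      if "0 < D" "0 < m" "cball Y D \<subseteq> U" "\<And>x. x \<in> cball Y D \<Longrightarrow> u0 x \<le> 4 * m" "m powr (\<gamma> - 1) * D\<^sup>2 \<le> m"
        "y \<in> cball Y D" for Y D m y
    proof -
      have "2 * L * m / D * dist Y y \<le> M * m / D * dist Y y"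
        using M that(1,2) by (intro mult_right_mono divide_right_mono) auto
      then show ?thesis using est(1)[OF that] by linarith
    qed
    have growth: "u0 Y \<le> C * (d\<^sup>2) powr (1 / (2 - \<gamma>))" if "0 < d" "d \<le> R / 4" "dist X Y \<le> d" for d Y
    proof (rule growth_at_zeros[where v = u0 and X = X and S = S, OF \<gamma> R M(1) _ _ _ _ C(1) C2 C3 X00 that])
      show "continuous_on (cball X R) u0" using cu0U XU by (rule continuous_on_subset)
      show "0 \<le> u0 x \<and> u0 x \<le> S" if "x \<in> cball X R" for x using bd that XU by blast
      show "u0 Y \<le> u0 y + M * m / D * dist Y y"
        if "0 < D" "0 < m" "cball Y D \<subseteq> cball X R" "\<And>x. x \<in> cball Y D \<Longrightarrow> u0 x \<le> 4 * m"
          "m powr (\<gamma> - 1) * D\<^sup>2 \<le> m" "y \<in> cball Y D" for Y D m y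
        by (rule modulus0[OF that(1,2) _ that(4-6)]) (use that(3) XU in auto)
      show "0 < u0 x"
        if "0 < t" "0 < h" "cball x0 (2*t) \<subseteq> cball X R" "\<And>x. x \<in> cball x0 (1 / (2 * M) * t) \<Longrightarrow> h \<le> u0 x"
          "h powr (\<gamma> - 1) * t\<^sup>2 \<le> c1 / 4 * h" "x \<in> cball x0 t" for x0 t h x
        by (rule est(2)[OF that(1,2) _ that(4-6)]) (use that(3) XU in auto)
    qed
    \<comment> \<open>With \<open>dist Z X < \<delta> / 8\<close> this places \<open>Y\<close>
      within \<open>3/8 * \<delta>\<close> of \<open>X\<close> and leaves \<open>cball Y r\<close>
      inside \<open>ball X \<delta>\<close>.\<close>
    define r where "r = \<delta> / 4"
    have r: "0 < r" using \<delta> by (simp add: r_def)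
    \<comment> \<open>Nondegeneracy wants a positive value at its centre, hence a nearby
      \<open>Z\<close> in place of the zero \<open>X\<close>.\<close>
    obtain Z where Z: "Z \<in> P" "dist Z X < \<delta> / 8" using near[of "\<delta> / 8"] \<delta> by auto
    have ZU: "cball Z r \<subseteq> U"
    proof -
      have "cball Z r \<subseteq> cball X R"
      proof
        fix y assume "y \<in> cball Z r"
        then show "y \<in> cball X R" using Z(2) \<delta> dist_triangle[of X y Z] by (simp add: r_def dist_commute)
      qed
      then show ?thesis using XU by blast
    qed
    have "0 < u0 Z" using Z(1) by (simp add: P_def)
    from est(3)[OF r ZU this] obtain Y where Y: "Y \<in> sphere Z r" "A * (r\<^sup>2) powr a \<le> u0 Y"
      unfolding a_def by blast
    have XY: "dist X Y \<le> 3/8 * \<delta>" using Y(1) Z(2) dist_triangle[of X Y Z] by (simp add: r_def dist_commute)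
    have Yd: "dist X y \<le> \<delta>" if "y \<in> cball Y r" for y
      using that XY \<delta>(1) dist_triangle[of X y Y] by (simp add: r_def)
    have YU: "cball Y r \<subseteq> U" using Yd \<delta> R XU by (force simp: subset_iff)
    \<comment> \<open>Growth from \<open>X\<close> bounds \<open>u0\<close> on
      \<open>cball Y r\<close> by this value, which is of the same order in \<delta> as the height
      at \<open>Y\<close>.\<close>
    define m where "m = C * (\<delta>\<^sup>2) powr a"
    have m: "0 < m" using C(1) \<delta>(1) by (simp add: m_def)
    have le_m: "u0 y \<le> m" if "y \<in> cball Y r" for y
      using growth[OF \<delta> Yd[OF that]] by (simp add: m_def a_def)
    have small: "m powr (\<gamma> - 1) * r\<^sup>2 \<le> m"
    proof -
      have "m powr (\<gamma> - 1) * r\<^sup>2 \<le> m powr (\<gamma> - 1) * \<delta>\<^sup>2"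
        using \<delta>(1) by (intro mult_left_mono power_mono) (auto simp: r_def)
      also have "\<dots> \<le> 1 powr (\<gamma> - 2) * m"
        by (rule scale_ineq[OF \<gamma> zero_less_one \<delta>(1)]) (use C(1) mult_right_mono[of 1 C "(\<delta>\<^sup>2) powr a"] in \<open>simp add: m_def a_def\<close>)
      finally show ?thesis by simp
    qed
    have Aeq: "A * (r\<^sup>2) powr a = A / (16 powr a * (M * C)) * (M * m)"
    proof -
      have "(r\<^sup>2) powr a = (\<delta>\<^sup>2) powr a / 16 powr a"
        using \<delta>(1) by (simp add: r_def power_divide powr_divide)
      then show ?thesis using M C by (simp add: m_def)
    qed
    have sub: "ball Y (\<theta> * \<delta>) \<subseteq> ball X \<delta> \<inter> P"
    proof
      fix y assume "y \<in> ball Y (\<theta> * \<delta>)"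
      then have y: "dist Y y < \<theta> * 4 * r" by (simp add: r_def)
      also have "\<theta> * 4 * r \<le> 1 * r" using th1 r by (intro mult_right_mono) auto
      finally have yr: "y \<in> cball Y r" "dist Y y < r" by simp_all
      have "u0 Y \<le> u0 y + M * m / r * dist Y y"
        by (rule modulus0[OF r m YU _ small yr(1)]) (use le_m m in force)
      moreover have "M * m / r * dist Y y < M * m / r * (\<theta> * 4 * r)"
        using y M m r by (intro mult_strict_left_mono) auto
      moreover have "M * m / r * (\<theta> * 4 * r) = \<theta> * 4 * (M * m)" using r by simp
      moreover have "\<theta> * 4 * (M * m) \<le> A / (16 powr a * (M * C)) * (M * m)"
        using th1(2) M m by (intro mult_right_mono) auto
      ultimately have "0 < u0 y" using Y(2) Aeq by linarith
      moreover have "y \<in> \<Omega>" using yr(1) YU U\<Omega> by blast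
      moreover have "dist X y < \<delta>" using yr(2) XY \<delta>(1) dist_triangle[of X y Y] by (simp add: r_def)
      ultimately show "y \<in> ball X \<delta> \<inter> P" by (simp add: P_def)
    qed
    show "\<theta> ^ CARD('n) \<le> measure lebesgue (ball X \<delta> \<inter> {x \<in> \<Omega>. 0 < u0 x}) / measure lebesgue (ball X \<delta>)"
      using measure_ball_ratio[OF \<delta>(1) th0 sub oP] by (simp add: P_def)
  qed
qed

end
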